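(* Let $d\ge1$ and fix constants $c$ and $\alpha$ such that $0<\sqrt{29}\,\alpha\le c<1$. Let $X=(X_t)_{t\ge0}$ be an isotropic unimodal Lévy process on $\mathbb{R}^d$ with radial jump density $j$. Let $R>0$, and let $\mathcal{A}$ and $\mathcal{U}$ be the cylinders $$\mathcal{A}:=(-R,R)\times B^{(d-1)}(0,R),\qquad \mathcal{U}:=\big((1+\alpha)R,(3+\alpha)R\big)\times B^{(d-1)}(0,R).$$ Let $f(x):=\mathbb{P}_x(X_{\tau_{\mathcal{A}}}\in\mathcal{U})$ and $x_0:=(1-\alpha)R\,e_1$, where $e_1=(1,0,\dots,0)$. Then $$f(-x_0)\le\left(\alpha^{-d}\,\frac{j(R)}{j(cR)}+2\,\mathbb{P}_0\left(X_{\tau_{B(0,\alpha R)}}\in B(0,10R)\right)\right)\sup_{B(0,(1-\alpha/2)R)}f .$$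
   Context: A Lévy process $X=(X_t)_{t\ge0}$ on $\mathbb{R}^d$ is a stochastic process with independent and stationary increments; it is assumed right-continuous with left limits. $\mathbb{P}_x$ denotes probability for the process started at $X_0=x$. $X$ is isotropic unimodal if for every $t>0$ there is a non-increasing $m_t:(0,\infty)\to[0,\infty)$ with $\mathbb{P}(X_t-X_0\in A)=\int_A m_t(|x|)\,dx$ for all measurable $A$ with $0\notin A$. Jump density: for an isotropic unimodal Lévy process there is a non-increasing function $j:(0,\infty)\to[0,\infty)$ such that the Lévy measure of $X$ is $j(|x|)\,dx$ on $\mathbb{R}^d\setminus\{0\}$; that is, for measurable $A\subseteq\mathbb{R}^d\setminus\{0\}$ with $0<\int_A j(|x|)\,dx<\infty$, jumps with displacement in $A$ occur according to a Poisson process of rate $\int_A j(|x|)\,dx$. ($X$ may in addition have a diffusion component.) Writing the quotient $j(R)/j(cR)$ presupposes $j(cR)>0$. $B(x_0,r)$ is the open Euclidean ball in $\mathbb{R}^d$, and $B^{(d-1)}(x_0,r)$ the open Euclidean ball in $\mathbb{R}^{d-1}$. For $U\subseteq\mathbb{R}^d$, $\tau_U:=\inf\{t\ge0:X_t\notin U\}$; an event $\{X_{\tau_U}\in A\}$ is understood not to occur if $\tau_U=\infty$. *)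

theory Defs
  imports "HOL-Probability.Probability"
begin

text \<open>
  The path property is only required almost surely. Nothing is assumed about the law of \<open>X 0\<close>;
  for a process started at a prescribed point see \<open>started_at\<close> below.
\<close>

locale levy_process = prob_space M
  for M :: "'w measure" and X :: "real \<Rightarrow> 'w \<Rightarrow> 'a :: euclidean_space" +
  assumes random_variable_X: "\<And>t. 0 \<le> t \<Longrightarrow> random_variable borel (X t)"
    and independent_increments:
      "\<And>(n :: nat) (t :: nat \<Rightarrow> real). 0 \<le> t 0 \<Longrightarrow> (\<And>i. i < n \<Longrightarrow> t i \<le> t (Suc i)) \<Longrightarrow>
         indep_vars (\<lambda>_. borel) (\<lambda>i \<omega>. X (t (Suc i)) \<omega> - X (t i) \<omega>) {..<n}"
    and stationary_increments:
      "\<And>s h. 0 \<le> s \<Longrightarrow> 0 \<le> h \<Longrightarrow>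
         distr M borel (\<lambda>\<omega>. X (s + h) \<omega> - X s \<omega>) = distr M borel (\<lambda>\<omega>. X h \<omega> - X 0 \<omega>)"
    and cadlag:
      "AE \<omega> in M. (\<forall>t\<ge>0. continuous (at_right t) (\<lambda>s. X s \<omega>)) \<and>
                  (\<forall>t>0. \<exists>l. ((\<lambda>s. X s \<omega>) \<longlongrightarrow> l) (at_left t))"

locale isotropic_unimodal_levy_process = levy_process +
  assumes isotropic_unimodal:
    "\<And>t. 0 < t \<Longrightarrow> \<exists>m :: real \<Rightarrow> real. (\<forall>r>0. 0 \<le> m r) \<and> antimono_on {0<..} m \<and>
       (\<forall>A \<in> sets borel. 0 \<notin> A \<longrightarrow>
          emeasure M {\<omega> \<in> space M. X t \<omega> - X 0 \<omega> \<in> A} =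
          (\<integral>\<^sup>+ x \<in> A. ennreal (m (norm x)) \<partial>lborel))"

definition jump_times :: "(real \<Rightarrow> 'w \<Rightarrow> 'a :: euclidean_space) \<Rightarrow> 'a set \<Rightarrow> 'w \<Rightarrow> real set"
  where "jump_times X A \<omega> = {t. 0 < t \<and> X t \<omega> - Lim (at_left t) (\<lambda>s. X s \<omega>) \<in> A}"

text \<open>
  A Poisson process on \<open>(0, \<infinity>)\<close>, given by its random set \<open>T\<close> of event times. Finiteness has to be
  stated separately, because \<open>card\<close> is 0 on infinite sets.
\<close>

definition poisson_process :: "'w measure \<Rightarrow> ('w \<Rightarrow> real set) \<Rightarrow> real \<Rightarrow> bool"
  where "poisson_process M T rate \<longleftrightarrow>
    (AE \<omega> in M. \<forall>t. finite (T \<omega> \<inter> {0<..t})) \<and>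
    (\<forall>s t. 0 \<le> s \<and> s < t \<longrightarrow>
       distr M (count_space UNIV) (\<lambda>\<omega>. card (T \<omega> \<inter> {s<..t})) =
       measure_pmf (poisson_pmf (rate * (t - s)))) \<and>
    (\<forall>(n :: nat) (t :: nat \<Rightarrow> real). 0 \<le> t 0 \<and> (\<forall>i<n. t i \<le> t (Suc i)) \<longrightarrow>
       prob_space.indep_vars M (\<lambda>_. count_space UNIV)
         (\<lambda>i \<omega>. card (T \<omega> \<inter> {t i<..t (Suc i)})) {..<n})"

text \<open>
  \<open>j\<close> is a radial jump density of \<open>X\<close>: the Levy measure is \<open>j (norm x) dx\<close>. Its values at
  arguments \<open>\<le> 0\<close> are irrelevant. Counts of jumps are taken in the completed probability space,
  since on the exceptional null set of irregular paths they need not be measurable. Sets \<open>A\<close> to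
  which \<open>j\<close> gives mass 0 need no clause of their own unless \<open>j\<close> vanishes identically: compare the
  jumps in \<open>B\<close> and in \<open>A \<union> B\<close> for some \<open>B\<close> of positive finite mass.
\<close>

definition jump_density ::
    "'w measure \<Rightarrow> (real \<Rightarrow> 'w \<Rightarrow> 'a :: euclidean_space) \<Rightarrow> (real \<Rightarrow> real) \<Rightarrow> bool"
  where "jump_density M X j \<longleftrightarrow>
    (\<forall>r>0. 0 \<le> j r) \<and> antimono_on {0<..} j \<and>
    (\<forall>A \<in> sets borel. 0 \<notin> A \<longrightarrow>
       (let I = (\<integral>\<^sup>+ x \<in> A. ennreal (j (norm x)) \<partial>lborel)
        in 0 < I \<and> I < \<infinity> \<longrightarrow> poisson_process (completion M) (jump_times X A) (enn2real I)))"

definition started_at ::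
    "'a \<Rightarrow> (real \<Rightarrow> 'w \<Rightarrow> 'a :: euclidean_space) \<Rightarrow> real \<Rightarrow> 'w \<Rightarrow> 'a"
  where "started_at x X t \<omega> = x + (X t \<omega> - X 0 \<omega>)"

definition exit_time ::
    "(real \<Rightarrow> 'w \<Rightarrow> 'a :: euclidean_space) \<Rightarrow> 'a set \<Rightarrow> 'w \<Rightarrow> ereal"
  where "exit_time X U \<omega> = Inf {ereal t | t. 0 \<le> t \<and> X t \<omega> \<notin> U}"

definition exits_into ::
    "(real \<Rightarrow> 'w \<Rightarrow> 'a :: euclidean_space) \<Rightarrow> 'a set \<Rightarrow> 'a set \<Rightarrow> 'w \<Rightarrow> bool"
  where "exits_into X U A \<omega> \<longleftrightarrow>
    exit_time X U \<omega> < \<infinity> \<and> X (real_of_ereal (exit_time X U \<omega>)) \<omega> \<in> A"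

text \<open>
  The probability, for the process started at \<open>x\<close>, that it lies in \<open>A\<close> when it first leaves \<open>U\<close>.
  The law of the process started at \<open>x\<close> is realised by translating the paths. The completion is
  essential: exit times of open sets by right-continuous paths are in general measurable only after
  completion, and \<open>measure\<close> is 0 on non-measurable sets.
\<close>

definition exit_prob ::
    "'w measure \<Rightarrow> (real \<Rightarrow> 'w \<Rightarrow> 'a :: euclidean_space) \<Rightarrow> 'a \<Rightarrow> 'a set \<Rightarrow> 'a set \<Rightarrow> real"
  where "exit_prob M X x U A =
    measure (completion M) {\<omega> \<in> space M. exits_into (started_at x X) U A \<omega>}"

text \<open>
  The set \<open>I \<times> B\<close> with \<open>B\<close> the open Euclidean ball of radius \<open>r\<close> about 0 in the coordinates other
  than \<open>k\<close>. In dimension 1 no coordinates are left, \<open>L2_set\<close> is 0, and \<open>B\<close> is the one-point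
  space \<open>\<real>\<^sup>0\<close> whenever \<open>r > 0\<close>.
\<close>

definition cylinder :: "'n :: finite \<Rightarrow> real set \<Rightarrow> real \<Rightarrow> (real ^ 'n) set"
  where "cylinder k I r = {x. x $ k \<in> I \<and> L2_set (\<lambda>i. x $ i) (UNIV - {k}) < r}"

end

theory Submission
  imports Defs
begin

text \<open>
  Sampling \<open>X\<close> at the times \<open>k / 2^n\<close> gives a random walk whose step law has, apart from an atom at
  0, a radially decreasing density \<open>m\<^sub>n\<close>; let \<open>F\<^sub>n\<close> be the analogue of \<open>f\<close> for it. Stop the walk
  started at \<open>-x\<^sub>0\<close> when it leaves \<open>B(-x\<^sub>0, \<alpha>R)\<close>. It may land in \<open>\<U>\<close> or in the slab
  \<open>{y \<in> \<A>. y\<^sub>1 > (1 - \<alpha>)R}\<close>, by a step of length at least \<open>(2 - 3\<alpha>)R > R\<close>. The union of these two sets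
  has \<open>\<alpha>\<^sup>-\<^sup>d\<close> times the volume of a cylinder \<open>D \<subseteq> \<U>\<close> that every point of \<open>B(x\<^sub>0, \<alpha>R)\<close> reaches by a step of
  length at most \<open>5.31 \<alpha>R < \<surd>29 \<alpha>R \<le> cR\<close>, and comparing step by step with the walk started at \<open>x\<^sub>0\<close>
  bounds this contribution by \<open>\<alpha>\<^sup>-\<^sup>d m\<^sub>n((2 - 3\<alpha>)R) / m\<^sub>n(5.31 \<alpha>R) F\<^sub>n(x\<^sub>0)\<close>. Otherwise it lands at some
  \<open>y \<in> \<A>\<close> with \<open>y\<^sub>1 \<le> (1 - \<alpha>)R\<close>, and reflections in coordinate hyperplanes show
  \<open>F\<^sub>n(y) \<le> F\<^sub>n(max 0 y\<^sub>1 e\<^sub>1)\<close>.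

  To let \<open>n\<close> tend to infinity, one needs that \<open>2^n m\<^sub>n\<close> is asymptotically bounded by \<open>j\<close> on both sides,
  which follows by comparing the probabilities of having no grid increment and no jump in an annulus, and
  that the exit events of the walks approximate those of \<open>X\<close>. They do, except on paths that touch a
  boundary before they jump. For a fixed path, the starting points for which this happens lie in countably
  many frontiers of convex sets, hence form a null set; since the first nonzero position of the walk has a density, a fixed
  starting point is harmless as well.
\<close>

section \<open>Killed random walks\<close>

definition walk_step :: "'a::euclidean_space measure \<Rightarrow> 'a set \<Rightarrow> ('a \<Rightarrow> ennreal) \<Rightarrow> 'a \<Rightarrow> ennreal"
  where "walk_step p A \<phi> x = indicator A x * (\<integral>\<^sup>+z. \<phi> (x + z) \<partial>p)"

definition walk_potential :: "'a::euclidean_space measure \<Rightarrow> 'a set \<Rightarrow> ('a \<Rightarrow> ennreal) \<Rightarrow> 'a \<Rightarrow> ennreal"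
  where "walk_potential p A \<phi> x = (\<Sum>k. (walk_step p A ^^ k) \<phi> x)"

lemma walk_step_mono:
  assumes "A \<subseteq> A'" "\<And>x. \<phi> x \<le> \<psi> x"
  shows "walk_step p A \<phi> x \<le> walk_step p A' \<psi> x"
  unfolding walk_step_def using assms
  by (intro mult_mono nn_integral_mono) (auto split: split_indicator)

lemma walk_step_pow_mono:
  assumes "A \<subseteq> A'" "\<And>x. \<phi> x \<le> \<psi> x"
  shows "(walk_step p A ^^ k) \<phi> x \<le> (walk_step p A' ^^ k) \<psi> x"
  using assms(2) by (induction k arbitrary: x) (auto intro!: walk_step_mono assms(1))

lemma walk_potential_mono:
  assumes "A \<subseteq> A'" "\<And>x. \<phi> x \<le> \<psi> x"
  shows "walk_potential p A \<phi> x \<le> walk_potential p A' \<psi> x"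
  unfolding walk_potential_def
  by (intro suminf_le walk_step_pow_mono assms) auto

lemma walk_step_pow_shift:
  "(walk_step p A ^^ k) \<phi> (x + v) = (walk_step p ((\<lambda>y. y - v) ` A) ^^ k) (\<lambda>y. \<phi> (y + v)) x"
proof (induction k arbitrary: x)
  case (Suc k)
  have "x + v \<in> A \<longleftrightarrow> x \<in> (\<lambda>y. y - v) ` A"
    by (auto simp: image_iff intro!: bexI[of _ "x + v"])
  then have "indicator A (x + v) = (indicator ((\<lambda>y. y - v) ` A) x :: ennreal)"
    by (simp add: indicator_def)
  moreover have "(\<lambda>z. (walk_step p A ^^ k) \<phi> (x + v + z))
      = (\<lambda>z. (walk_step p ((\<lambda>y. y - v) ` A) ^^ k) (\<lambda>y. \<phi> (y + v)) (x + z))"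
    by (simp add: Suc[symmetric] add_ac)
  ultimately show ?case
    unfolding funpow.simps comp_apply walk_step_def[of _ _ "(walk_step p _ ^^ k) _"] by metis
qed simp

lemma walk_potential_shift:
  "walk_potential p A \<phi> (x + v) = walk_potential p ((\<lambda>y. y - v) ` A) (\<lambda>y. \<phi> (y + v)) x"
  unfolding walk_potential_def walk_step_pow_shift ..

locale step_law = prob_space p for p :: "'a::euclidean_space measure" +
  assumes sets_p [measurable_cong, simp]: "sets p = sets borel"
begin

lemma space_p [simp]: "space p = UNIV"
  using sets_eq_imp_space_eq[OF sets_p] by simp

lemma walk_step_measurable [measurable]:
  assumes [measurable]: "\<phi> \<in> borel_measurable borel" "A \<in> sets borel"
  shows "walk_step p A \<phi> \<in> borel_measurable borel"
  unfolding walk_step_def by measurable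

lemma walk_step_pow_measurable [measurable]:
  assumes [measurable]: "\<phi> \<in> borel_measurable borel" "A \<in> sets borel"
  shows "(walk_step p A ^^ k) \<phi> \<in> borel_measurable borel"
  by (induction k) auto

lemma walk_potential_measurable [measurable]:
  assumes [measurable]: "\<phi> \<in> borel_measurable borel" "A \<in> sets borel"
  shows "walk_potential p A \<phi> \<in> borel_measurable borel"
  unfolding walk_potential_def by measurable

lemma walk_step_add:
  assumes [measurable]: "\<phi> \<in> borel_measurable borel" "\<psi> \<in> borel_measurable borel"
  shows "walk_step p A (\<lambda>x. \<phi> x + \<psi> x) x = walk_step p A \<phi> x + walk_step p A \<psi> x"
  unfolding walk_step_def by (subst nn_integral_add) (auto simp: distrib_left)

lemma walk_step_cmult:
  assumes [measurable]: "\<phi> \<in> borel_measurable borel"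
  shows "walk_step p A (\<lambda>x. c * \<phi> x) x = c * walk_step p A \<phi> x"
  unfolding walk_step_def by (subst nn_integral_cmult) (auto simp: mult_ac)

lemma walk_step_pow_add:
  assumes [measurable]: "\<phi> \<in> borel_measurable borel" "\<psi> \<in> borel_measurable borel" "A \<in> sets borel"
  shows "(walk_step p A ^^ k) (\<lambda>x. \<phi> x + \<psi> x) x = (walk_step p A ^^ k) \<phi> x + (walk_step p A ^^ k) \<psi> x"
proof (induction k arbitrary: x)
  case (Suc k)
  have "(walk_step p A ^^ Suc k) (\<lambda>x. \<phi> x + \<psi> x) x
      = walk_step p A (\<lambda>x. (walk_step p A ^^ k) \<phi> x + (walk_step p A ^^ k) \<psi> x) x"
    by (simp add: Suc walk_step_def[of p A "(walk_step p A ^^ k) (\<lambda>x. \<phi> x + \<psi> x)"]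
        walk_step_def[of p A "\<lambda>x. (walk_step p A ^^ k) \<phi> x + (walk_step p A ^^ k) \<psi> x"])
  then show ?case
    by (simp add: walk_step_add)
qed simp

lemma walk_step_pow_cmult:
  assumes [measurable]: "\<phi> \<in> borel_measurable borel" "A \<in> sets borel"
  shows "(walk_step p A ^^ k) (\<lambda>x. c * \<phi> x) x = c * (walk_step p A ^^ k) \<phi> x"
proof (induction k arbitrary: x)
  case (Suc k)
  have "(walk_step p A ^^ Suc k) (\<lambda>x. c * \<phi> x) x
      = walk_step p A (\<lambda>x. c * (walk_step p A ^^ k) \<phi> x) x"
    by (simp add: Suc walk_step_def[of p A "(walk_step p A ^^ k) (\<lambda>x. c * \<phi> x)"]
        walk_step_def[of p A "\<lambda>x. c * (walk_step p A ^^ k) \<phi> x"])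
  then show ?case
    by (simp add: walk_step_cmult)
qed simp

lemma walk_potential_add:
  assumes [measurable]: "\<phi> \<in> borel_measurable borel" "\<psi> \<in> borel_measurable borel" "A \<in> sets borel"
  shows "walk_potential p A (\<lambda>x. \<phi> x + \<psi> x) x = walk_potential p A \<phi> x + walk_potential p A \<psi> x"
  unfolding walk_potential_def walk_step_pow_add[OF assms] by (rule suminf_add[symmetric]) auto

lemma walk_potential_cmult:
  assumes [measurable]: "\<phi> \<in> borel_measurable borel" "A \<in> sets borel"
  shows "walk_potential p A (\<lambda>x. c * \<phi> x) x = c * walk_potential p A \<phi> x"
  unfolding walk_potential_def walk_step_pow_cmult[OF assms] by (rule ennreal_suminf_cmult)

lemma walk_potential_unfold:
  assumes [measurable]: "\<phi> \<in> borel_measurable borel" "A \<in> sets borel"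
  shows "walk_potential p A \<phi> x = \<phi> x + walk_step p A (walk_potential p A \<phi>) x"
proof -
  have "walk_step p A (walk_potential p A \<phi>) x = (\<Sum>k. walk_step p A ((walk_step p A ^^ k) \<phi>) x)"
    unfolding walk_step_def[of _ _ "walk_potential p A \<phi>"] walk_potential_def
    by (subst nn_integral_suminf) (auto simp: walk_step_def[of _ _ "(walk_step p A ^^ _) \<phi>"] ennreal_suminf_cmult)
  then show ?thesis
    unfolding walk_potential_def by (subst suminf_offset[of _ 1]) auto
qed

lemma walk_potential_indicator_le_1:
  assumes [measurable]: "A \<in> sets borel" "U \<in> sets borel" and disj: "A \<inter> U = {}"
  shows "walk_potential p A (indicator U) x \<le> 1"
proof -
  have "(\<Sum>j<n. (walk_step p A ^^ j) (indicator U) x) \<le> 1" for n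
  proof (induction n arbitrary: x)
    case (Suc n)
    have "(\<Sum>j<Suc n. (walk_step p A ^^ j) (indicator U) x)
        = indicator U x + walk_step p A (\<lambda>x. \<Sum>j<n. (walk_step p A ^^ j) (indicator U) x) x"
      unfolding sum.lessThan_Suc_shift
      by (simp add: walk_step_def nn_integral_sum sum_distrib_left)
    also have "\<dots> \<le> indicator U x + indicator A x * (\<integral>\<^sup>+z. 1 \<partial>p)"
      unfolding walk_step_def[of _ _ "\<lambda>x. \<Sum>j<n. _ j x"]
      by (intro add_mono mult_left_mono nn_integral_mono Suc) auto
    also have "\<dots> \<le> 1"
      using disj emeasure_space_1 by (auto split: split_indicator)
    finally show ?case .
  qed simp
  then show ?thesis
    unfolding walk_potential_def by (intro suminf_le_const) auto
qed

text \<open>The inequality (strong Markov at the exit from \<open>B\<close>) suffices, so that one need not know that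
  the walk leaves \<open>B\<close>.\<close>

lemma walk_potential_le_subset:
  assumes [measurable]: "A \<in> sets borel" "B \<in> sets borel" "U \<in> sets borel"
    and BA: "B \<subseteq> A" and AU: "A \<inter> U = {}"
  shows "walk_potential p A (indicator U) x
       \<le> walk_potential p B (\<lambda>y. indicator (-B) y * walk_potential p A (indicator U) y) x"
proof -
  define F where "F = walk_potential p A (indicator U)"
  define W where "W = walk_potential p B (\<lambda>y. indicator (-B) y * F y)"
  have [measurable]: "F \<in> borel_measurable borel" "W \<in> borel_measurable borel"
    unfolding F_def W_def by measurable
  have W: "W x = indicator (-B) x * F x + walk_step p B W x" for x
    unfolding W_def by (rule walk_potential_unfold) measurable
  have "(\<Sum>j<n. (walk_step p A ^^ j) (indicator U) x) \<le> W x" for n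
  proof (induction n arbitrary: x)
    case (Suc n)
    show ?case
    proof (cases "x \<in> B")
      case True
      have "(\<Sum>j<Suc n. (walk_step p A ^^ j) (indicator U) x)
          = indicator U x + walk_step p A (\<lambda>x. \<Sum>j<n. (walk_step p A ^^ j) (indicator U) x) x"
        unfolding sum.lessThan_Suc_shift
        by (simp add: walk_step_def nn_integral_sum sum_distrib_left)
      also have "\<dots> = walk_step p B (\<lambda>x. \<Sum>j<n. (walk_step p A ^^ j) (indicator U) x) x"
        using True BA AU by (auto simp: walk_step_def[of _ _ "\<lambda>x. \<Sum>j<n. _ j x"] indicator_def)
      also have "\<dots> \<le> walk_step p B W x"
        by (intro walk_step_mono Suc) auto
      finally show ?thesis
        using True by (subst W) auto
    next
      case False
      have "(\<Sum>j<Suc n. (walk_step p A ^^ j) (indicator U) x) \<le> F x"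
        unfolding F_def walk_potential_def by (intro sum_le_suminf) auto
      also have "\<dots> \<le> W x"
        using False by (subst W) auto
      finally show ?thesis .
    qed
  qed simp
  then show ?thesis
    unfolding F_def[symmetric] W_def[symmetric] unfolding F_def walk_potential_def
    by (intro suminf_le_const) auto
qed

end

locale unimodal_law = step_law p for p :: "'a::euclidean_space measure" +
  fixes m :: "real \<Rightarrow> real"
  assumes m_nonneg: "\<And>r. 0 < r \<Longrightarrow> 0 \<le> m r"
    and m_antimono: "antimono_on {0<..} m"
    and emeasure_p: "\<And>A. A \<in> sets borel \<Longrightarrow> 0 \<notin> A \<Longrightarrow>
          emeasure p A = (\<integral>\<^sup>+ x \<in> A. ennreal (m (norm x)) \<partial>lborel)"

lemma borel_measurable_antimono_norm:
  fixes m :: "real \<Rightarrow> real"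
  assumes "antimono_on {0<..} m"
  shows "(\<lambda>x::'a::euclidean_space. if x = 0 then c else ennreal (m (norm x))) \<in> borel_measurable borel"
proof -
  have "mono_on {0<..} (\<lambda>r. - m r)"
    using assms by (auto simp: monotone_on_def)
  then have "(\<lambda>r. - m r) \<in> borel_measurable (restrict_space borel {0<..})"
    by (rule borel_measurable_mono_on_fnc)
  then have "(\<lambda>r. indicator {0<..} r *\<^sub>R (- m r)) \<in> borel_measurable borel"
    by (subst (asm) borel_measurable_restrict_space_iff) auto
  then have [measurable]: "(\<lambda>r. - (indicator {0<..} r *\<^sub>R (- m r))) \<in> borel_measurable borel"
    by measurable
  have "(\<lambda>x::'a. if x = 0 then c else ennreal (- (indicator {0<..} (norm x) *\<^sub>R (- m (norm x))))) \<in> borel_measurable borel"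
    by measurable
  also have "(\<lambda>x::'a. if x = 0 then c else ennreal (- (indicator {0<..} (norm x) *\<^sub>R (- m (norm x)))))
      = (\<lambda>x::'a. if x = 0 then c else ennreal (m (norm x)))"
    by (auto simp: fun_eq_iff indicator_def)
  finally show ?thesis .
qed

lemma ennreal_rearrangement:
  fixes u v c d :: ennreal
  assumes "u \<le> v" "c \<le> d"
  shows "u * d + v * c \<le> u * c + v * d"
proof -
  obtain w e where "v = u + w" "d = c + e"
    using assms by (auto simp: le_iff_add)
  then show ?thesis
    by (simp add: algebra_simps) 
qed

definition coord_refl :: "'a::euclidean_space \<Rightarrow> real \<Rightarrow> 'a \<Rightarrow> 'a"
  where "coord_refl b h x = x + (2 * (h - x \<bullet> b)) *\<^sub>R b"

lemma coord_refl_inner: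
  assumes "b \<in> Basis"
  shows "coord_refl b h x \<bullet> b = 2 * h - x \<bullet> b"
  using assms by (simp add: coord_refl_def inner_add_left)

lemma coord_refl_involution:
  assumes "b \<in> Basis"
  shows "coord_refl b h (coord_refl b h x) = x"
  using assms by (simp add: coord_refl_def inner_add_left algebra_simps)

lemma norm_coord_refl_diff:
  assumes "b \<in> Basis"
  shows "norm (coord_refl b h y - coord_refl b h x) = norm (y - x)"
proof -
  have "coord_refl b h y - coord_refl b h x = (y - x) - (2 * ((y - x) \<bullet> b)) *\<^sub>R b"
    by (simp add: coord_refl_def algebra_simps inner_diff_left)
  then have "(norm (coord_refl b h y - coord_refl b h x))\<^sup>2 = (norm (y - x))\<^sup>2"
    using assms by (simp add: power2_norm_eq_inner inner_diff_left inner_diff_right inner_commute)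
  then show ?thesis
    by simp
qed

lemma norm_coord_refl_cross:
  assumes "b \<in> Basis"
  shows "(norm (y - coord_refl b h x))\<^sup>2 = (norm (y - x))\<^sup>2 + 4 * (h - x \<bullet> b) * (h - y \<bullet> b)"
proof -
  have "y - coord_refl b h x = (y - x) - (2 * (h - x \<bullet> b)) *\<^sub>R b"
    by (simp add: coord_refl_def algebra_simps)
  moreover have "(norm (u - t *\<^sub>R b))\<^sup>2 = (norm u)\<^sup>2 - 2 * t * (u \<bullet> b) + t\<^sup>2" for u t
    using assms unfolding power2_norm_eq_inner
    by (simp add: inner_diff_left inner_diff_right inner_commute power2_eq_square algebra_simps)
  ultimately have "(norm (y - coord_refl b h x))\<^sup>2
      = (norm (y - x))\<^sup>2 - 2 * (2 * (h - x \<bullet> b)) * ((y - x) \<bullet> b) + (2 * (h - x \<bullet> b))\<^sup>2"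
    by metis
  then show ?thesis
    by (simp add: algebra_simps power2_eq_square inner_diff_left)
qed

lemma coord_refl_measurable [measurable]: "coord_refl b h \<in> borel_measurable borel"
  unfolding coord_refl_def by measurable

lemma lborel_distr_coord_refl:
  fixes b :: "'a::euclidean_space"
  assumes b: "b \<in> Basis"
  shows "distr lborel borel (coord_refl b h) = lborel"
proof -
  define c where "c j = (if j = b then -1 else 1::real)" for j
  have eq: "(2 * h) *\<^sub>R b + (\<Sum>j\<in>Basis. (c j * (x \<bullet> j)) *\<^sub>R j) = coord_refl b h x" for x
  proof -
    have "(\<Sum>j\<in>Basis. (c j * (x \<bullet> j)) *\<^sub>R j)
        = (\<Sum>j\<in>Basis. (x \<bullet> j) *\<^sub>R j + (if j = b then (- 2 * (x \<bullet> j)) *\<^sub>R j else 0))"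
      by (intro sum.cong) (auto simp: c_def algebra_simps scaleR_2[symmetric])
    also have "\<dots> = x - (2 * (x \<bullet> b)) *\<^sub>R b"
      using b by (simp add: sum.distrib euclidean_representation)
    finally show ?thesis
      by (simp add: coord_refl_def algebra_simps)
  qed
  have "lborel = density (distr lborel borel (\<lambda>x. (2 * h) *\<^sub>R b + (\<Sum>j\<in>Basis. (c j * (x \<bullet> j)) *\<^sub>R j)))
      (\<lambda>_. \<Prod>j\<in>(Basis::'a set). \<bar>c j\<bar>)"
    by (rule lborel_affine_euclidean) (auto simp: c_def)
  also have "(\<Prod>j\<in>(Basis::'a set). \<bar>c j\<bar>) = 1"
    by (intro prod.neutral) (auto simp: c_def)
  finally show ?thesis
    unfolding eq by (simp add: density_1)
qed

lemma nn_integral_lborel_coord_refl: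
  assumes "b \<in> Basis" and [measurable]: "f \<in> borel_measurable borel"
  shows "(\<integral>\<^sup>+x. f (coord_refl b h x) \<partial>lborel) = (\<integral>\<^sup>+x. f x \<partial>lborel)"
  by (subst (2) lborel_distr_coord_refl[OF assms(1), of h, symmetric]) (simp add: nn_integral_distr)

context unimodal_law
begin

text \<open>The value at 0, a null set, is chosen so that the density is radially decreasing everywhere.\<close>

definition dens :: "'a \<Rightarrow> ennreal"
  where "dens x = (if x = 0 then \<top> else ennreal (m (norm x)))"

lemma dens_measurable [measurable]: "dens \<in> borel_measurable borel"
  unfolding dens_def using m_antimono by (rule borel_measurable_antimono_norm)

lemma dens_antimono: "norm x \<le> norm y \<Longrightarrow> dens y \<le> dens x"
  using m_antimono by (auto simp: dens_def monotone_on_def intro!: ennreal_leI)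

lemma density_dens: "density p (indicator (-{0})) = density lborel dens"
proof (rule measure_eqI)
  fix A assume "A \<in> sets (density p (indicator (-{0})))"
  then have [measurable]: "A \<in> sets borel"
    by simp
  have "emeasure (density p (indicator (-{0}))) A = emeasure p (A - {0})"
    by (simp add: emeasure_density Diff_eq Int_commute flip: indicator_inter_arith)
  also have "\<dots> = (\<integral>\<^sup>+ x \<in> A - {0}. ennreal (m (norm x)) \<partial>lborel)"
    by (rule emeasure_p) auto
  also have "\<dots> = (\<integral>\<^sup>+ x \<in> A. dens x \<partial>lborel)"
  proof (rule nn_integral_cong_AE)
    have "AE x in lborel. x \<noteq> (0::'a)"
      by (rule AE_lborel_singleton)
    then show "AE x in lborel. ennreal (m (norm x)) * indicator (A - {0}) x = dens x * indicator A x"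
      by eventually_elim (auto simp: dens_def split: split_indicator)
  qed
  also have "\<dots> = emeasure (density lborel dens) A"
    by (simp add: emeasure_density)
  finally show "emeasure (density p (indicator (-{0}))) A = emeasure (density lborel dens) A" .
qed simp

lemma nn_integral_p:
  assumes [measurable]: "\<phi> \<in> borel_measurable borel"
  shows "(\<integral>\<^sup>+z. \<phi> z \<partial>p) = emeasure p {0} * \<phi> 0 + (\<integral>\<^sup>+z. dens z * \<phi> z \<partial>lborel)"
proof -
  have "(\<integral>\<^sup>+z. \<phi> z \<partial>p) = (\<integral>\<^sup>+z. indicator {0} z * \<phi> z + indicator (-{0}) z * \<phi> z \<partial>p)"
    by (intro nn_integral_cong) (auto split: split_indicator)
  also have "\<dots> = (\<integral>\<^sup>+z. indicator {0} z * \<phi> z \<partial>p) + (\<integral>\<^sup>+z. indicator (-{0}) z * \<phi> z \<partial>p)"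
    by (intro nn_integral_add) auto
  also have "(\<integral>\<^sup>+z. indicator {0} z * \<phi> z \<partial>p) = (\<integral>\<^sup>+z. \<phi> 0 * indicator {0} z \<partial>p)"
    by (intro nn_integral_cong) (auto split: split_indicator)
  also have "(\<integral>\<^sup>+z. indicator (-{0}) z * \<phi> z \<partial>p) = (\<integral>\<^sup>+z. \<phi> z \<partial>density p (indicator (-{0})))"
    by (subst nn_integral_density) auto
  also have "\<dots> = (\<integral>\<^sup>+z. dens z * \<phi> z \<partial>lborel)"
    unfolding density_dens by (subst nn_integral_density) auto
  finally show ?thesis
    by (simp add: nn_integral_cmult mult.commute)
qed

lemma nn_integral_p_shift:
  assumes [measurable]: "\<phi> \<in> borel_measurable borel"
  shows "(\<integral>\<^sup>+z. \<phi> (x + z) \<partial>p) = emeasure p {0} * \<phi> x + (\<integral>\<^sup>+y. dens (y - x) * \<phi> y \<partial>lborel)"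
proof -
  have "(\<integral>\<^sup>+y. dens (y - x) * \<phi> y \<partial>lborel) = (\<integral>\<^sup>+z. dens z * \<phi> (x + z) \<partial>lborel)"
    by (subst lborel_distr_plus[of x, symmetric]) (simp add: nn_integral_distr)
  then show ?thesis
    by (simp add: nn_integral_p)
qed

lemma reflection_mean_mono:
  assumes [measurable]: "\<phi> \<in> borel_measurable borel" and b: "b \<in> Basis"
    and \<phi>: "\<And>x. 0 < s * (x \<bullet> b - h) \<Longrightarrow> \<phi> x \<le> \<phi> (coord_refl b h x)"
    and x: "0 < s * (x \<bullet> b - h)"
  shows "(\<integral>\<^sup>+z. \<phi> (x + z) \<partial>p) \<le> (\<integral>\<^sup>+z. \<phi> (coord_refl b h x + z) \<partial>p)"
proof -
  let ?r = "coord_refl b h"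
  have 1: "dens (?r y - ?r x) = dens (y - x)" for y x
    by (intro antisym dens_antimono) (simp_all add: norm_coord_refl_diff[OF b])
  have 2: "dens (?r y - x) = dens (y - ?r x)" for y x
    using 1[of y "?r x"] by (simp add: coord_refl_involution[OF b])
  have I: "(\<integral>\<^sup>+y. dens (y - z) * \<phi> y \<partial>lborel) + (\<integral>\<^sup>+y. dens (y - z) * \<phi> y \<partial>lborel)
      = (\<integral>\<^sup>+y. \<phi> y * dens (y - z) + \<phi> (?r y) * dens (y - ?r z) \<partial>lborel)" for z
  proof -
    have "(\<integral>\<^sup>+y. dens (y - z) * \<phi> y \<partial>lborel) = (\<integral>\<^sup>+y. dens (?r y - z) * \<phi> (?r y) \<partial>lborel)"
      by (rule nn_integral_lborel_coord_refl[OF b, symmetric]) measurable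
    then have "(\<integral>\<^sup>+y. dens (y - z) * \<phi> y \<partial>lborel) + (\<integral>\<^sup>+y. dens (y - z) * \<phi> y \<partial>lborel)
      = (\<integral>\<^sup>+y. dens (y - z) * \<phi> y \<partial>lborel) + (\<integral>\<^sup>+y. dens (?r y - z) * \<phi> (?r y) \<partial>lborel)"
      by simp
    also have "\<dots> = (\<integral>\<^sup>+y. dens (y - z) * \<phi> y + dens (?r y - z) * \<phi> (?r y) \<partial>lborel)"
      by (rule nn_integral_add[symmetric]) measurable
    finally show ?thesis
      by (simp add: 2 mult.commute)
  qed
  have "(\<integral>\<^sup>+y. dens (y - x) * \<phi> y \<partial>lborel) + (\<integral>\<^sup>+y. dens (y - x) * \<phi> y \<partial>lborel)
      \<le> (\<integral>\<^sup>+y. dens (y - ?r x) * \<phi> y \<partial>lborel) + (\<integral>\<^sup>+y. dens (y - ?r x) * \<phi> y \<partial>lborel)"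
    unfolding I coord_refl_involution[OF b]
  proof (intro nn_integral_mono)
    fix y :: 'a
    have cross: "(norm (y - ?r x))\<^sup>2 = (norm (y - x))\<^sup>2 + 4 * ((x \<bullet> b - h) * (y \<bullet> b - h))"
      by (simp add: norm_coord_refl_cross[OF b] algebra_simps)
    consider "0 < s * (y \<bullet> b - h)" | "s * (y \<bullet> b - h) < 0" | "y \<bullet> b = h"
      using x by (metis eq_iff_diff_eq_0 linorder_neqE_linordered_idom mult_eq_0_iff mult_zero_left)
    then show "\<phi> y * dens (y - x) + \<phi> (?r y) * dens (y - ?r x)
        \<le> \<phi> y * dens (y - ?r x) + \<phi> (?r y) * dens (y - x)"
    proof cases
      case 1
      then have "0 < (s * (x \<bullet> b - h)) * (s * (y \<bullet> b - h))"
        using x by simp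
      then have "0 < s\<^sup>2 * ((x \<bullet> b - h) * (y \<bullet> b - h))"
        by (simp add: power2_eq_square mult_ac)
      then have "0 < (x \<bullet> b - h) * (y \<bullet> b - h)"
        by (simp add: zero_less_mult_iff)
      then have "(norm (y - x))\<^sup>2 \<le> (norm (y - ?r x))\<^sup>2"
        using cross by simp
      then have "norm (y - x) \<le> norm (y - ?r x)"
        by (rule power2_le_imp_le) simp
      then show ?thesis
        by (intro ennreal_rearrangement \<phi> 1 dens_antimono)
    next
      case 2
      then have "(s * (x \<bullet> b - h)) * (s * (y \<bullet> b - h)) < 0"
        using x by (simp add: mult_less_0_iff)
      then have "s\<^sup>2 * ((x \<bullet> b - h) * (y \<bullet> b - h)) < 0"
        by (simp add: power2_eq_square mult_ac)
      then have "(x \<bullet> b - h) * (y \<bullet> b - h) < 0"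
        by (metis mult_less_0_iff not_less zero_le_power2)
      then have "(norm (y - ?r x))\<^sup>2 \<le> (norm (y - x))\<^sup>2"
        using cross by simp
      then have 3: "norm (y - ?r x) \<le> norm (y - x)"
        by (rule power2_le_imp_le) simp
      have "s * (?r y \<bullet> b - h) = - (s * (y \<bullet> b - h))"
        by (simp add: coord_refl_inner[OF b] algebra_simps)
      then have "0 < s * (?r y \<bullet> b - h)"
        using 2 by simp
      then have "\<phi> (?r y) \<le> \<phi> y"
        using \<phi>[of "?r y"] by (simp add: coord_refl_involution[OF b])
      from ennreal_rearrangement[OF this dens_antimono[OF 3]] show ?thesis
        by (simp add: add.commute)
    next
      case 3
      then have "?r y = y"
        by (simp add: coord_refl_def)
      then show ?thesis
        by (simp add: add.commute)
    qed
  qed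
  then have "(\<integral>\<^sup>+y. dens (y - x) * \<phi> y \<partial>lborel) \<le> (\<integral>\<^sup>+y. dens (y - ?r x) * \<phi> y \<partial>lborel)"
    using add_strict_mono linorder_not_le by blast
  then show ?thesis
    unfolding nn_integral_p_shift[OF assms(1)] by (intro add_mono mult_left_mono \<phi> x) auto
qed

lemma reflection_walk_step_pow_mono:
  assumes [measurable]: "\<phi> \<in> borel_measurable borel" "A \<in> sets borel" and b: "b \<in> Basis"
    and A: "\<And>x. 0 < s * (x \<bullet> b - h) \<Longrightarrow> x \<in> A \<Longrightarrow> coord_refl b h x \<in> A"
    and \<phi>: "\<And>x. 0 < s * (x \<bullet> b - h) \<Longrightarrow> \<phi> x \<le> \<phi> (coord_refl b h x)"
    and x: "0 < s * (x \<bullet> b - h)"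
  shows "(walk_step p A ^^ k) \<phi> x \<le> (walk_step p A ^^ k) \<phi> (coord_refl b h x)"
  using x
proof (induction k arbitrary: x)
  case (Suc k)
  have "(\<integral>\<^sup>+z. (walk_step p A ^^ k) \<phi> (x + z) \<partial>p) \<le> (\<integral>\<^sup>+z. (walk_step p A ^^ k) \<phi> (coord_refl b h x + z) \<partial>p)"
    using Suc by (intro reflection_mean_mono[where s=s] b) auto
  moreover have "(indicator A x :: ennreal) \<le> indicator A (coord_refl b h x)"
    using A Suc.prems by (auto split: split_indicator)
  ultimately show ?case
    by (simp add: walk_step_def[of _ _ "(walk_step p A ^^ k) \<phi>"] mult_mono)
qed (simp add: \<phi>)

lemma reflection_walk_potential_mono:
  assumes "A \<in> sets borel" "U \<in> sets borel" "b \<in> Basis"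
    and "\<And>x. 0 < s * (x \<bullet> b - h) \<Longrightarrow> x \<in> A \<Longrightarrow> coord_refl b h x \<in> A"
    and "\<And>x. 0 < s * (x \<bullet> b - h) \<Longrightarrow> x \<in> U \<Longrightarrow> coord_refl b h x \<in> U"
    and "0 < s * (x \<bullet> b - h)"
  shows "walk_potential p A (indicator U) x \<le> walk_potential p A (indicator U) (coord_refl b h x)"
  unfolding walk_potential_def using assms
  by (intro suminf_le reflection_walk_step_pow_mono[where s=s]) (auto split: split_indicator)

lemma mass_le:
  assumes [measurable]: "V \<in> sets borel" and \<rho>: "0 < \<rho>" and V: "\<And>v. v \<in> V \<Longrightarrow> \<rho> \<le> norm (v - z)"
  shows "(\<integral>\<^sup>+w. indicator V (z + w) \<partial>p) \<le> ennreal (m \<rho>) * emeasure lborel V"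
proof -
  have "z \<notin> V"
    using V[of z] \<rho> by auto
  then have "(\<integral>\<^sup>+w. indicator V (z + w) \<partial>p) = (\<integral>\<^sup>+y. dens (y - z) * indicator V y \<partial>lborel)"
    by (simp add: nn_integral_p_shift)
  also have "\<dots> \<le> (\<integral>\<^sup>+y. ennreal (m \<rho>) * indicator V y \<partial>lborel)"
  proof (intro nn_integral_mono)
    fix y show "dens (y - z) * indicator V y \<le> ennreal (m \<rho>) * indicator V y"
      using V[of y] \<rho> m_antimono
      by (auto simp: dens_def monotone_on_def indicator_def intro!: ennreal_leI)
  qed
  finally show ?thesis
    by (simp add: nn_integral_cmult)
qed

lemma mass_ge:
  assumes [measurable]: "V \<in> sets borel" and \<rho>: "0 < \<rho>" and V: "\<And>v. v \<in> V \<Longrightarrow> norm (v - z) \<le> \<rho>"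
  shows "ennreal (m \<rho>) * emeasure lborel V \<le> (\<integral>\<^sup>+w. indicator V (z + w) \<partial>p)"
proof -
  have "ennreal (m \<rho>) * emeasure lborel V = (\<integral>\<^sup>+y. ennreal (m \<rho>) * indicator V y \<partial>lborel)"
    by (simp add: nn_integral_cmult)
  also have "\<dots> \<le> (\<integral>\<^sup>+y. dens (y - z) * indicator V y \<partial>lborel)"
  proof (intro nn_integral_mono)
    fix y show "ennreal (m \<rho>) * indicator V y \<le> dens (y - z) * indicator V y"
      using V[of y] \<rho> m_antimono
      by (auto simp: dens_def monotone_on_def indicator_def intro!: ennreal_leI)
  qed
  also have "\<dots> \<le> (\<integral>\<^sup>+w. indicator V (z + w) \<partial>p)"
    by (simp add: nn_integral_p_shift)
  finally show ?thesis .
qed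

end

section \<open>Increments on dyadic grids\<close>

primrec walk_chain :: "'a::euclidean_space measure \<Rightarrow> (nat \<Rightarrow> 'a set) \<Rightarrow> nat \<Rightarrow> ('a \<Rightarrow> ennreal) \<Rightarrow> 'a \<Rightarrow> ennreal"
  where
    "walk_chain p C 0 \<phi> = \<phi>"
  | "walk_chain p C (Suc L) \<phi> = walk_chain p C L (walk_step p (C L) \<phi>)"

lemma walk_chain_const: "walk_chain p (\<lambda>_. A) L \<phi> = (walk_step p A ^^ L) \<phi>"
  by (induction L arbitrary: \<phi>) (simp_all add: funpow_swap1)

definition grid_exit :: "nat \<Rightarrow> 'a set \<Rightarrow> 'a set \<Rightarrow> (real \<Rightarrow> 'a) \<Rightarrow> bool"
  where "grid_exit n A U y \<longleftrightarrow> (\<exists>k. (\<forall>i<k. y (real i / 2^n) \<in> A) \<and> y (real k / 2^n) \<in> U)"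

definition dyadic_times :: "real set"
  where "dyadic_times = {real k / 2^n | k n. True}"

lemma dyadic_timesI [simp]: "real k / 2^n \<in> dyadic_times"
  by (auto simp: dyadic_times_def)

lemma dyadic_times_nonneg: "s \<in> dyadic_times \<Longrightarrow> 0 \<le> s"
  by (auto simp: dyadic_times_def)

lemma dyadic_times_common_grid:
  assumes "finite J" "J \<subseteq> dyadic_times"
  shows "\<exists>n. \<forall>s\<in>J. \<exists>k. s = real k / 2^n"
  using assms
proof (induction J rule: finite_induct)
  case (insert s J)
  then obtain n where n: "\<forall>s\<in>J. \<exists>k. s = real k / 2^n"
    by auto
  obtain k' n' where s: "s = real k' / 2^n'"
    using insert.prems by (auto simp: dyadic_times_def)
  have up: "real k / 2^a = real (k * 2^b) / 2^(a + b)" for k a b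
    by (simp add: power_add)
  have "\<forall>r\<in>insert s J. \<exists>k. r = real k / 2^(n + n')"
  proof
    fix r assume "r \<in> insert s J"
    then show "\<exists>k. r = real k / 2^(n + n')"
    proof
      assume "r = s"
      then show ?thesis
        using up[of k' n' n] s by (auto simp: add.commute intro!: exI[of _ "k' * 2^n"])
    next
      assume "r \<in> J"
      then obtain k where "r = real k / 2^n"
        using n by auto
      then show ?thesis
        using up[of k n n'] by (auto intro!: exI[of _ "k * 2^n'"])
    qed
  qed
  then show ?case ..
qed simp

context levy_process
begin

definition disp :: "real \<Rightarrow> 'w \<Rightarrow> 'a"
  where "disp t \<omega> = X t \<omega> - X 0 \<omega>"

lemma disp_0 [simp]: "disp 0 \<omega> = 0"
  by (simp add: disp_def)

lemma started_at_disp: "started_at x X = (\<lambda>t \<omega>. x + disp t \<omega>)"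
  by (simp add: started_at_def[abs_def] disp_def[abs_def])

lemma disp_measurable [measurable]: "0 \<le> t \<Longrightarrow> disp t \<in> borel_measurable M"
  unfolding disp_def[abs_def] using random_variable_X[of t] random_variable_X[of 0]
  by measurable

lemma disp_grid_measurable [measurable]: "disp (real k / 2^n) \<in> borel_measurable M"
  by (rule disp_measurable) simp

definition step :: "real \<Rightarrow> 'a measure"
  where "step h = distr M borel (disp h)"

lemma step_law_step: "0 \<le> h \<Longrightarrow> step_law (step h)"
  unfolding step_def by (auto intro!: step_law.intro prob_space_distr step_law_axioms.intro)

lemma emeasure_step: "0 \<le> h \<Longrightarrow> A \<in> sets borel \<Longrightarrow> emeasure (step h) A = emeasure M {\<omega>\<in>space M. disp h \<omega> \<in> A}"
  unfolding step_def by (subst emeasure_distr) (auto intro!: arg_cong2[where f=emeasure])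

lemma nn_integral_next_increment:
  fixes m :: nat and h :: real
  defines "\<xi> \<equiv> \<lambda>i \<omega>. X (real (Suc i) * h) \<omega> - X (real i * h) \<omega>"
  assumes h: "0 \<le> h"
    and [measurable]: "\<Psi> \<in> borel_measurable (PiM {..<m} (\<lambda>_. borel) \<Otimes>\<^sub>M borel)"
  shows "(\<integral>\<^sup>+\<omega>. \<Psi> (\<lambda>i\<in>{..<m}. \<xi> i \<omega>, \<xi> m \<omega>) \<partial>M)
      = (\<integral>\<^sup>+\<omega>. (\<integral>\<^sup>+z. \<Psi> (\<lambda>i\<in>{..<m}. \<xi> i \<omega>, z) \<partial>step h) \<partial>M)"
proof -
  have "indep_vars (\<lambda>_. borel) \<xi> {..<Suc m}"
    unfolding \<xi>_def using h
    by (intro independent_increments[of "\<lambda>i. real i * h"]) (auto simp: mult_right_mono)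
  then have ind: "indep_var (PiM {..<m} (\<lambda>_. borel)) (\<lambda>\<omega>. \<lambda>i\<in>{..<m}. \<xi> i \<omega>)
      (PiM {m} (\<lambda>_. borel)) (\<lambda>\<omega>. \<lambda>i\<in>{m}. \<xi> i \<omega>)"
    by (rule indep_var_restrict) auto
  note [measurable] = indep_var_rv1[OF ind] indep_var_rv2[OF ind]
  have [measurable]: "\<xi> m \<in> borel_measurable M"
    unfolding \<xi>_def using h by (intro borel_measurable_diff random_variable_X) auto
  have law: "distr M borel (\<xi> m) = step h"
    using stationary_increments[of "real m * h" h] h
    unfolding \<xi>_def step_def disp_def[abs_def] by (simp add: algebra_simps)
  interpret S: step_law "step h"
    by (rule step_law_step[OF h])
  let ?V = "distr M (PiM {..<m} (\<lambda>_. borel)) (\<lambda>\<omega>. \<lambda>i\<in>{..<m}. \<xi> i \<omega>)"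
  let ?W = "distr M (PiM {m} (\<lambda>_. borel)) (\<lambda>\<omega>. \<lambda>i\<in>{m}. \<xi> i \<omega>)"
  interpret W: prob_space ?W
    by (rule prob_space_distr) measurable
  have "(\<integral>\<^sup>+\<omega>. \<Psi> (\<lambda>i\<in>{..<m}. \<xi> i \<omega>, \<xi> m \<omega>) \<partial>M)
      = (\<integral>\<^sup>+w. \<Psi> (fst w, snd w m) \<partial>distr M (PiM {..<m} (\<lambda>_. borel) \<Otimes>\<^sub>M PiM {m} (\<lambda>_. borel))
          (\<lambda>\<omega>. (\<lambda>i\<in>{..<m}. \<xi> i \<omega>, \<lambda>i\<in>{m}. \<xi> i \<omega>)))"
    by (subst nn_integral_distr) auto
  also have "\<dots> = (\<integral>\<^sup>+w. \<Psi> (fst w, snd w m) \<partial>(?V \<Otimes>\<^sub>M ?W))"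
    using ind by (simp add: indep_var_distribution_eq)
  also have "\<dots> = (\<integral>\<^sup>+v. (\<integral>\<^sup>+u. \<Psi> (v, u m) \<partial>?W) \<partial>?V)"
    by (subst W.nn_integral_fst[symmetric]) auto
  also have "\<dots> = (\<integral>\<^sup>+\<omega>. (\<integral>\<^sup>+u. \<Psi> (\<lambda>i\<in>{..<m}. \<xi> i \<omega>, u m) \<partial>?W) \<partial>M)"
    by (subst nn_integral_distr) auto
  also have "\<dots> = (\<integral>\<^sup>+\<omega>. (\<integral>\<^sup>+z. \<Psi> (\<lambda>i\<in>{..<m}. \<xi> i \<omega>, z) \<partial>step h) \<partial>M)"
  proof (intro nn_integral_cong)
    fix \<omega>
    have [measurable]: "(\<lambda>z. \<Psi> (\<lambda>i\<in>{..<m}. \<xi> i \<omega>, z)) \<in> borel_measurable borel"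
    proof -
      have "(\<lambda>i\<in>{..<m}. \<xi> i \<omega>) \<in> space (PiM {..<m} (\<lambda>_. borel))"
        by (simp add: space_PiM)
      then show ?thesis
        by measurable
    qed
    show "(\<integral>\<^sup>+u. \<Psi> (\<lambda>i\<in>{..<m}. \<xi> i \<omega>, u m) \<partial>?W) = (\<integral>\<^sup>+z. \<Psi> (\<lambda>i\<in>{..<m}. \<xi> i \<omega>, z) \<partial>step h)"
      unfolding law[symmetric] by (subst (1 2) nn_integral_distr) auto
  qed
  finally show ?thesis .
qed

lemma disp_eq_sum: "disp (real i * h) \<omega> = (\<Sum>l<i. X (real (Suc l) * h) \<omega> - X (real l * h) \<omega>)"
  by (subst sum_lessThan_telescope) (simp add: disp_def)

lemma nn_integral_chain:
  assumes h: "0 \<le> h" and [measurable]: "A0 \<in> sets borel" "\<And>i. C i \<in> sets borel" "\<phi> \<in> borel_measurable borel"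
  shows "(\<integral>\<^sup>+\<omega>. indicator A0 (disp (real K * h) \<omega>) *
        (\<Prod>i<L. indicator (C i) (x + (disp (real (K + i) * h) \<omega> - disp (real K * h) \<omega>))) *
        \<phi> (x + (disp (real (K + L) * h) \<omega> - disp (real K * h) \<omega>)) \<partial>M)
      = emeasure M {\<omega>\<in>space M. disp (real K * h) \<omega> \<in> A0} * walk_chain (step h) C L \<phi> x"
  using assms(4)
proof (induction L arbitrary: \<phi>)
  case 0
  have [measurable]: "disp (real K * h) \<in> borel_measurable M"
    using h by simp
  have "(\<integral>\<^sup>+\<omega>. indicator A0 (disp (real K * h) \<omega>) * \<phi> x \<partial>M)
      = (\<integral>\<^sup>+\<omega>. \<phi> x * indicator {\<omega>\<in>space M. disp (real K * h) \<omega> \<in> A0} \<omega> \<partial>M)"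
    by (intro nn_integral_cong) (auto split: split_indicator)
  also have "\<dots> = \<phi> x * emeasure M {\<omega>\<in>space M. disp (real K * h) \<omega> \<in> A0}"
    by (intro nn_integral_cmult_indicator) measurable
  finally show ?case
    by (simp add: mult.commute)
next
  case (Suc L)
  note [measurable] = Suc.prems
  interpret S: step_law "step h"
    by (rule step_law_step[OF h])
  define m where "m = K + L"
  define \<xi> where "\<xi> = (\<lambda>i \<omega>. X (real (Suc i) * h) \<omega> - X (real i * h) \<omega>)"
  define s :: "(nat \<Rightarrow> 'a) \<Rightarrow> nat \<Rightarrow> 'a" where "s v i = (\<Sum>l<i. v l)" for v i
  define g :: "(nat \<Rightarrow> 'a) \<Rightarrow> ennreal" where
    "g v = indicator A0 (s v K) * (\<Prod>i<L. indicator (C i) (x + (s v (K + i) - s v K)))" for v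
  define G where "G v = g v * indicator (C L) (x + (s v m - s v K))" for v
  define \<Psi> where "\<Psi> = (\<lambda>(v, z). G v * \<phi> (x + (s v m - s v K) + z))"
  have sm: "(\<lambda>v. s v i) \<in> borel_measurable (PiM {..<m} (\<lambda>_. borel))" if "i \<le> m" for i
    unfolding s_def using that by (intro borel_measurable_sum measurable_component_singleton) auto
  have [measurable]: "(\<lambda>v. s v K) \<in> borel_measurable (PiM {..<m} (\<lambda>_. borel))"
    "(\<lambda>v. s v m) \<in> borel_measurable (PiM {..<m} (\<lambda>_. borel))"
    using sm[of K] sm[of m] by (auto simp: m_def)
  have "(\<lambda>v. indicator (C i) (x + (s v (K + i) - s v K)) :: ennreal) \<in> borel_measurable (PiM {..<m} (\<lambda>_. borel))"
    if "i < L" for i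
  proof -
    have [measurable]: "(\<lambda>v. s v (K + i)) \<in> borel_measurable (PiM {..<m} (\<lambda>_. borel))"
      using that by (intro sm) (simp add: m_def)
    show ?thesis
      by measurable
  qed
  then have [measurable]: "(\<lambda>v. \<Prod>i<L. indicator (C i) (x + (s v (K + i) - s v K)) :: ennreal)
      \<in> borel_measurable (PiM {..<m} (\<lambda>_. borel))"
    by (intro borel_measurable_prod_ennreal) auto
  have [measurable]: "g \<in> borel_measurable (PiM {..<m} (\<lambda>_. borel))"
    unfolding g_def by measurable
  have [measurable]: "G \<in> borel_measurable (PiM {..<m} (\<lambda>_. borel))"
    unfolding G_def by measurable
  have [measurable]: "\<Psi> \<in> borel_measurable (PiM {..<m} (\<lambda>_. borel) \<Otimes>\<^sub>M borel)"
    unfolding \<Psi>_def by measurable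
  have s: "s (\<lambda>i\<in>{..<m}. \<xi> i \<omega>) i = disp (real i * h) \<omega>" if "i \<le> m" for i \<omega>
    unfolding disp_eq_sum s_def \<xi>_def using that by (intro sum.cong) auto
  have sK: "s (\<lambda>i\<in>{..<m}. \<xi> i \<omega>) K = disp (real K * h) \<omega>"
    and sm': "s (\<lambda>i\<in>{..<m}. \<xi> i \<omega>) m = disp (real (K + L) * h) \<omega>"
    and sKi: "i < L \<Longrightarrow> s (\<lambda>i\<in>{..<m}. \<xi> i \<omega>) (K + i) = disp (real (K + i) * h) \<omega>" for \<omega> i
    by (auto intro!: s[unfolded m_def] simp: m_def simp del: of_nat_add)
  have g: "g (\<lambda>i\<in>{..<m}. \<xi> i \<omega>) = indicator A0 (disp (real K * h) \<omega>) *
      (\<Prod>i<L. indicator (C i) (x + (disp (real (K + i) * h) \<omega> - disp (real K * h) \<omega>)))" for \<omega>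
    unfolding g_def by (intro arg_cong2[where f="(*)"] prod.cong) (simp_all add: sK sKi del: of_nat_add)
  have G: "G (\<lambda>i\<in>{..<m}. \<xi> i \<omega>) = indicator A0 (disp (real K * h) \<omega>) *
      (\<Prod>i<L. indicator (C i) (x + (disp (real (K + i) * h) \<omega> - disp (real K * h) \<omega>))) *
      indicator (C L) (x + (disp (real (K + L) * h) \<omega> - disp (real K * h) \<omega>))" for \<omega>
    unfolding G_def g by (simp add: sK sm' del: of_nat_add)
  have \<xi>m: "disp (real (K + Suc L) * h) \<omega> = disp (real (K + L) * h) \<omega> + \<xi> m \<omega>" for \<omega>
    by (simp add: disp_def \<xi>_def m_def)
  have "(\<integral>\<^sup>+\<omega>. indicator A0 (disp (real K * h) \<omega>) *
        (\<Prod>i<Suc L. indicator (C i) (x + (disp (real (K + i) * h) \<omega> - disp (real K * h) \<omega>))) *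
        \<phi> (x + (disp (real (K + Suc L) * h) \<omega> - disp (real K * h) \<omega>)) \<partial>M)
      = (\<integral>\<^sup>+\<omega>. \<Psi> (\<lambda>i\<in>{..<m}. \<xi> i \<omega>, \<xi> m \<omega>) \<partial>M)"
    unfolding \<xi>m by (intro nn_integral_cong) (simp add: \<Psi>_def G sK sm' mult_ac add_ac add_diff_eq del: of_nat_add)
  also have "\<dots> = (\<integral>\<^sup>+\<omega>. (\<integral>\<^sup>+z. \<Psi> (\<lambda>i\<in>{..<m}. \<xi> i \<omega>, z) \<partial>step h) \<partial>M)"
    unfolding \<xi>_def by (rule nn_integral_next_increment[OF h]) measurable
  also have "\<dots> = (\<integral>\<^sup>+\<omega>. indicator A0 (disp (real K * h) \<omega>) *
        (\<Prod>i<L. indicator (C i) (x + (disp (real (K + i) * h) \<omega> - disp (real K * h) \<omega>))) *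
        walk_step (step h) (C L) \<phi> (x + (disp (real (K + L) * h) \<omega> - disp (real K * h) \<omega>)) \<partial>M)"
    by (intro nn_integral_cong)
       (simp add: \<Psi>_def G sK sm' walk_step_def nn_integral_cmult mult.assoc del: of_nat_add)
  also have "\<dots> = emeasure M {\<omega>\<in>space M. disp (real K * h) \<omega> \<in> A0} * walk_chain (step h) C L (walk_step (step h) (C L) \<phi>) x"
    by (rule Suc.IH) measurable
  finally show ?case
    by simp
qed

lemma emeasure_chain:
  assumes h: "0 \<le> h" and [measurable]: "A0 \<in> sets borel" "\<And>i. C i \<in> sets borel" "U \<in> sets borel"
  shows "emeasure M {\<omega>\<in>space M. disp (real K * h) \<omega> \<in> A0 \<and>
        (\<forall>i<L. x + (disp (real (K + i) * h) \<omega> - disp (real K * h) \<omega>) \<in> C i) \<and>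
        x + (disp (real (K + L) * h) \<omega> - disp (real K * h) \<omega>) \<in> U}
      = emeasure M {\<omega>\<in>space M. disp (real K * h) \<omega> \<in> A0} * walk_chain (step h) C L (indicator U) x"
proof -
  have [measurable]: "disp (real i * h) \<in> borel_measurable M" for i
    using h by simp
  let ?S = "{\<omega>\<in>space M. disp (real K * h) \<omega> \<in> A0 \<and>
        (\<forall>i<L. x + (disp (real (K + i) * h) \<omega> - disp (real K * h) \<omega>) \<in> C i) \<and>
        x + (disp (real (K + L) * h) \<omega> - disp (real K * h) \<omega>) \<in> U}"
  have P: "(\<Prod>i<n. indicator (C i) (f i) :: ennreal) = (if \<forall>i<n. f i \<in> C i then 1 else 0)" for n f
    by (induction n) (auto simp: less_Suc_eq indicator_def)
  have "emeasure M ?S = (\<integral>\<^sup>+\<omega>. indicator ?S \<omega> \<partial>M)"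
    by (intro nn_integral_indicator[symmetric]) measurable
  also have "\<dots> = (\<integral>\<^sup>+\<omega>. indicator A0 (disp (real K * h) \<omega>) *
        (\<Prod>i<L. indicator (C i) (x + (disp (real (K + i) * h) \<omega> - disp (real K * h) \<omega>))) *
        indicator U (x + (disp (real (K + L) * h) \<omega> - disp (real K * h) \<omega>)) \<partial>M)"
    unfolding P by (intro nn_integral_cong) (auto simp: indicator_def)
  finally show ?thesis
    by (subst (asm) nn_integral_chain[OF h]) auto
qed

lemma emeasure_grid_exit_at:
  assumes [measurable]: "A \<in> sets borel" "U \<in> sets borel"
  shows "emeasure M {\<omega>\<in>space M. (\<forall>i<k. x + disp (real i / 2^n) \<omega> \<in> A) \<and> x + disp (real k / 2^n) \<omega> \<in> U}
      = (walk_step (step (1 / 2^n)) A ^^ k) (indicator U) x"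
  using emeasure_chain[of "1 / 2^n" UNIV "\<lambda>_. A" U 0 k x] emeasure_space_1
  by (simp add: walk_chain_const)

lemma grid_exit_measurable [measurable]:
  assumes [measurable]: "A \<in> sets borel" "U \<in> sets borel"
  shows "{\<omega>\<in>space M. grid_exit n A U (\<lambda>s. x + disp s \<omega>)} \<in> sets M"
  unfolding grid_exit_def by measurable

lemma emeasure_grid_exit_le:
  assumes [measurable]: "A \<in> sets borel" "U \<in> sets borel"
  shows "emeasure M {\<omega>\<in>space M. grid_exit n A U (\<lambda>s. x + disp s \<omega>)}
      \<le> walk_potential (step (1 / 2^n)) A (indicator U) x"
proof -
  let ?E = "\<lambda>k. {\<omega>\<in>space M. (\<forall>i<k. x + disp (real i / 2^n) \<omega> \<in> A) \<and> x + disp (real k / 2^n) \<omega> \<in> U}"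
  have "{\<omega>\<in>space M. grid_exit n A U (\<lambda>s. x + disp s \<omega>)} = (\<Union>k. ?E k)"
    by (auto simp: grid_exit_def)
  also have "emeasure M \<dots> \<le> (\<Sum>k. emeasure M (?E k))"
    by (intro emeasure_subadditive_countably) auto
  finally show ?thesis
    unfolding walk_potential_def emeasure_grid_exit_at[OF assms] .
qed

lemma emeasure_grid_exit:
  assumes [measurable]: "A \<in> sets borel" "U \<in> sets borel" and disj: "A \<inter> U = {}"
  shows "emeasure M {\<omega>\<in>space M. grid_exit n A U (\<lambda>s. x + disp s \<omega>)}
      = walk_potential (step (1 / 2^n)) A (indicator U) x"
proof -
  let ?E = "\<lambda>k. {\<omega>\<in>space M. (\<forall>i<k. x + disp (real i / 2^n) \<omega> \<in> A) \<and> x + disp (real k / 2^n) \<omega> \<in> U}"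
  have "disjoint_family ?E"
    unfolding disjoint_family_on_def
  proof safe
    fix a b :: nat and \<omega>
    assume *: "a \<noteq> b" "\<forall>i<a. x + disp (real i / 2^n) \<omega> \<in> A" "x + disp (real a / 2^n) \<omega> \<in> U"
      "\<forall>i<b. x + disp (real i / 2^n) \<omega> \<in> A" "x + disp (real b / 2^n) \<omega> \<in> U"
    then have "a < b \<or> b < a"
      by linarith
    then show "\<omega> \<in> {}"
      using * disj by auto
  qed
  then have "emeasure M (\<Union>k. ?E k) = (\<Sum>k. emeasure M (?E k))"
    by (intro suminf_emeasure[symmetric]) auto
  also have "(\<Union>k. ?E k) = {\<omega>\<in>space M. grid_exit n A U (\<lambda>s. x + disp s \<omega>)}"
    by (auto simp: grid_exit_def)
  finally show ?thesis
    unfolding walk_potential_def emeasure_grid_exit_at[OF assms(1,2)] by simp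
qed

definition path_law :: "(real \<Rightarrow> 'a) measure"
  where "path_law = distr M (PiM dyadic_times (\<lambda>_. borel)) (\<lambda>\<omega>. \<lambda>s\<in>dyadic_times. disp s \<omega>)"

lemma distr_disp_future:
  assumes h: "h \<in> dyadic_times"
  shows "distr M (borel \<Otimes>\<^sub>M PiM dyadic_times (\<lambda>_. borel)) (\<lambda>\<omega>. (disp h \<omega>, \<lambda>s\<in>dyadic_times. disp (h + s) \<omega> - disp h \<omega>))
    = step h \<Otimes>\<^sub>M path_law"
proof -
  let ?D = "PiM dyadic_times (\<lambda>_. borel :: 'a measure)"
  let ?F = "\<lambda>\<omega>. \<lambda>s\<in>dyadic_times. disp (h + s) \<omega> - disp h \<omega>"
  have h0: "0 \<le> h"
    using h by (rule dyadic_times_nonneg)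
  have [measurable]: "disp h \<in> borel_measurable M"
    using h0 by simp
  have [measurable]: "?F \<in> M \<rightarrow>\<^sub>M ?D" "(\<lambda>\<omega>. \<lambda>s\<in>dyadic_times. disp s \<omega>) \<in> M \<rightarrow>\<^sub>M ?D"
    using h0 by (auto intro!: measurable_restrict borel_measurable_diff disp_measurable dest: dyadic_times_nonneg)
  interpret S: step_law "step h"
    by (rule step_law_step[OF h0])
  interpret Q: prob_space path_law
    unfolding path_law_def by (rule prob_space_distr) measurable
  have key: "emeasure M {\<omega>\<in>space M. disp h \<omega> \<in> A \<and> (\<forall>s\<in>J. disp (h + s) \<omega> - disp h \<omega> \<in> B s)}
      = emeasure M {\<omega>\<in>space M. disp h \<omega> \<in> A} * emeasure M {\<omega>\<in>space M. \<forall>s\<in>J. disp s \<omega> \<in> B s}"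
    if J: "finite J" "J \<subseteq> dyadic_times" and [measurable]: "A \<in> sets borel" and B: "\<And>s. s \<in> J \<Longrightarrow> B s \<in> sets borel"
    for A J and B :: "real \<Rightarrow> 'a set"
  proof -
    obtain n where n: "\<forall>s\<in>insert h J. \<exists>k. s = real k / 2^n"
      using dyadic_times_common_grid[of "insert h J"] J h by auto
    then obtain K where K: "h = real K / 2^n"
      by auto
    obtain \<kappa> where \<kappa>: "\<And>s. s \<in> J \<Longrightarrow> s = real (\<kappa> s) / 2^n"
      using n by (metis insertCI)
    define L where "L = Suc (Max (insert 0 (\<kappa> ` J)))"
    define C where "C i = (if real i / 2^n \<in> J then B (real i / 2^n) else UNIV)" for i
    have [measurable]: "C i \<in> sets borel" for i
      using B by (auto simp: C_def)
    have L: "\<kappa> s < L" if "s \<in> J" for s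
      using J(1) that by (auto simp: L_def less_Suc_eq_le intro!: Max_ge)
    have eq: "(\<forall>s\<in>J. f s \<in> B s) \<longleftrightarrow> (\<forall>i<L. f (real i / 2^n) \<in> C i)" for f
    proof safe
      fix i assume "\<forall>s\<in>J. f s \<in> B s"
      then show "f (real i / 2^n) \<in> C i"
        by (auto simp: C_def)
    next
      fix s assume "\<forall>i<L. f (real i / 2^n) \<in> C i" "s \<in> J"
      then have "f (real (\<kappa> s) / 2^n) \<in> C (\<kappa> s)"
        using L by blast
      then show "f s \<in> B s"
        using \<kappa>[OF \<open>s \<in> J\<close>] \<open>s \<in> J\<close> by (simp add: C_def)
    qed
    have 1: "emeasure M {\<omega>\<in>space M. disp h \<omega> \<in> A \<and> (\<forall>s\<in>J. disp (h + s) \<omega> - disp h \<omega> \<in> B s)}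
        = emeasure M {\<omega>\<in>space M. disp h \<omega> \<in> A} * walk_chain (step (1 / 2^n)) C L (indicator UNIV) 0"
      using emeasure_chain[of "1 / 2^n" A C UNIV K L 0]
      unfolding eq by (simp add: K add_divide_distrib)
    have 2: "emeasure M {\<omega>\<in>space M. \<forall>s\<in>J. disp s \<omega> \<in> B s} = walk_chain (step (1 / 2^n)) C L (indicator UNIV) 0"
      using emeasure_chain[of "1 / 2^n" UNIV C UNIV 0 L 0] emeasure_space_1
      unfolding eq by simp
    show ?thesis
      unfolding 1 2 ..
  qed
  show ?thesis
  proof (rule pair_measure_eqI[symmetric])
    show "sigma_finite_measure (step h)" "sigma_finite_measure path_law"
      by unfold_locales
    show "sets (step h \<Otimes>\<^sub>M path_law) = sets (distr M (borel \<Otimes>\<^sub>M ?D) (\<lambda>\<omega>. (disp h \<omega>, ?F \<omega>)))"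
      by (simp add: path_law_def cong: sets_pair_measure_cong)
    fix A B assume AB: "A \<in> sets (step h)" "B \<in> sets path_law"
    then have [measurable]: "A \<in> sets borel" "B \<in> sets ?D"
      by (auto simp: path_law_def)
    define N1 where "N1 = distr (density M (indicator {\<omega>\<in>space M. disp h \<omega> \<in> A})) ?D ?F"
    define N2 where "N2 = scale_measure (emeasure M {\<omega>\<in>space M. disp h \<omega> \<in> A}) path_law"
    have N1: "emeasure N1 E = emeasure M {\<omega>\<in>space M. disp h \<omega> \<in> A \<and> ?F \<omega> \<in> E}" if [measurable]: "E \<in> sets ?D" for E
    proof -
      have "emeasure N1 E = (\<integral>\<^sup>+\<omega>. indicator {\<omega>\<in>space M. disp h \<omega> \<in> A} \<omega> * indicator (?F -` E \<inter> space M) \<omega> \<partial>M)"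
        unfolding N1_def by (simp add: emeasure_distr emeasure_density)
      also have "\<dots> = (\<integral>\<^sup>+\<omega>. indicator {\<omega>\<in>space M. disp h \<omega> \<in> A \<and> ?F \<omega> \<in> E} \<omega> \<partial>M)"
        by (intro nn_integral_cong) (auto simp: indicator_def)
      also have "\<dots> = emeasure M {\<omega>\<in>space M. disp h \<omega> \<in> A \<and> ?F \<omega> \<in> E}"
        by (intro nn_integral_indicator) measurable
      finally show ?thesis .
    qed
    have "N1 = N2"
    proof (rule measure_eqI_PiM_infinite)
      show "sets N1 = sets ?D" "sets N2 = sets ?D"
        by (simp_all add: N1_def N2_def path_law_def)
      show "finite_measure N1"
      proof
        have "emeasure N1 (space N1) = emeasure M {\<omega>\<in>space M. disp h \<omega> \<in> A \<and> ?F \<omega> \<in> space ?D}"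
          using N1[of "space ?D"] by (simp add: N1_def)
        then show "emeasure N1 (space N1) \<noteq> \<infinity>"
          by (simp add: emeasure_eq_measure)
      qed
      fix J and B' :: "real \<Rightarrow> 'a set"
      assume J: "finite J" "J \<subseteq> dyadic_times" and B': "\<And>i. i \<in> J \<Longrightarrow> B' i \<in> sets borel"
      let ?E = "prod_emb dyadic_times (\<lambda>_. borel) J (Pi\<^sub>E J B')"
      have [measurable]: "?E \<in> sets ?D"
        using J B' by (intro sets_PiM_I) auto
      have E: "f \<in> ?E \<longleftrightarrow> f \<in> space ?D \<and> (\<forall>s\<in>J. f s \<in> B' s)" for f
        using J(2) by (auto simp: prod_emb_iff space_PiM PiE_iff extensional_def)
      have "emeasure N1 ?E = emeasure M {\<omega>\<in>space M. disp h \<omega> \<in> A \<and> (\<forall>s\<in>J. disp (h + s) \<omega> - disp h \<omega> \<in> B' s)}"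
        unfolding N1[OF \<open>?E \<in> sets ?D\<close>] E using J(2)
        by (intro arg_cong2[where f=emeasure]) (auto simp: space_PiM subset_eq)
      also have "\<dots> = emeasure M {\<omega>\<in>space M. disp h \<omega> \<in> A} * emeasure M {\<omega>\<in>space M. \<forall>s\<in>J. disp s \<omega> \<in> B' s}"
        by (rule key) (use J B' in auto)
      also have "emeasure M {\<omega>\<in>space M. \<forall>s\<in>J. disp s \<omega> \<in> B' s} = emeasure path_law ?E"
        unfolding path_law_def using J(2)
        by (subst emeasure_distr) (auto simp: E[unfolded] space_PiM subset_eq intro!: arg_cong2[where f=emeasure])
      finally show "emeasure N1 ?E = emeasure N2 ?E"
        by (simp add: N2_def)
    qed
    then have "emeasure N1 B = emeasure N2 B"
      by simp
    then show "emeasure (step h) A * emeasure path_law B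
        = emeasure (distr M (borel \<Otimes>\<^sub>M ?D) (\<lambda>\<omega>. (disp h \<omega>, ?F \<omega>))) (A \<times> B)"
      using h0 by (simp add: N1 N2_def emeasure_step emeasure_distr vimage_def Int_def conj_ac)
  qed
qed

end

section \<open>Exit of right-continuous paths\<close>

definition thicken :: "'a::metric_space set \<Rightarrow> real \<Rightarrow> 'a set"
  where "thicken A e = (\<Union>a\<in>A. ball a e)"

definition shrink :: "'a::metric_space set \<Rightarrow> real \<Rightarrow> 'a set"
  where "shrink A e = {z. ball z e \<subseteq> A}"

lemma open_thicken [simp]: "open (thicken A e)"
  by (auto simp: thicken_def)

lemma closed_shrink [simp]: "closed (shrink A e)"
proof -
  have "shrink A e = - thicken (- A) e"
    by (auto simp: shrink_def thicken_def subset_eq dist_commute)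
  then show ?thesis
    by (simp add: closed_Compl)
qed

lemma closure_subset_thicken:
  assumes "0 < e"
  shows "closure A \<subseteq> thicken A e"
  using assms by (auto simp: thicken_def closure_approachable dest!: spec[of _ e])

lemma subset_thicken:
  assumes "0 < e"
  shows "A \<subseteq> thicken A e"
  using closure_subset_thicken[OF assms] closure_subset by blast



lemma thicken_mono: "e \<le> e' \<Longrightarrow> thicken A e \<subseteq> thicken A e'"
  unfolding thicken_def by (intro UN_mono subset_ball) auto

lemma thicken_near:
  assumes "z \<in> thicken A e" "dist z w < d" "e + d \<le> e'"
  shows "w \<in> thicken A e'"
proof -
  obtain a where "a \<in> A" "dist a z < e"
    using assms by (auto simp: thicken_def)
  then show ?thesis
    using assms dist_triangle[of a w z] by (auto simp: thicken_def intro!: bexI[of _ a])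
qed

lemma shrink_subset: "0 < e \<Longrightarrow> shrink A e \<subseteq> A"
  by (auto simp: shrink_def)

lemma shrink_near:
  assumes "z \<in> shrink A e" "dist z w \<le> d" "d + e' \<le> e"
  shows "w \<in> shrink A e'"
  unfolding shrink_def mem_Collect_eq
proof
  fix v assume "v \<in> ball w e'"
  then have "dist z v < e"
    using assms(2,3) dist_triangle[of z v w] by simp
  then show "v \<in> A"
    using assms(1) by (auto simp: shrink_def)
qed

lemma shrink_antimono: "e' \<le> e \<Longrightarrow> shrink A e \<subseteq> shrink A e'"
  by (auto simp: shrink_def)

lemma open_imp_shrink:
  assumes "open A" "z \<in> A"
  obtains e where "0 < e" "z \<in> shrink A e"
  using assms by (auto simp: open_contains_ball shrink_def)

definition right_cont :: "(real \<Rightarrow> 'a::metric_space) \<Rightarrow> bool"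
  where "right_cont y \<longleftrightarrow> (\<forall>t\<ge>0. continuous (at_right t) y)"

lemma right_contD:
  assumes "right_cont y" "0 \<le> t" "0 < e"
  obtains d where "0 < d" "\<And>s. t \<le> s \<Longrightarrow> s < t + d \<Longrightarrow> dist (y s) (y t) < e"
proof -
  have "(y \<longlongrightarrow> y t) (at_right t)"
    using assms by (auto simp: right_cont_def continuous_within)
  then have "\<forall>\<^sub>F s in at_right t. dist (y s) (y t) < e"
    using assms(3) by (rule tendstoD)
  then obtain b where b: "t < b" "\<And>s. t < s \<Longrightarrow> s < b \<Longrightarrow> dist (y s) (y t) < e"
    by (auto simp: eventually_at_right_field)
  show ?thesis
  proof
    show "0 < b - t"
      using b by simp
    fix s assume "t \<le> s" "s < t + (b - t)"
    then show "dist (y s) (y t) < e"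
      using b assms(3) by (cases "s = t") auto
  qed
qed

lemma first_grid_point:
  fixes t :: real
  assumes "0 \<le> t"
  obtains k where "t \<le> real k / 2^n" "real k / 2^n < t + 1 / 2^n" "\<And>i. i < k \<Longrightarrow> real i / 2^n < t"
proof
  let ?k = "nat \<lceil>t * 2^n\<rceil>"
  have k: "real ?k = of_int \<lceil>t * 2^n\<rceil>"
    using assms by simp
  show "t \<le> real ?k / 2^n"
    unfolding k by (simp add: field_simps le_of_int_ceiling)
  show "real ?k / 2^n < t + 1 / 2^n"
    unfolding k using ceiling_correct[of "t * 2^n"] by (simp add: field_simps)
  fix i assume "i < ?k"
  then have "of_int (int i) < t * 2^n"
    by (subst less_ceiling_iff[symmetric]) linarith
  then show "real i / 2^n < t"
    by (simp add: field_simps)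
qed

lemma eventually_grid_fine:
  assumes "0 < (d::real)"
  shows "\<forall>\<^sub>F n in sequentially. 1 / 2^n < d"
proof -
  have "(\<lambda>n. (1/2::real)^n) \<longlonglongrightarrow> 0"
    by (rule LIMSEQ_power_zero) simp
  then have "\<forall>\<^sub>F n in sequentially. (1/2::real)^n < d"
    using assms by (rule order_tendstoD)
  then show ?thesis
    by (simp add: power_divide)
qed

lemma eventually_Suc_fine:
  assumes "0 < (d::real)"
  shows "\<forall>\<^sub>F n in sequentially. 1 / Suc n < d"
  using LIMSEQ_Suc[OF lim_1_over_n] assms by (auto dest: order_tendstoD)

lemma dyadic_between:
  fixes a b :: real
  assumes "0 \<le> a" "a < b"
  obtains h where "h \<in> dyadic_times" "a < h" "h < b"
proof -
  let ?c = "(a + b) / 2"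
  have "0 < b - ?c"
    using assms by (simp add: field_simps)
  then obtain n where n: "1 / 2^n < b - ?c"
    using eventually_happens'[OF sequentially_bot eventually_grid_fine] by blast
  obtain k where k: "?c \<le> real k / 2^n" "real k / 2^n < ?c + 1 / 2^n"
    using first_grid_point[of ?c n] assms by auto
  show ?thesis
  proof
    show "a < real k / 2^n"
      by (rule less_le_trans[OF _ k(1)]) (use assms in simp)
    show "real k / 2^n < b"
      using k(2) n by simp
  qed simp
qed

definition exits_at :: "'a set \<Rightarrow> 'a set \<Rightarrow> (real \<Rightarrow> 'a) \<Rightarrow> real \<Rightarrow> bool"
  where "exits_at A U y t \<longleftrightarrow> 0 \<le> t \<and> (\<forall>s. 0 \<le> s \<and> s < t \<longrightarrow> y s \<in> A) \<and> y t \<in> U"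

text \<open>Outer and inner approximations, in terms of the values at countably many times, of the event
  that the path leaves \<open>A\<close> by a jump into \<open>U\<close>.\<close>

definition outer_exit :: "'a::metric_space set \<Rightarrow> 'a set \<Rightarrow> (real \<Rightarrow> 'a) \<Rightarrow> bool"
  where "outer_exit A U y \<longleftrightarrow> (\<forall>N. \<exists>n\<ge>N. grid_exit n (thicken A (1 / Suc N)) (thicken U (1 / Suc N)) y)"

definition inner_exit :: "'a::metric_space set \<Rightarrow> 'a set \<Rightarrow> (real \<Rightarrow> 'a) \<Rightarrow> bool"
  where "inner_exit A U y \<longleftrightarrow> (\<exists>N. \<forall>n\<ge>N. grid_exit n (shrink A (1 / Suc N)) (shrink U (1 / Suc N)) y)"

definition separated :: "real \<Rightarrow> 'a::metric_space set \<Rightarrow> 'a set \<Rightarrow> bool"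
  where "separated d A U \<longleftrightarrow> 0 < d \<and> (\<forall>a\<in>A. \<forall>u\<in>U. d \<le> dist a u)"

lemma grid_exit_mono:
  assumes "grid_exit n A U y" "A \<subseteq> A'" "U \<subseteq> U'"
  shows "grid_exit n A' U' y"
  using assms unfolding grid_exit_def by blast

lemma separated_closure:
  assumes "separated d A U"
  shows "separated d (closure A) (closure U)"
  unfolding separated_def
proof (intro conjI ballI)
  show "0 < d"
    using assms by (simp add: separated_def)
  fix a u assume *: "a \<in> closure A" "u \<in> closure U"
  have "d \<le> dist a u + e" if "0 < e" for e
  proof -
    obtain a' u' where "a' \<in> A" "dist a' a < e/2" "u' \<in> U" "dist u' u < e/2"
      using * \<open>0 < e\<close> by (meson closure_approachable half_gt_zero)
    moreover from this have "d \<le> dist a' u'"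
      using assms by (auto simp: separated_def)
    moreover have "dist a' u' \<le> dist a' a + dist a u + dist u u'"
      by metric
    ultimately show ?thesis
      by (simp add: dist_commute)
  qed
  then show "d \<le> dist a u"
    by (rule field_le_epsilon)
qed

lemma outer_exit_imp:
  assumes y: "right_cont y" and sep: "separated d A U" and out: "outer_exit A U y"
  shows "\<exists>t. exits_at (closure A) (closure U) y t"
proof -
  have "\<forall>N. \<exists>n k. n \<ge> N \<and> (\<forall>i<k. y (real i / 2^n) \<in> thicken A (1 / Suc N)) \<and> y (real k / 2^n) \<in> thicken U (1 / Suc N)"
    using out unfolding outer_exit_def grid_exit_def by metis
  then obtain \<nu> \<kappa> where \<nu>: "\<And>N. \<nu> N \<ge> N"
    and before: "\<And>N i. i < \<kappa> N \<Longrightarrow> y (real i / 2^\<nu> N) \<in> thicken A (1 / Suc N)"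
    and at: "\<And>N. y (real (\<kappa> N) / 2^\<nu> N) \<in> thicken U (1 / Suc N)"
    by metis
  define \<tau> where "\<tau> N = real (\<kappa> N) / 2^\<nu> N" for N
  have \<tau>0: "0 \<le> \<tau> N" for N
    by (simp add: \<tau>_def)
  define S where "S = {s. 0 \<le> s \<and> y s \<notin> closure A}"
  define \<sigma> where "\<sigma> = Inf S"
  have S_bdd: "bdd_below S"
    by (auto simp: S_def intro!: bdd_belowI[of _ 0])
  have "0 < d"
    using sep by (simp add: separated_def)
  have \<tau>S: "\<forall>\<^sub>F N in sequentially. \<tau> N \<in> S"
    using eventually_Suc_fine[OF \<open>0 < d\<close>]
  proof eventually_elim
    case (elim N)
    have "y (\<tau> N) \<notin> closure A"
    proof
      assume *: "y (\<tau> N) \<in> closure A"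
      obtain u where u: "u \<in> U" "dist u (y (\<tau> N)) < 1 / Suc N"
        using at[of N] by (auto simp: \<tau>_def thicken_def)
      then have "d \<le> dist (y (\<tau> N)) u"
        using separated_closure[OF sep] * closure_subset[of U] unfolding separated_def by blast
      then show False
        using u(2) elim by (simp add: dist_commute)
    qed
    then show ?case
      by (simp add: S_def \<tau>0)
  qed
  then have "S \<noteq> {}"
    using eventually_happens'[OF _ \<tau>S] by auto
  then have \<sigma>0: "0 \<le> \<sigma>"
    unfolding \<sigma>_def by (intro cInf_greatest) (auto simp: S_def)
  have \<sigma>_le: "\<sigma> \<le> s" if "s \<in> S" for s
    unfolding \<sigma>_def using that S_bdd by (rule cInf_lower)
  have \<tau>_lim: "\<forall>\<^sub>F N in sequentially. \<tau> N < \<sigma> + \<eta>" if \<eta>: "0 < \<eta>" for \<eta>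
  proof -
    have "Inf S < \<sigma> + \<eta>"
      using \<eta> by (simp add: \<sigma>_def)
    then obtain s where s: "s \<in> S" "s < \<sigma> + \<eta>"
      using \<open>S \<noteq> {}\<close> cInf_lessD by blast
    have "open (- closure A)" "y s \<in> - closure A"
      using s by (auto simp: S_def)
    then obtain e where e: "0 < e" "y s \<in> shrink (- closure A) e"
      by (rule open_imp_shrink)
    obtain \<delta> where \<delta>: "0 < \<delta>" "\<And>r. s \<le> r \<Longrightarrow> r < s + \<delta> \<Longrightarrow> dist (y r) (y s) < e/2"
      using right_contD[OF y, of s "e/2"] s e by (auto simp: S_def)
    have "0 < min \<delta> (\<sigma> + \<eta> - s)" "0 < e/2"
      using \<delta> s e by auto
    from eventually_grid_fine[OF this(1)] eventually_Suc_fine[OF this(2)]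
    show ?thesis
    proof eventually_elim
      case (elim N)
      obtain k where k: "s \<le> real k / 2^\<nu> N" "real k / 2^\<nu> N < s + 1 / 2^\<nu> N"
        using first_grid_point[of s "\<nu> N"] s by (auto simp: S_def)
      have "(1::real) / 2^\<nu> N \<le> 1 / 2^N"
        using \<nu>[of N] by (intro divide_left_mono power_increasing) auto
      then have k': "real k / 2^\<nu> N < s + min \<delta> (\<sigma> + \<eta> - s)"
        using k elim by linarith
      have "\<not> k < \<kappa> N"
      proof
        assume "k < \<kappa> N"
        from before[OF this] obtain a where a: "a \<in> A" "dist a (y (real k / 2^\<nu> N)) < 1 / Suc N"
          by (auto simp: thicken_def)
        then have "dist a (y (real k / 2^\<nu> N)) < e/2"
          using elim by linarith
        moreover have "dist (y (real k / 2^\<nu> N)) (y s) < e/2"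
          using \<delta>(2)[OF k(1)] k' by linarith
        moreover have "dist (y s) a \<le> dist a (y (real k / 2^\<nu> N)) + dist (y (real k / 2^\<nu> N)) (y s)"
          by metric
        ultimately have "a \<in> ball (y s) e"
          by simp
        then have "a \<notin> closure A"
          using e(2) by (auto simp: shrink_def)
        then show False
          using a(1) closure_subset by blast
      qed
      then have "\<tau> N \<le> real k / 2^\<nu> N"
        by (simp add: \<tau>_def divide_right_mono)
      then show ?case
        using k' by linarith
    qed
  qed
  have "y \<sigma> \<in> closure U"
    unfolding closure_approachable
  proof (intro allI impI)
    fix e :: real assume "0 < e"
    then obtain \<delta> where \<delta>: "0 < \<delta>" "\<And>r. \<sigma> \<le> r \<Longrightarrow> r < \<sigma> + \<delta> \<Longrightarrow> dist (y r) (y \<sigma>) < e/2"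
      using right_contD[OF y \<sigma>0, of "e/2"] by auto
    have "\<forall>\<^sub>F N in sequentially. \<tau> N < \<sigma> + \<delta> \<and> 1 / Suc N < e/2 \<and> \<tau> N \<in> S"
      using \<tau>_lim[OF \<delta>(1)] eventually_Suc_fine[OF half_gt_zero[OF \<open>0 < e\<close>]] \<tau>S by eventually_elim simp
    then obtain N where N: "\<tau> N < \<sigma> + \<delta>" "1 / Suc N < e/2" "\<tau> N \<in> S"
      using eventually_happens' sequentially_bot by blast
    obtain u where u: "u \<in> U" "dist u (y (\<tau> N)) < 1 / Suc N"
      using at[of N] by (auto simp: \<tau>_def thicken_def)
    have "dist (y (\<tau> N)) (y \<sigma>) < e/2"
      using N \<sigma>_le \<delta> by auto
    then have "dist u (y \<sigma>) < e"
      using u N(2) dist_triangle[of u "y \<sigma>" "y (\<tau> N)"] by linarith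
    then show "\<exists>u\<in>U. dist u (y \<sigma>) < e"
      using u by auto
  qed
  moreover have "y s \<in> closure A" if "0 \<le> s" "s < \<sigma>" for s
    using \<sigma>_le[of s] that by (force simp: S_def)
  ultimately show ?thesis
    using \<sigma>0 by (auto simp: exits_at_def)
qed

lemma exits_at_imp_outer_exit:
  assumes y: "right_cont y" and t: "exits_at (closure A) (closure U) y t"
  shows "outer_exit A U y"
  unfolding outer_exit_def
proof
  fix N
  obtain \<delta> where \<delta>: "0 < \<delta>" "\<And>r. t \<le> r \<Longrightarrow> r < t + \<delta> \<Longrightarrow> dist (y r) (y t) < 1 / Suc N / 2"
    using right_contD[OF y, of t "1 / Suc N / 2"] t by (auto simp: exits_at_def)
  have "\<forall>\<^sub>F n in sequentially. N \<le> n \<and> 1 / 2^n < \<delta>"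
    using eventually_grid_fine[OF \<delta>(1)] eventually_ge_at_top[of N] by eventually_elim simp
  then obtain n where n: "N \<le> n" "1 / 2^n < \<delta>"
    using eventually_happens' sequentially_bot by blast
  obtain k where k: "t \<le> real k / 2^n" "real k / 2^n < t + 1 / 2^n" "\<And>i. i < k \<Longrightarrow> real i / 2^n < t"
    using first_grid_point[of t n] t by (auto simp: exits_at_def)
  have "y (real i / 2^n) \<in> thicken A (1 / Suc N)" if "i < k" for i
    using t k(3)[OF that] closure_subset_thicken[of "1 / Suc N" A] by (auto simp: exits_at_def)
  moreover have "y (real k / 2^n) \<in> thicken U (1 / Suc N)"
  proof (rule thicken_near)
    show "y t \<in> thicken U (1 / Suc N / 2)"
      using t closure_subset_thicken[of "1 / Suc N / 2" U] by (auto simp: exits_at_def)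
    show "dist (y t) (y (real k / 2^n)) < 1 / Suc N / 2"
      using \<delta>(2)[OF k(1)] k(2) n by (simp add: dist_commute)
    show "1 / Suc N / 2 + 1 / Suc N / 2 \<le> 1 / Suc N"
      by (simp only: field_sum_of_halves)
  qed
  ultimately show "\<exists>n\<ge>N. grid_exit n (thicken A (1 / Suc N)) (thicken U (1 / Suc N)) y"
    using n(1) unfolding grid_exit_def by blast
qed

lemma exits_at_imp_inner_exit:
  assumes y: "right_cont y" and e: "0 < e" and t: "exits_at (shrink A e) (shrink U e) y t"
  shows "inner_exit A U y"
proof -
  obtain \<delta> where \<delta>: "0 < \<delta>" "\<And>r. t \<le> r \<Longrightarrow> r < t + \<delta> \<Longrightarrow> dist (y r) (y t) < e/2"
    using right_contD[OF y, of t "e/2"] t e by (auto simp: exits_at_def)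
  have "\<forall>\<^sub>F N in sequentially. 1 / Suc N < e/2 \<and> 1 / 2^N < \<delta>"
    using eventually_grid_fine[OF \<delta>(1)] eventually_Suc_fine[OF half_gt_zero[OF e]] by eventually_elim simp
  then obtain N where N: "1 / Suc N < e/2" "1 / 2^N < \<delta>"
    using eventually_happens' sequentially_bot by blast
  have "grid_exit n (shrink A (1 / Suc N)) (shrink U (1 / Suc N)) y" if "N \<le> n" for n
  proof -
    have n: "1 / 2^n < \<delta>"
    proof -
      have "(1::real) / 2^n \<le> 1 / 2^N"
        using that by (intro divide_left_mono power_increasing) auto
      then show ?thesis
        using N by linarith
    qed
    obtain k where k: "t \<le> real k / 2^n" "real k / 2^n < t + 1 / 2^n" "\<And>i. i < k \<Longrightarrow> real i / 2^n < t"
      using first_grid_point[of t n] t by (auto simp: exits_at_def)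
    have "shrink A e \<subseteq> shrink A (1 / Suc N)"
      using N e by (intro shrink_antimono) linarith
    then have "y (real i / 2^n) \<in> shrink A (1 / Suc N)" if "i < k" for i
      using t k(3)[OF that] by (auto simp: exits_at_def)
    moreover have "y (real k / 2^n) \<in> shrink U (1 / Suc N)"
    proof (rule shrink_near)
      show "y t \<in> shrink U e"
        using t by (auto simp: exits_at_def)
      show "dist (y t) (y (real k / 2^n)) \<le> e/2"
        using \<delta>(2)[OF k(1)] k(2) n by (simp add: dist_commute)
      show "e/2 + 1 / Suc N \<le> e"
        using N by linarith
    qed
    ultimately show ?thesis
      unfolding grid_exit_def by blast
  qed
  then show ?thesis
    unfolding inner_exit_def by blast
qed

lemma inner_exit_imp:
  assumes y: "right_cont y" and sep: "separated d A U" and inn: "inner_exit A U y"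
  shows "\<exists>e>0. \<exists>t. exits_at (shrink A e) (shrink U e) y t"
proof -
  obtain N where N: "\<And>n. n \<ge> N \<Longrightarrow> grid_exit n (shrink A (1 / Suc N)) (shrink U (1 / Suc N)) y"
    using inn by (auto simp: inner_exit_def)
  let ?A = "shrink A (1 / Suc N)" and ?U = "shrink U (1 / Suc N)"
  have "?A \<subseteq> A" "?U \<subseteq> U"
    by (auto intro!: shrink_subset)
  then have "separated d ?A ?U"
    using sep unfolding separated_def by blast
  moreover have "outer_exit ?A ?U y"
    unfolding outer_exit_def
  proof
    fix N'
    show "\<exists>n\<ge>N'. grid_exit n (thicken ?A (1 / Suc N')) (thicken ?U (1 / Suc N')) y"
      by (intro exI[of _ "max N N'"] conjI grid_exit_mono[OF N] subset_thicken) auto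
  qed
  ultimately have "\<exists>t. exits_at (closure ?A) (closure ?U) y t"
    by (rule outer_exit_imp[OF y])
  then show ?thesis
    by (intro exI[of _ "1 / Suc N"]) simp
qed

lemma exits_at_mono: "exits_at A U y t \<Longrightarrow> A \<subseteq> A' \<Longrightarrow> U \<subseteq> U' \<Longrightarrow> exits_at A' U' y t"
  by (auto simp: exits_at_def)

lemma first_exit:
  assumes y: "right_cont y" and A: "open A" and s: "0 \<le> s" "y s \<notin> A"
  shows "\<exists>t. exits_at A (- A) y t \<and> t \<le> s"
proof -
  define S where "S = {s. 0 \<le> s \<and> y s \<notin> A}"
  define t where "t = Inf S"
  have S_bdd: "bdd_below S"
    by (auto simp: S_def intro!: bdd_belowI[of _ 0])
  have "s \<in> S"
    using s by (simp add: S_def)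
  have t_le: "t \<le> r" if "r \<in> S" for r
    unfolding t_def using that S_bdd by (rule cInf_lower)
  have t0: "0 \<le> t"
    unfolding t_def using \<open>s \<in> S\<close> by (intro cInf_greatest) (auto simp: S_def)
  have "y t \<notin> A"
  proof
    assume "y t \<in> A"
    then obtain e where e: "0 < e" "ball (y t) e \<subseteq> A"
      using A by (auto simp: open_contains_ball)
    obtain \<delta> where \<delta>: "0 < \<delta>" "\<And>r. t \<le> r \<Longrightarrow> r < t + \<delta> \<Longrightarrow> dist (y r) (y t) < e"
      using right_contD[OF y t0 e(1)] by blast
    have "Inf S < t + \<delta>"
      using \<delta> by (simp add: t_def)
    then obtain r where "r \<in> S" "r < t + \<delta>"
      using \<open>s \<in> S\<close> cInf_lessD by blast
    then have "y r \<in> A"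
      using \<delta>(2)[of r] t_le e by (auto simp: dist_commute)
    then show False
      using \<open>r \<in> S\<close> by (simp add: S_def)
  qed
  moreover have "y r \<in> A" if "0 \<le> r" "r < t" for r
    using t_le[of r] that by (force simp: S_def)
  ultimately show ?thesis
    using t0 t_le[OF \<open>s \<in> S\<close>] by (auto simp: exits_at_def)
qed

lemma exits_into_iff:
  assumes y: "right_cont (\<lambda>s. X s \<omega>)" and A: "open A"
  shows "exits_into X A V \<omega> \<longleftrightarrow> (\<exists>t. exits_at A (V - A) (\<lambda>s. X s \<omega>) t)"
proof -
  have *: "exit_time X A \<omega> = ereal t" if "exits_at A (- A) (\<lambda>s. X s \<omega>) t" for t
    unfolding exit_time_def
  proof (rule antisym)
    show "Inf {ereal s |s. 0 \<le> s \<and> X s \<omega> \<notin> A} \<le> ereal t"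
      using that by (intro Inf_lower) (auto simp: exits_at_def)
    show "ereal t \<le> Inf {ereal s |s. 0 \<le> s \<and> X s \<omega> \<notin> A}"
      using that by (intro Inf_greatest) (force simp: exits_at_def)
  qed
  show ?thesis
  proof
    assume ex: "exits_into X A V \<omega>"
    then have "exit_time X A \<omega> < \<infinity>"
      by (simp add: exits_into_def)
    then obtain s where "0 \<le> s" "X s \<omega> \<notin> A"
      unfolding exit_time_def Inf_less_iff by auto
    then obtain t where t: "exits_at A (- A) (\<lambda>s. X s \<omega>) t"
      using first_exit[OF y A] by blast
    then have "X t \<omega> \<in> V"
      using ex *[OF t] by (simp add: exits_into_def)
    then show "\<exists>t. exits_at A (V - A) (\<lambda>s. X s \<omega>) t"
      using t by (auto simp: exits_at_def)
  next
    assume "\<exists>t. exits_at A (V - A) (\<lambda>s. X s \<omega>) t"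
    then obtain t where t: "exits_at A (V - A) (\<lambda>s. X s \<omega>) t" ..
    then have "exit_time X A \<omega> = ereal t"
      by (intro * exits_at_mono[OF t]) auto
    then show "exits_into X A V \<omega>"
      using t by (simp add: exits_into_def exits_at_def)
  qed
qed

lemma exits_at_imp_grid_exit:
  assumes y: "right_cont y" and U: "open U" and t: "exits_at A U y t"
  shows "\<forall>\<^sub>F n in sequentially. grid_exit n A U y"
proof -
  obtain e where e: "0 < e" "ball (y t) e \<subseteq> U"
    using U t by (auto simp: open_contains_ball exits_at_def)
  obtain \<delta> where \<delta>: "0 < \<delta>" "\<And>r. t \<le> r \<Longrightarrow> r < t + \<delta> \<Longrightarrow> dist (y r) (y t) < e"
    using right_contD[OF y, of t e] t e by (auto simp: exits_at_def)
  from eventually_grid_fine[OF \<delta>(1)] show ?thesis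
  proof eventually_elim
    case (elim n)
    obtain k where k: "t \<le> real k / 2^n" "real k / 2^n < t + 1 / 2^n" "\<And>i. i < k \<Longrightarrow> real i / 2^n < t"
      using first_grid_point[of t n] t by (auto simp: exits_at_def)
    have "y (real i / 2^n) \<in> A" if "i < k" for i
      using t k(3)[OF that] by (auto simp: exits_at_def)
    moreover have "y (real k / 2^n) \<in> U"
      using \<delta>(2)[OF k(1)] k(2) elim e by (auto simp: dist_commute)
    ultimately show ?case
      unfolding grid_exit_def by blast
  qed
qed

lemma frequently_grid_exit_imp:
  assumes y: "right_cont y" and B: "open B" and V: "closure B \<union> closure W \<subseteq> V"
    and freq: "\<exists>\<^sub>F n in sequentially. grid_exit n B (W - B) y"
  shows "\<exists>t. exits_at B (V - B) y t"
proof -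
  obtain n k where "y (real k / 2^n) \<in> W - B"
    using frequently_ex[OF freq] by (auto simp: grid_exit_def)
  then obtain \<tau> where \<tau>: "exits_at B (- B) y \<tau>"
    using first_exit[OF y B, of "real k / 2^n"] by auto
  have "y \<tau> \<in> V"
  proof (cases "y \<tau> \<in> closure B")
    case False
    then have "open (- closure B)" "y \<tau> \<in> - closure B"
      by auto
    then obtain e0 where e0: "0 < e0" "ball (y \<tau>) e0 \<subseteq> - closure B"
      by (meson open_contains_ball)
    have "y \<tau> \<in> closure W"
      unfolding closure_approachable
    proof (intro allI impI)
      fix e :: real assume "0 < e"
      then obtain \<delta> where \<delta>: "0 < \<delta>" "\<And>r. \<tau> \<le> r \<Longrightarrow> r < \<tau> + \<delta> \<Longrightarrow> dist (y r) (y \<tau>) < min e e0"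
        using right_contD[OF y, of \<tau> "min e e0"] \<tau> e0 by (auto simp: exits_at_def)
      from frequently_eventually_frequently[OF freq eventually_grid_fine[OF \<delta>(1)]]
      obtain n where n: "grid_exit n B (W - B) y" "1 / 2^n < \<delta>"
        using frequently_ex by blast
      obtain k where k: "\<And>i. i < k \<Longrightarrow> y (real i / 2^n) \<in> B" "y (real k / 2^n) \<in> W - B"
        using n(1) by (auto simp: grid_exit_def)
      obtain l where l: "\<tau> \<le> real l / 2^n" "real l / 2^n < \<tau> + 1 / 2^n"
        using first_grid_point[of \<tau> n thesis] \<tau> unfolding exits_at_def by blast
      have "y (real l / 2^n) \<in> ball (y \<tau>) e0"
        using \<delta>(2)[OF l(1)] l(2) n(2) by (simp add: dist_commute)
      then have "y (real l / 2^n) \<notin> B"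
        using e0 closure_subset by blast
      then have "k \<le> l"
        using k(1) not_le by blast
      then have "real k / 2^n \<le> real l / 2^n"
        by (simp add: divide_right_mono)
      moreover have "\<tau> \<le> real k / 2^n"
      proof (rule ccontr)
        assume "\<not> \<tau> \<le> real k / 2^n"
        then have "y (real k / 2^n) \<in> B"
          using \<tau> by (auto simp: exits_at_def)
        then show False
          using k(2) by simp
      qed
      ultimately have "dist (y (real k / 2^n)) (y \<tau>) < e"
        using \<delta>(2)[of "real k / 2^n"] l n by auto
      then show "\<exists>w\<in>W. dist w (y \<tau>) < e"
        using k(2) by blast
    qed
    then show ?thesis
      using V by blast
  qed (use V in blast)
  then show ?thesis
    using \<tau> by (auto simp: exits_at_def)
qed

lemma exit_dichotomy_at_first_move:
  fixes y :: "real \<Rightarrow> 'a::euclidean_space"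
  assumes y: "right_cont y" and y0: "y 0 = 0" and A: "open A" and U: "open U" and x: "x \<in> A"
    and sep: "separated d A U"
    and restart: "\<And>h. h \<in> dyadic_times \<Longrightarrow> y h \<noteq> 0 \<Longrightarrow>
        outer_exit A U (\<lambda>s. x + y h + (y (h + s) - y h)) \<Longrightarrow> inner_exit A U (\<lambda>s. x + y h + (y (h + s) - y h))"
    and first: "\<And>T. 0 \<le> T \<Longrightarrow> (\<And>s. 0 \<le> s \<Longrightarrow> s < T \<Longrightarrow> y s = 0) \<Longrightarrow> x + y T \<notin> frontier A \<union> frontier U"
    and outer: "outer_exit A U (\<lambda>s. x + y s)"
  shows "inner_exit A U (\<lambda>s. x + y s)"
proof -
  have rc: "right_cont (\<lambda>s. x + y s)"
    using y unfolding right_cont_def by (auto intro!: continuous_intros)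
  obtain t where t: "exits_at (closure A) (closure U) (\<lambda>s. x + y s) t"
    using outer_exit_imp[OF rc sep outer] ..
  have sep': "separated d (closure A) (closure U)"
    by (rule separated_closure[OF sep])
  have "x \<notin> closure U"
    using sep' x closure_subset[of A] unfolding separated_def by force
  then have yt: "y t \<noteq> 0" and "0 \<le> t"
    using t by (auto simp: exits_at_def)
  obtain T where T: "exits_at {0} (- {0}) y T \<or> (0 \<le> T \<and> T < t \<and> (\<forall>s. 0 \<le> s \<and> s < T \<longrightarrow> y s = 0) \<and>
      (\<forall>\<eta>>0. \<exists>s. T \<le> s \<and> s < T + \<eta> \<and> s < t \<and> y s \<noteq> 0))" and "T \<le> t"
  proof -
    define S where "S = {s. 0 \<le> s \<and> y s \<noteq> 0}"
    define T where "T = Inf S"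
    have S_bdd: "bdd_below S"
      by (auto simp: S_def intro!: bdd_belowI[of _ 0])
    have "t \<in> S"
      using yt \<open>0 \<le> t\<close> by (simp add: S_def)
    have T_le: "T \<le> r" if "r \<in> S" for r
      unfolding T_def using that S_bdd by (rule cInf_lower)
    have T0: "0 \<le> T"
      unfolding T_def using \<open>t \<in> S\<close> by (intro cInf_greatest) (auto simp: S_def)
    have before: "\<forall>s. 0 \<le> s \<and> s < T \<longrightarrow> y s = 0"
      using T_le by (force simp: S_def)
    have near: "\<exists>s\<in>S. s < T + \<eta>" if "0 < \<eta>" for \<eta>
    proof -
      have "Inf S < T + \<eta>"
        using that by (simp add: T_def)
      then show ?thesis
        using \<open>t \<in> S\<close> cInf_lessD by blast
    qed
    show ?thesis
    proof (cases "T = t")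
      case True
      then show ?thesis
        using that[of T] yt T0 before by (auto simp: exits_at_def)
    next
      case False
      then have "T < t"
        using T_le[OF \<open>t \<in> S\<close>] by simp
      have "\<exists>s. T \<le> s \<and> s < T + \<eta> \<and> s < t \<and> y s \<noteq> 0" if \<eta>: "0 < \<eta>" for \<eta>
      proof -
        obtain s where "s \<in> S" "s < T + min \<eta> (t - T)"
          using near[of "min \<eta> (t - T)"] \<eta> \<open>T < t\<close> by (metis diff_gt_0_iff_gt min_less_iff_conj)
        then show ?thesis
          using T_le[of s] by (intro exI[of _ s]) (auto simp: S_def)
      qed
      then show ?thesis
        using \<open>T < t\<close> T0 before by (intro that[of T]) auto
    qed
  qed
  have T0: "0 \<le> T" and before: "\<And>s. 0 \<le> s \<Longrightarrow> s < T \<Longrightarrow> y s = 0"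
    using T by (auto simp: exits_at_def)
  have xT: "x + y T \<notin> frontier A \<union> frontier U"
    by (rule first[OF T0 before])
  show ?thesis
  proof (cases "T = t")
    case True
    then have "x + y t \<in> U"
      using xT t U by (auto simp: exits_at_def frontier_def interior_open)
    then obtain e1 where e1: "0 < e1" "x + y t \<in> shrink U e1"
      using open_imp_shrink[OF U] by blast
    obtain e2 where e2: "0 < e2" "x \<in> shrink A e2"
      using A x by (rule open_imp_shrink)
    have "exits_at (shrink A (min e1 e2)) (shrink U (min e1 e2)) (\<lambda>s. x + y s) t"
      using e1(2) e2(2) before True \<open>0 \<le> t\<close> shrink_antimono[of "min e1 e2" e1 U] shrink_antimono[of "min e1 e2" e2 A]
      by (auto simp: exits_at_def)
    then show ?thesis
      using e1 e2 by (intro exits_at_imp_inner_exit[OF rc, of "min e1 e2"]) auto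
  next
    case False
    then have "T < t"
      using \<open>T \<le> t\<close> by simp
    then have "x + y T \<in> A"
      using xT t A T0 by (auto simp: exits_at_def frontier_def interior_open)
    then obtain e1 where e1: "0 < e1" "x + y T \<in> shrink A e1"
      using open_imp_shrink[OF A] by blast
    obtain e2 where e2: "0 < e2" "x \<in> shrink A e2"
      using A x by (rule open_imp_shrink)
    obtain \<eta> where \<eta>: "0 < \<eta>" "\<And>s. T \<le> s \<Longrightarrow> s < T + \<eta> \<Longrightarrow> dist (y s) (y T) < e1/2"
      using right_contD[OF y T0, of "e1/2"] e1 by auto
    obtain s where s: "T \<le> s" "s < T + \<eta>" "s < t" "y s \<noteq> 0"
    proof (cases "y T = 0")
      case True
      then show ?thesis
        using T \<eta>(1) that by (auto simp: exits_at_def)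
    next
      case False
      then show ?thesis
        using that[of T] \<eta>(1) \<open>T < t\<close> by auto
    qed
    obtain \<delta> where \<delta>: "0 < \<delta>" "\<And>r. s \<le> r \<Longrightarrow> r < s + \<delta> \<Longrightarrow> dist (y r) (y s) < norm (y s)"
      using right_contD[OF y, of s "norm (y s)"] s T0 by auto
    have "0 \<le> s" "s < min (s + \<delta>) (min (T + \<eta>) t)"
      using s \<delta> T0 by auto
    then obtain h where h: "h \<in> dyadic_times" "s < h" "h < min (s + \<delta>) (min (T + \<eta>) t)"
      by (rule dyadic_between)
    have "y h \<noteq> 0"
      using \<delta>(2)[of h] h by (auto simp: dist_norm)
    let ?z = "\<lambda>r. x + y h + (y (h + r) - y h)"
    have h0: "0 \<le> h"
      using h(1) by (rule dyadic_times_nonneg)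
    have rcz: "right_cont ?z"
      unfolding right_cont_def
    proof (intro allI impI)
      fix r :: real assume "0 \<le> r"
      then have "((\<lambda>s. x + y s) \<longlongrightarrow> x + y (h + r)) (at_right (h + r))"
        using rc h0 by (auto simp: right_cont_def continuous_within)
      then have "((\<lambda>s. x + y (s + h)) \<longlongrightarrow> x + y (h + r)) (at_right r)"
        by (subst (asm) add.commute[of h r], subst (asm) at_right_to_0, subst at_right_to_0)
           (simp add: filterlim_filtermap add_ac)
      then show "continuous (at_right r) ?z"
        by (simp add: continuous_within add_ac)
    qed
    have "exits_at (closure A) (closure U) ?z (t - h)"
      using t h h0 by (auto simp: exits_at_def)
    then have "outer_exit A U ?z"
      by (rule exits_at_imp_outer_exit[OF rcz])
    then have "inner_exit A U ?z"
      by (rule restart[OF h(1) \<open>y h \<noteq> 0\<close>])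
    then obtain e3 t' where e3: "0 < e3" "exits_at (shrink A e3) (shrink U e3) ?z t'"
      using inner_exit_imp[OF rcz sep] by blast
    define e where "e = min e3 (min (e1/2) e2)"
    have e: "0 < e" "e \<le> e3" "e \<le> e1/2" "e \<le> e2"
      using e1 e2 e3 by (auto simp: e_def)
    have "exits_at (shrink A e) (shrink U e) (\<lambda>s. x + y s) (h + t')"
      unfolding exits_at_def
    proof (intro conjI allI impI)
      show "0 \<le> h + t'"
        using e3(2) h0 by (simp add: exits_at_def)
      show "x + y (h + t') \<in> shrink U e"
        using e3(2) shrink_antimono[OF e(2), of U] by (auto simp: exits_at_def)
      fix r assume r: "0 \<le> r \<and> r < h + t'"
      consider "r < T" | "T \<le> r" "r < h" | "h \<le> r"
        by linarith
      then show "x + y r \<in> shrink A e"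
      proof cases
        case 1
        then show ?thesis
          using before r e2(2) shrink_antimono[OF e(4), of A] by auto
      next
        case 2
        have "dist (x + y T) (x + y r) \<le> e1/2"
          using \<eta>(2)[of r] 2 h by (simp add: dist_norm norm_minus_commute)
        then show ?thesis
          using e(3) by (intro shrink_near[OF e1(2)]) auto
      next
        case 3
        then have "0 \<le> r - h" "r - h < t'"
          using r by auto
        then have "?z (r - h) \<in> shrink A e3"
          using e3(2) unfolding exits_at_def by blast
        then have "x + y r \<in> shrink A e3"
          by simp
        then show ?thesis
          using shrink_antimono[OF e(2)] by blast
      qed
    qed
    then show ?thesis
      by (rule exits_at_imp_inner_exit[OF rc e(1)])
  qed
qed

lemma countable_separated_exit_times:
  fixes y :: "real \<Rightarrow> 'a::euclidean_space"
  assumes left: "\<And>t. 0 < t \<Longrightarrow> \<exists>l. (y \<longlongrightarrow> l) (at_left t)"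
    and sep: "separated d A U"
  shows "\<exists>T. countable T \<and> (\<forall>x t. exits_at (closure A) (closure U) (\<lambda>s. x + y s) t \<longrightarrow> t \<in> T)"
proof -
  have "0 < d"
    using sep by (simp add: separated_def)
  define \<theta> where "\<theta> q = Inf {s. q \<le> s \<and> d/2 \<le> dist (y s) (y q)}" for q
  have "t \<in> insert 0 (\<theta> ` \<rat>)" if t: "exits_at (closure A) (closure U) (\<lambda>s. x + y s) t" for x t
  proof (cases "t = 0")
    case False
    then have "0 < t"
      using t by (auto simp: exits_at_def)
    then obtain l where l: "(y \<longlongrightarrow> l) (at_left t)"
      using left by blast
    then have "\<forall>\<^sub>F s in at_left t. dist (y s) l < d/4"
      by (rule tendstoD) (use \<open>0 < d\<close> in simp)
    then obtain b where b: "b < t" "\<And>s. b < s \<Longrightarrow> s < t \<Longrightarrow> dist (y s) l < d/4"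
      by (auto simp: eventually_at_left_field)
    obtain q where q: "q \<in> \<rat>" "max 0 b < q" "q < t"
      using Rats_dense_in_real[of "max 0 b" t] b \<open>0 < t\<close> by auto
    have "x + y q \<in> closure A" "x + y t \<in> closure U"
      using t q by (auto simp: exits_at_def)
    then have "d \<le> dist (x + y q) (x + y t)"
      using separated_closure[OF sep] unfolding separated_def by blast
    then have "d/2 \<le> dist (y t) (y q)"
      using \<open>0 < d\<close> by (simp add: dist_commute[of "y t"])
    moreover have "t \<le> s" if "q \<le> s" "d/2 \<le> dist (y s) (y q)" for s
    proof (rule ccontr)
      assume "\<not> t \<le> s"
      then have "dist (y s) l < d/4" "dist (y q) l < d/4"
        using b q that by auto
      then show False
        using that dist_triangle2[of "y s" "y q" l] by linarith
    qed
    ultimately have "\<theta> q = t"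
      unfolding \<theta>_def using q by (intro cInf_eq_minimum) auto
    then show ?thesis
      using q by blast
  qed simp
  moreover have "countable (insert 0 (\<theta> ` \<rat>))"
    by (simp add: countable_rat)
  ultimately show ?thesis
    by blast
qed

lemma negligible_ambiguous_starts:
  fixes y :: "real \<Rightarrow> 'a::euclidean_space"
  assumes y: "right_cont y" and left: "\<And>t. 0 < t \<Longrightarrow> \<exists>l. (y \<longlongrightarrow> l) (at_left t)"
    and A: "open A" "convex A" and U: "open U" "negligible (frontier U)" and sep: "separated d A U"
  shows "negligible {x. outer_exit A U (\<lambda>s. x + y s) \<and> \<not> inner_exit A U (\<lambda>s. x + y s)}"
proof -
  obtain T where T: "countable T" "\<And>x t. exits_at (closure A) (closure U) (\<lambda>s. x + y s) t \<Longrightarrow> t \<in> T"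
    using countable_separated_exit_times[OF left sep] by blast
  define C where "C t = (\<Inter>s\<in>{s. 0 \<le> s \<and> s < t}. (\<lambda>z. - y s + z) ` closure A)" for t
  have C: "x \<in> C t \<longleftrightarrow> (\<forall>s. 0 \<le> s \<and> s < t \<longrightarrow> x + y s \<in> closure A)" for x t
    unfolding C_def by (auto simp: image_iff intro!: bexI[of _ "x + y _"]) 
  have "convex (C t)" for t
    unfolding C_def by (intro convex_INT convex_translation convex_closure A)
  then have "negligible (\<Union>t\<in>T. frontier (C t) \<union> (\<lambda>z. - y t + z) ` frontier U)"
    using T(1) U by (intro negligible_countable_Union)
      (auto intro!: negligible_Un negligible_convex_frontier simp del: uminus_add_conv_diff intro: negligible_translation)
  then show ?thesis
  proof (rule negligible_subset, safe)
    fix x assume outer: "outer_exit A U (\<lambda>s. x + y s)" and inner: "\<not> inner_exit A U (\<lambda>s. x + y s)"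
    have rc: "right_cont (\<lambda>s. x + y s)"
      using y unfolding right_cont_def by (auto intro!: continuous_intros)
    obtain t where t: "exits_at (closure A) (closure U) (\<lambda>s. x + y s) t"
      using outer_exit_imp[OF rc sep outer] ..
    have "x \<in> frontier (C t) \<or> x + y t \<in> frontier U"
    proof (rule ccontr)
      assume *: "\<not> ?thesis"
      have "x \<in> C t"
        using t by (auto simp: C exits_at_def)
      then have "x \<in> interior (C t)"
        using * closure_subset[of "C t"] by (auto simp: frontier_def)
      then obtain e1 where e1: "0 < e1" "ball x e1 \<subseteq> C t"
        by (meson interior_subset open_contains_ball open_interior subset_trans)
      have "x + y t \<in> U"
        using * t U by (auto simp: exits_at_def frontier_def interior_open)
      then obtain e2 where e2: "0 < e2" "x + y t \<in> shrink U e2"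
        using open_imp_shrink[OF U(1)] by blast
      define e where "e = min e1 e2"
      have "x + y s \<in> shrink A e" if s: "0 \<le> s" "s < t" for s
      proof -
        have "ball (x + y s) e \<subseteq> closure A"
        proof
          fix v assume "v \<in> ball (x + y s) e"
          then have "v - y s \<in> ball x e1"
            by (simp add: e_def dist_norm algebra_simps)
          then have "v - y s \<in> C t"
            using e1 by blast
          then show "v \<in> closure A"
            using s by (auto simp: C)
        qed
        then have "ball (x + y s) e \<subseteq> interior (closure A)"
          by (rule interior_maximal) simp
        then show ?thesis
          using A by (simp add: shrink_def convex_interior_closure interior_open)
      qed
      moreover have "x + y t \<in> shrink U e"
        using e2 shrink_antimono[of e e2 U] by (auto simp: e_def)
      ultimately have "exits_at (shrink A e) (shrink U e) (\<lambda>s. x + y s) t"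
        using t by (auto simp: exits_at_def)
      then have "inner_exit A U (\<lambda>s. x + y s)"
        using e1 e2 by (intro exits_at_imp_inner_exit[OF rc, of e]) (auto simp: e_def)
      then show False
        using inner by blast
    qed
    then show "x \<in> (\<Union>t\<in>T. frontier (C t) \<union> (\<lambda>z. - y t + z) ` frontier U)"
      using T(2)[OF t] by (auto simp: image_iff intro!: bexI[of _ t] bexI[of _ "x + y t"])
  qed
qed

section \<open>The start of the path\<close>

lemma thicken_borel [measurable]: "thicken A e \<in> sets borel"
  by (simp add: borel_open)

lemma shrink_borel [measurable]: "shrink A e \<in> sets borel"
  by (simp add: borel_closed)

lemma outer_exit_pred [measurable]:
  assumes [measurable]: "\<And>k n. (\<lambda>w. f w (real k / 2^n)) \<in> borel_measurable N"
  shows "Measurable.pred N (\<lambda>w. outer_exit A U (f w :: real \<Rightarrow> 'a::euclidean_space))"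
  unfolding outer_exit_def grid_exit_def by measurable

lemma inner_exit_pred [measurable]:
  assumes [measurable]: "\<And>k n. (\<lambda>w. f w (real k / 2^n)) \<in> borel_measurable N"
  shows "Measurable.pred N (\<lambda>w. inner_exit A U (f w :: real \<Rightarrow> 'a::euclidean_space))"
  unfolding inner_exit_def grid_exit_def by measurable

lemma (in step_law) walk_step_origin_pow:
  assumes [measurable]: "\<phi> \<in> borel_measurable borel"
  shows "(walk_step p {0} ^^ Suc k) \<phi> 0 = emeasure p {0} ^ k * (\<integral>\<^sup>+z. \<phi> z \<partial>p)"
proof (induction k)
  case (Suc k)
  have "(walk_step p {0} ^^ Suc (Suc k)) \<phi> 0 = (\<integral>\<^sup>+z. (walk_step p {0} ^^ Suc k) \<phi> z \<partial>p)"
    by (simp add: walk_step_def[of _ _ "walk_step p {0} _"])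
  also have "\<dots> = (\<integral>\<^sup>+z. (walk_step p {0} ^^ Suc k) \<phi> 0 * indicator {0} z \<partial>p)"
    by (intro nn_integral_cong) (auto simp: walk_step_def split: split_indicator)
  also have "\<dots> = (walk_step p {0} ^^ Suc k) \<phi> 0 * emeasure p {0}"
    by (intro nn_integral_cmult_indicator) simp
  finally show ?case
    using Suc by (simp add: mult_ac)
qed (simp add: walk_step_def)

context unimodal_law
begin

lemma emeasure_lborel_null:
  assumes "N \<in> null_sets lborel" "0 \<notin> N"
  shows "emeasure p N = 0"
proof -
  have [measurable]: "N \<in> sets borel"
    using assms by auto
  have "AE x in lborel. x \<notin> N"
    using assms(1) by (rule AE_not_in)
  then have "AE x in lborel. ennreal (m (norm x)) * indicator N x = 0"
    by eventually_elim simp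
  then have "(\<integral>\<^sup>+ x \<in> N. ennreal (m (norm x)) \<partial>lborel) = (\<integral>\<^sup>+ (x::'a). 0 \<partial>lborel)"
    by (rule nn_integral_cong_AE)
  then show ?thesis
    using assms(2) by (simp add: emeasure_p)
qed

lemma AE_lborel_imp_AE_p:
  assumes "AE x in lborel. Q x"
  shows "AE x in p. x \<noteq> 0 \<longrightarrow> Q x"
proof -
  obtain N where N: "N \<in> null_sets lborel" "{x. \<not> Q x} \<subseteq> N"
    using assms by (auto elim!: AE_E simp: null_sets_def)
  have "N - {0} \<in> null_sets p"
    using N(1) by (intro null_setsI emeasure_lborel_null null_set_Diff) auto
  then have "AE x in p. x \<notin> N - {0}"
    by (rule AE_not_in)
  then show ?thesis
    by eventually_elim (use N(2) in auto)
qed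

text \<open>The left side is the law of the first nonzero position of the walk; a radially decreasing
  density of total mass at most 1 is bounded by \<open>1 / volume (ball 0 r)\<close> outside \<open>ball 0 r\<close>.\<close>

lemma first_move_law_le:
  assumes [measurable]: "V \<in> sets borel" and r: "0 < r" and V: "\<And>v. v \<in> V \<Longrightarrow> r \<le> norm v"
  shows "walk_potential p {0} (indicator V) 0 * emeasure lborel (ball (0::'a) r) \<le> emeasure lborel V"
proof -
  define a where "a = emeasure p {0}"
  define b where "b = emeasure p (-{0})"
  have ab: "a + b = 1"
    using emeasure_space_1 unfolding a_def b_def
    by (subst plus_emeasure) (auto simp: Compl_partition)
  have pV: "(\<integral>\<^sup>+z. indicator V z \<partial>p) \<le> ennreal (m r) * emeasure lborel V"
    using mass_le[of V r 0] r V by simp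
  have "ennreal (m r) * emeasure lborel (ball (0::'a) r - {0}) \<le> (\<integral>\<^sup>+w. indicator (ball 0 r - {0}) (0 + w) \<partial>p)"
    by (rule mass_ge) (use r in auto)
  also have "\<dots> \<le> b"
    unfolding b_def by (auto simp: intro!: emeasure_mono)
  also have "emeasure lborel (ball (0::'a) r - {0}) = emeasure lborel (ball (0::'a) r)"
    by (rule emeasure_Diff_null_set) (auto simp: null_sets_def)
  finally have pb: "ennreal (m r) * emeasure lborel (ball (0::'a) r) \<le> b" .
  have "(\<Sum>k<n. a ^ k * b) + a ^ n = 1" for n
  proof (induction n)
    case (Suc n)
    have "a ^ n * b + a ^ Suc n = a ^ n * (a + b)"
      by (simp add: distrib_right mult.commute add.commute)
    then have "(\<Sum>k<Suc n. a ^ k * b) + a ^ Suc n = (\<Sum>k<n. a ^ k * b) + a ^ n * (a + b)"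
      by (simp only: sum.lessThan_Suc add.assoc)
    then show ?case
      using Suc ab by simp
  qed simp
  then have "(\<Sum>k<n. a ^ k * b) \<le> 1" for n
    by (metis le_iff_add)
  then have geo: "(\<Sum>k. a ^ k * b) \<le> 1"
    by (intro suminf_le_const) auto
  have "0 \<notin> V"
    using V[of 0] r by auto
  then have "walk_potential p {0} (indicator V) 0 = (\<Sum>k. (walk_step p {0} ^^ Suc k) (indicator V) 0)"
    unfolding walk_potential_def by (subst suminf_offset[of _ 1]) auto
  also have "\<dots> = (\<Sum>k. a ^ k * (\<integral>\<^sup>+z. indicator V z \<partial>p))"
    unfolding a_def by (subst walk_step_origin_pow) auto
  also have "\<dots> \<le> (\<Sum>k. a ^ k * (ennreal (m r) * emeasure lborel V))"
    by (intro suminf_le mult_left_mono pV) auto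
  finally have "walk_potential p {0} (indicator V) 0 * emeasure lborel (ball (0::'a) r)
      \<le> (\<Sum>k. a ^ k * (ennreal (m r) * emeasure lborel V)) * emeasure lborel (ball (0::'a) r)"
    by (rule mult_right_mono) simp
  also have "\<dots> = (\<Sum>k. a ^ k * (ennreal (m r) * emeasure lborel (ball (0::'a) r))) * emeasure lborel V"
    unfolding ennreal_suminf_multc by (simp add: mult_ac)
  also have "\<dots> \<le> (\<Sum>k. a ^ k * b) * emeasure lborel V"
    by (intro mult_right_mono suminf_le mult_left_mono pb) auto
  also have "\<dots> \<le> 1 * emeasure lborel V"
    by (intro mult_right_mono geo) simp
  finally show ?thesis
    by simp
qed

end

lemma (in prob_space) emeasure_eventually_le:
  assumes [measurable]: "\<And>n. G n \<in> sets M" and b: "\<And>n. emeasure M (G n) \<le> b"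
  shows "emeasure M {\<omega>\<in>space M. \<forall>\<^sub>F n in sequentially. \<omega> \<in> G n} \<le> b"
proof -
  have "{\<omega>\<in>space M. \<forall>\<^sub>F n in sequentially. \<omega> \<in> G n} = (\<Union>N. {\<omega>\<in>space M. \<forall>n\<ge>N. \<omega> \<in> G n})"
    by (auto simp: eventually_sequentially)
  also have "emeasure M \<dots> = (SUP N. emeasure M {\<omega>\<in>space M. \<forall>n\<ge>N. \<omega> \<in> G n})"
    by (rule SUP_emeasure_incseq[symmetric]) (auto simp: incseq_def)
  also have "\<dots> \<le> b"
    by (intro SUP_least order_trans[OF emeasure_mono b]) auto
  finally show ?thesis .
qed

definition ambiguous :: "'a::euclidean_space set \<Rightarrow> 'a set \<Rightarrow> (real \<Rightarrow> 'a) \<Rightarrow> bool"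
  where "ambiguous A U y \<longleftrightarrow> outer_exit A U y \<and> \<not> inner_exit A U y"

lemma ambiguous_pred [measurable]:
  assumes [measurable]: "\<And>k n. (\<lambda>w. f w (real k / 2^n)) \<in> borel_measurable N"
  shows "Measurable.pred N (\<lambda>w. ambiguous A U (f w))"
  unfolding ambiguous_def by measurable

lemma ambiguous_cong:
  assumes "\<And>s. s \<in> dyadic_times \<Longrightarrow> y s = z s"
  shows "ambiguous A U y = ambiguous A U z"
  using assms by (simp add: ambiguous_def outer_exit_def inner_exit_def grid_exit_def)

context levy_process
begin

lemma AE_disp_path:
  "AE \<omega> in M. right_cont (\<lambda>s. disp s \<omega>) \<and> (\<forall>t>0. \<exists>l. ((\<lambda>s. disp s \<omega>) \<longlongrightarrow> l) (at_left t))"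
  using cadlag
proof eventually_elim
  case (elim \<omega>)
  show ?case
  proof (intro conjI allI impI)
    show "right_cont (\<lambda>s. disp s \<omega>)"
      unfolding right_cont_def disp_def using elim by (auto intro!: continuous_intros)
    fix t :: real assume "0 < t"
    then obtain l where "((\<lambda>s. X s \<omega>) \<longlongrightarrow> l) (at_left t)"
      using elim by blast
    then have "((\<lambda>s. disp s \<omega>) \<longlongrightarrow> l - X 0 \<omega>) (at_left t)"
      unfolding disp_def by (intro tendsto_intros)
    then show "\<exists>l. ((\<lambda>s. disp s \<omega>) \<longlongrightarrow> l) (at_left t)"
      by blast
  qed
qed

lemma AE_start_not_ambiguous:
  assumes A: "open A" "convex A" and U: "open U" "negligible (frontier U)" and sep: "separated d A U"
  shows "AE x in lborel. AE \<omega> in M. \<not> ambiguous A U (\<lambda>s. x + disp s \<omega>)"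
proof -
  interpret pair_sigma_finite lborel M
    by unfold_locales
  have "{w \<in> space (lborel \<Otimes>\<^sub>M M). \<not> ambiguous A U (\<lambda>s. fst w + disp s (snd w))} \<in> sets (lborel \<Otimes>\<^sub>M M)"
    by measurable
  then have "(AE x in lborel. AE \<omega> in M. \<not> ambiguous A U (\<lambda>s. x + disp s \<omega>)) \<longleftrightarrow>
      (AE \<omega> in M. AE x in lborel. \<not> ambiguous A U (\<lambda>s. x + disp s \<omega>))"
    by (rule AE_commute)
  moreover have "AE \<omega> in M. AE x in lborel. \<not> ambiguous A U (\<lambda>s. x + disp s \<omega>)"
    using AE_disp_path AE_space
  proof eventually_elim
    case (elim \<omega>)
    have "negligible {x. ambiguous A U (\<lambda>s. x + disp s \<omega>)}"
      unfolding ambiguous_def using elim by (intro negligible_ambiguous_starts[OF _ _ A U sep]) auto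
    moreover have "{x. ambiguous A U (\<lambda>s. x + disp s \<omega>)} \<in> sets borel"
      by measurable
    ultimately have "{x. ambiguous A U (\<lambda>s. x + disp s \<omega>)} \<in> null_sets lborel"
      by (simp add: negligible_iff_null_sets null_sets_completion_iff)
    then show ?case
      by (rule AE_I') auto
  qed
  ultimately show ?thesis
    by simp
qed

end

lemma negligible_outer_open:
  fixes N :: "'a::euclidean_space set"
  assumes "negligible N" "0 < (e::real)"
  obtains V where "open V" "N \<subseteq> V" "emeasure lborel V \<le> ennreal e"
proof -
  have N: "N \<in> sets lebesgue" "emeasure lebesgue N = 0"
    using assms(1) by (auto simp: negligible_iff_null_sets null_sets_def)
  obtain V where V: "open V" "N \<subseteq> V" "emeasure lebesgue (V - N) < ennreal e"
    using sets_lebesgue_outer_open[OF N(1) assms(2)] by metis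
  have "emeasure lebesgue V = emeasure lebesgue (V - N)"
    using N V(1) by (intro emeasure_Diff_null_set[symmetric]) (auto simp: null_sets_def)
  then have "emeasure lborel V \<le> ennreal e"
    using V by simp
  then show ?thesis
    using V that by blast
qed

context isotropic_unimodal_levy_process
begin

lemma step_unimodal:
  assumes "0 < h"
  shows "\<exists>m. unimodal_law (step h) m"
proof -
  obtain m where m: "\<forall>r>0. 0 \<le> m r" "antimono_on {0<..} m"
    "\<forall>A \<in> sets borel. 0 \<notin> A \<longrightarrow>
      emeasure M {\<omega> \<in> space M. X h \<omega> - X 0 \<omega> \<in> A} = (\<integral>\<^sup>+ x \<in> A. ennreal (m (norm x)) \<partial>lborel)"
    using isotropic_unimodal[OF assms] by blast
  have "unimodal_law (step h) m"
    using m assms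
    by (intro unimodal_law.intro step_law_step unimodal_law_axioms.intro)
       (auto simp: emeasure_step disp_def)
  then show ?thesis
    by blast
qed

lemma AE_first_move_not_in:
  assumes N: "negligible N" and r: "0 < r" "\<And>v. v \<in> N \<Longrightarrow> r < norm v"
  shows "AE \<omega> in M. \<forall>T\<ge>0. (\<forall>s. 0 \<le> s \<and> s < T \<longrightarrow> disp s \<omega> = 0) \<longrightarrow> disp T \<omega> \<notin> N"
proof -
  have "\<exists>V. open V \<and> N \<subseteq> V \<and> emeasure lborel V \<le> ennreal (1 / Suc i) \<and> (\<forall>v\<in>V. r < norm v)" for i
  proof -
    obtain V where V: "open V" "N \<subseteq> V" "emeasure lborel V \<le> ennreal (1 / Suc i)"
      using negligible_outer_open[OF N, of "1 / Suc i"] by auto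
    have "emeasure lborel (V \<inter> - cball 0 r) \<le> emeasure lborel V"
      using V by (intro emeasure_mono) auto
    moreover have "N \<subseteq> V \<inter> - cball 0 r"
      using V(2) r(2) by force
    ultimately show ?thesis
      using V by (intro exI[of _ "V \<inter> - cball 0 r"]) (auto intro: order_trans)
  qed
  then obtain V where V: "\<And>i. open (V i)" "\<And>i. N \<subseteq> V i"
    "\<And>i. emeasure lborel (V i) \<le> ennreal (1 / Suc i)" "\<And>i v. v \<in> V i \<Longrightarrow> r < norm v"
    by metis
  have [measurable]: "V i \<in> sets borel" for i
    using V(1) by simp
  define E where "E i = {\<omega>\<in>space M. \<forall>\<^sub>F n in sequentially. \<omega> \<in> {\<omega>\<in>space M. grid_exit n {0} (V i) (\<lambda>s. 0 + disp s \<omega>)}}" for i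
  have [measurable]: "E i \<in> sets M" for i
    unfolding E_def eventually_sequentially by measurable
  let ?b = "emeasure lborel (ball (0::'b) r)"
  have "?b = ennreal (unit_ball_vol (real DIM('b)) * r ^ DIM('b))"
    using r(1) by (intro emeasure_ball) simp
  moreover have "0 < unit_ball_vol (real DIM('b)) * r ^ DIM('b)"
    using r(1) by simp
  ultimately have b: "0 < ?b" "?b < \<infinity>"
    by simp_all
  have E: "emeasure M (E i) \<le> ennreal (1 / Suc i) / ?b" for i
    unfolding E_def
  proof (rule emeasure_eventually_le)
    fix n
    obtain m where "unimodal_law (step (1 / 2^n)) m"
      using step_unimodal[of "1 / 2^n"] by auto
    then interpret S: unimodal_law "step (1 / 2^n)" m .
    have "emeasure M {\<omega>\<in>space M. grid_exit n {0} (V i) (\<lambda>s. 0 + disp s \<omega>)}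
        \<le> walk_potential (step (1 / 2^n)) {0} (indicator (V i)) 0"
      by (rule emeasure_grid_exit_le) auto
    also have "\<dots> = walk_potential (step (1 / 2^n)) {0} (indicator (V i)) 0 * ?b / ?b"
      using b by (intro mult_divide_eq_ennreal[symmetric]) auto
    also have "\<dots> \<le> emeasure lborel (V i) / ?b"
      using r(1) V(4) by (intro divide_right_mono_ennreal S.first_move_law_le) (auto intro: less_imp_le)
    also have "\<dots> \<le> ennreal (1 / Suc i) / ?b"
      by (intro divide_right_mono_ennreal V)
    finally show "emeasure M {\<omega>\<in>space M. grid_exit n {0} (V i) (\<lambda>s. 0 + disp s \<omega>)} \<le> ennreal (1 / Suc i) / ?b" .
  qed measurable
  have "emeasure M (\<Inter>i. E i) * ?b \<le> ennreal (1 / Suc i)" for i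
  proof -
    have "emeasure M (\<Inter>i. E i) * ?b \<le> ennreal (1 / Suc i) / ?b * ?b"
      by (intro mult_right_mono order_trans[OF emeasure_mono E]) auto
    also have "\<dots> = ennreal (1 / Suc i)"
      using b by (simp add: ennreal_divide_times)
    finally show ?thesis .
  qed
  moreover have "(\<lambda>i. ennreal (1 / Suc i)) \<longlonglongrightarrow> ennreal 0"
    by (intro tendsto_ennrealI LIMSEQ_Suc lim_1_over_n)
  ultimately have "emeasure M (\<Inter>i. E i) * ?b \<le> ennreal 0"
    by (intro LIMSEQ_le_const[where X="\<lambda>i. ennreal (1 / Suc i)"]) auto
  then have "emeasure M (\<Inter>i. E i) = 0"
    using b by auto
  then have "(\<Inter>i. E i) \<in> null_sets M"
    by (intro null_setsI) auto
  then have "AE \<omega> in M. \<omega> \<notin> (\<Inter>i. E i)"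
    by (rule AE_not_in)
  then show ?thesis
    using AE_disp_path AE_space
  proof eventually_elim
    case (elim \<omega>)
    show ?case
    proof (intro allI impI notI)
      fix T assume T: "0 \<le> T" "\<forall>s. 0 \<le> s \<and> s < T \<longrightarrow> disp s \<omega> = 0" "disp T \<omega> \<in> N"
      have "\<forall>\<^sub>F n in sequentially. grid_exit n {0} (V i) (\<lambda>s. disp s \<omega>)" for i
        using elim T V(2)[of i] by (intro exits_at_imp_grid_exit[OF _ V(1), of _ _ _ T]) (auto simp: exits_at_def)
      then show False
        using elim by (auto simp: E_def)
    qed
  qed
qed

lemma AE_restart_not_ambiguous:
  assumes A: "open A" "convex A" and U: "open U" "negligible (frontier U)" and sep: "separated d A U"
    and h: "h \<in> dyadic_times"
  shows "AE \<omega> in M. disp h \<omega> \<noteq> 0 \<longrightarrow> \<not> ambiguous A U (\<lambda>s. x + disp h \<omega> + (disp (h + s) \<omega> - disp h \<omega>))"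
proof (cases "h = 0")
  case False
  then have h0: "0 < h"
    using dyadic_times_nonneg[OF h] by simp
  then have [measurable]: "disp h \<in> borel_measurable M"
    by simp
  obtain m where "unimodal_law (step h) m"
    using step_unimodal[OF h0] by blast
  then interpret S: unimodal_law "step h" m .
  let ?D = "PiM dyadic_times (\<lambda>_. borel :: 'b measure)"
  let ?F = "\<lambda>\<omega>. \<lambda>s\<in>dyadic_times. disp (h + s) \<omega> - disp h \<omega>"
  have [measurable]: "?F \<in> M \<rightarrow>\<^sub>M ?D" "(\<lambda>\<omega>. \<lambda>s\<in>dyadic_times. disp s \<omega>) \<in> M \<rightarrow>\<^sub>M ?D"
    using h0 by (auto intro!: measurable_restrict borel_measurable_diff disp_measurable dest: dyadic_times_nonneg)
  have [measurable]: "(\<lambda>z. z (real k / 2^n)) \<in> borel_measurable ?D" for k n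
    by (rule measurable_component_singleton) simp
  have [measurable]: "Measurable.pred (borel \<Otimes>\<^sub>M ?D) (\<lambda>w. ambiguous A U (\<lambda>s. x + fst w + snd w s))"
  proof (rule ambiguous_pred)
    fix k n
    have "(\<lambda>w. snd w (real k / 2^n)) \<in> borel_measurable ((borel :: 'b measure) \<Otimes>\<^sub>M ?D)"
      by (rule measurable_compose[OF measurable_snd measurable_component_singleton]) simp
    then show "(\<lambda>w. x + fst w + snd w (real k / 2^n)) \<in> borel_measurable (borel \<Otimes>\<^sub>M ?D)"
      by (intro borel_measurable_add) auto
  qed
  have "Measurable.pred borel (\<lambda>v. v = (0::'b))"
    by measurable
  then have [measurable]: "Measurable.pred (borel \<Otimes>\<^sub>M ?D) (\<lambda>w. fst w = (0::'b))"
    by (rule measurable_compose[OF measurable_fst])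
  have amb_measurable: "Measurable.pred (borel \<Otimes>\<^sub>M ?D) (\<lambda>w. fst w \<noteq> 0 \<longrightarrow> \<not> ambiguous A U (\<lambda>s. x + fst w + snd w s))"
    by (intro pred_intros_logic) fact+
  interpret Q: prob_space path_law
    unfolding path_law_def by (rule prob_space_distr) measurable
  have path_sets: "sets path_law = sets ?D"
    by (simp add: path_law_def)
  interpret pair_sigma_finite "step h" path_law
    by unfold_locales
  have path: "(AE z in path_law. \<not> ambiguous A U (\<lambda>s. v + z s)) \<longleftrightarrow>
      (AE \<omega> in M. \<not> ambiguous A U (\<lambda>s. v + disp s \<omega>))" for v
  proof -
    have "(AE z in path_law. \<not> ambiguous A U (\<lambda>s. v + z s)) \<longleftrightarrow>
        (AE \<omega> in M. \<not> ambiguous A U (\<lambda>s. v + (\<lambda>s\<in>dyadic_times. disp s \<omega>) s))"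
      unfolding path_law_def by (rule AE_distr_iff) measurable
    also have "(\<lambda>\<omega>. ambiguous A U (\<lambda>s. v + (\<lambda>s\<in>dyadic_times. disp s \<omega>) s)) = (\<lambda>\<omega>. ambiguous A U (\<lambda>s. v + disp s \<omega>))"
      by (intro ext ambiguous_cong) simp
    finally show ?thesis .
  qed
  have "AE v in distr lborel borel ((+) x). AE \<omega> in M. \<not> ambiguous A U (\<lambda>s. v + disp s \<omega>)"
    unfolding lborel_distr_plus by (rule AE_start_not_ambiguous[OF A U sep])
  then have "AE v in lborel. AE \<omega> in M. \<not> ambiguous A U (\<lambda>s. x + v + disp s \<omega>)"
    by (rule AE_distrD[rotated]) simp
  then have "AE v in step h. v \<noteq> 0 \<longrightarrow> (AE z in path_law. \<not> ambiguous A U (\<lambda>s. x + v + z s))"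
    unfolding path by (rule S.AE_lborel_imp_AE_p)
  then have "AE v in step h. AE z in path_law. v \<noteq> 0 \<longrightarrow> \<not> ambiguous A U (\<lambda>s. x + v + z s)"
    by eventually_elim auto
  then have "AE w in step h \<Otimes>\<^sub>M path_law. fst w \<noteq> 0 \<longrightarrow> \<not> ambiguous A U (\<lambda>s. x + fst w + snd w s)"
  proof (intro AE_pair_measure)
    have s: "sets (step h \<Otimes>\<^sub>M path_law) = sets (borel \<Otimes>\<^sub>M ?D)"
      by (intro sets_pair_measure_cong S.sets_p path_sets)
    show "{w \<in> space (step h \<Otimes>\<^sub>M path_law). fst w \<noteq> 0 \<longrightarrow> \<not> ambiguous A U (\<lambda>s. x + fst w + snd w s)}
        \<in> sets (step h \<Otimes>\<^sub>M path_law)"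
      unfolding sets_eq_imp_space_eq[OF s] s using amb_measurable by (simp only: pred_def)
  qed simp
  then have "AE w in distr M (borel \<Otimes>\<^sub>M ?D) (\<lambda>\<omega>. (disp h \<omega>, ?F \<omega>)).
      fst w \<noteq> 0 \<longrightarrow> \<not> ambiguous A U (\<lambda>s. x + fst w + snd w s)"
    unfolding distr_disp_future[OF h] .
  moreover have "(\<lambda>\<omega>. (disp h \<omega>, ?F \<omega>)) \<in> M \<rightarrow>\<^sub>M borel \<Otimes>\<^sub>M ?D"
    by measurable
  ultimately have "AE \<omega> in M. fst (disp h \<omega>, ?F \<omega>) \<noteq> 0 \<longrightarrow>
      \<not> ambiguous A U (\<lambda>s. x + fst (disp h \<omega>, ?F \<omega>) + snd (disp h \<omega>, ?F \<omega>) s)"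
    by (rule AE_distrD[rotated])
  then have "AE \<omega> in M. disp h \<omega> \<noteq> 0 \<longrightarrow> \<not> ambiguous A U (\<lambda>s. x + disp h \<omega> + ?F \<omega> s)"
    by (simp only: fst_conv snd_conv)
  then show ?thesis
  proof eventually_elim
    case (elim \<omega>)
    have "ambiguous A U (\<lambda>s. x + disp h \<omega> + ?F \<omega> s)
        = ambiguous A U (\<lambda>s. x + disp h \<omega> + (disp (h + s) \<omega> - disp h \<omega>))"
      by (rule ambiguous_cong) simp
    then show ?case
      using elim by simp
  qed
qed simp

lemma AE_not_ambiguous:
  assumes A: "open A" "convex A" and U: "open U" "negligible (frontier U)" and sep: "separated d A U"
    and x: "x \<in> A"
  shows "AE \<omega> in M. \<not> ambiguous A U (\<lambda>s. x + disp s \<omega>)"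
proof -
  define N where "N = (+) (- x) ` (frontier A \<union> frontier U)"
  have N: "negligible N"
    unfolding N_def using A U
    by (intro negligible_translation negligible_Un) (auto intro: negligible_convex_frontier)
  obtain r where r: "0 < r" "\<And>v. v \<in> N \<Longrightarrow> r < norm v"
  proof -
    have "x \<notin> closure U"
      using separated_closure[OF sep] x closure_subset[of A] unfolding separated_def by force
    then have "x \<notin> frontier A \<union> frontier U"
      using x A by (auto simp: frontier_def interior_open)
    then have "x \<in> - (frontier A \<union> frontier U)"
      by simp
    moreover have "open (- (frontier A \<union> frontier U))"
      by (intro open_Compl closed_Un frontier_closed)
    ultimately obtain e where e: "0 < e" "cball x e \<subseteq> - (frontier A \<union> frontier U)"
      by (meson open_contains_cball)
    have "e < norm v" if "v \<in> N" for v
    proof -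
      have "x + v \<in> frontier A \<union> frontier U"
        using that by (auto simp: N_def)
      then have "x + v \<notin> cball x e"
        using e by blast
      then show ?thesis
        by (simp add: dist_norm)
    qed
    then show ?thesis
      using e that by blast
  qed
  have "countable dyadic_times"
  proof -
    have "dyadic_times = (\<lambda>(k, n). real k / 2^n) ` UNIV"
      by (auto simp: dyadic_times_def image_iff)
    then show ?thesis
      by (metis countable_image countableI_type)
  qed
  then have "AE \<omega> in M. \<forall>h\<in>dyadic_times. disp h \<omega> \<noteq> 0 \<longrightarrow>
      \<not> ambiguous A U (\<lambda>s. x + disp h \<omega> + (disp (h + s) \<omega> - disp h \<omega>))"
    by (subst AE_ball_countable) (use AE_restart_not_ambiguous[OF A U sep] in blast)+
  moreover have "AE \<omega> in M. \<forall>T\<ge>0. (\<forall>s. 0 \<le> s \<and> s < T \<longrightarrow> disp s \<omega> = 0) \<longrightarrow> disp T \<omega> \<notin> N"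
    by (rule AE_first_move_not_in[OF N r(1)]) (rule r(2))
  ultimately show ?thesis
    using AE_disp_path
  proof eventually_elim
    case (elim \<omega>)
    have *: "x + disp T \<omega> \<notin> frontier A \<union> frontier U"
      if "0 \<le> T" "\<And>s. 0 \<le> s \<Longrightarrow> s < T \<Longrightarrow> disp s \<omega> = 0" for T
    proof -
      have "disp T \<omega> \<notin> N"
        using elim that by blast
      moreover have "disp T \<omega> = - x + (x + disp T \<omega>)"
        by simp
      ultimately show ?thesis
        unfolding N_def by blast
    qed
    have "inner_exit A U (\<lambda>s. x + disp s \<omega>)" if "outer_exit A U (\<lambda>s. x + disp s \<omega>)"
    proof (rule exit_dichotomy_at_first_move[where y="\<lambda>s. disp s \<omega>", OF _ _ A(1) U(1) x sep _ * that])
      show "right_cont (\<lambda>s. disp s \<omega>)"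
        using elim by blast
      show "inner_exit A U (\<lambda>s. x + disp h \<omega> + (disp (h + s) \<omega> - disp h \<omega>))"
        if "h \<in> dyadic_times" "disp h \<omega> \<noteq> 0" "outer_exit A U (\<lambda>s. x + disp h \<omega> + (disp (h + s) \<omega> - disp h \<omega>))" for h
        using elim that unfolding ambiguous_def by blast
    qed simp
    then show ?case
      unfolding ambiguous_def by blast
  qed
qed

end

section \<open>Exit probabilities as limits of walks\<close>

lemma (in prob_space) completion_eqI_AE:
  assumes S: "S \<in> sets M" and E: "E \<subseteq> space M" and AE: "AE \<omega> in M. \<omega> \<in> E \<longleftrightarrow> \<omega> \<in> S"
  shows "E \<in> sets (completion M)" and "measure (completion M) E = measure M S"
proof -
  have AE': "AE \<omega> in completion M. \<omega> \<in> S \<longleftrightarrow> \<omega> \<in> E"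
    using AE by (intro AE_completion) auto
  show E': "E \<in> sets (completion M)"
    by (rule completion.in_sets_AE[OF AE']) (use S E in auto)
  have "measure (completion M) E = measure (completion M) S"
    by (rule measure_eq_AE) (use AE' S E' in auto)
  then show "measure (completion M) E = measure M S"
    using S by simp
qed

context levy_process
begin

lemma AE_right_cont: "AE \<omega> in M. right_cont (\<lambda>s. x + disp s \<omega>)"
  using AE_disp_path
proof eventually_elim
  case (elim \<omega>)
  then show ?case
    unfolding right_cont_def by (intro allI impI continuous_add continuous_const) blast
qed

lemma exit_prob_le_grid:
  assumes A: "open A" and U: "open U" "A \<inter> U = {}" and \<delta>: "0 < \<delta>"
  shows "\<forall>\<^sub>F n in sequentially.
    ennreal (exit_prob M X x A U) \<le> walk_potential (step (1 / 2^n)) A (indicator U) x + ennreal \<delta>"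
proof -
  have [measurable]: "A \<in> sets borel" "U \<in> sets borel"
    using A U by auto
  define G where "G n = {\<omega>\<in>space M. grid_exit n A U (\<lambda>s. x + disp s \<omega>)}" for n
  define L where "L N = {\<omega>\<in>space M. \<forall>n\<ge>N. \<omega> \<in> G n}" for N
  have [measurable]: "G n \<in> sets M" "L n \<in> sets M" for n
    unfolding G_def L_def by measurable
  let ?E = "{\<omega>\<in>space M. exits_into (started_at x X) A U \<omega>}"
  have le: "exit_prob M X x A U \<le> measure M (\<Union>N. L N)"
  proof (cases "?E \<in> sets (completion M)")
    case True
    have "AE \<omega> in M. \<omega> \<in> ?E \<longrightarrow> \<omega> \<in> (\<Union>N. L N)"
      using AE_right_cont[of x] AE_space
    proof eventually_elim
      case (elim \<omega>)
      have "\<forall>\<^sub>F n in sequentially. \<omega> \<in> G n" if "\<omega> \<in> ?E"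
      proof -
        have "exits_into (started_at x X) A U \<omega>"
          using that by simp
        then obtain t where "exits_at A (U - A) (\<lambda>s. x + disp s \<omega>) t"
          using exits_into_iff[of "started_at x X" \<omega> A U] elim A by (auto simp: started_at_disp)
        then have "exits_at A U (\<lambda>s. x + disp s \<omega>) t"
          by (rule exits_at_mono) auto
        from exits_at_imp_grid_exit[OF elim(1) U(1) this] show ?thesis
          using elim by (simp add: G_def)
      qed
      then show ?case
        using elim by (auto simp: L_def eventually_sequentially)
    qed
    then have "AE \<omega> in completion M. \<omega> \<in> ?E \<longrightarrow> \<omega> \<in> (\<Union>N. L N)"
      by (rule AE_completion)
    then have "measure (completion M) ?E \<le> measure (completion M) (\<Union>N. L N)"
      using prob_space_completion by (intro finite_measure.finite_measure_mono_AE)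
        (auto simp: prob_space_def)
    then show ?thesis
      by (simp add: exit_prob_def)
  next
    case False
    then show ?thesis
      by (simp add: exit_prob_def measure_notin_sets)
  qed
  have "(\<lambda>N. measure M (L N)) \<longlonglongrightarrow> measure M (\<Union>N. L N)"
    by (rule finite_Lim_measure_incseq) (auto simp: incseq_def L_def)
  then have "\<forall>\<^sub>F N in sequentially. measure M (\<Union>N. L N) - \<delta> < measure M (L N)"
    by (rule order_tendstoD) (use \<delta> in simp)
  then show ?thesis
  proof eventually_elim
    case (elim N)
    have "measure M (L N) \<le> measure M (G N)"
      by (rule finite_measure_mono) (auto simp: L_def)
    then have "exit_prob M X x A U \<le> measure M (G N) + \<delta>"
      using elim le by linarith
    then have "ennreal (exit_prob M X x A U) \<le> ennreal (measure M (G N)) + ennreal \<delta>"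
      using \<delta> by (simp flip: ennreal_plus)
    also have "ennreal (measure M (G N)) \<le> walk_potential (step (1 / 2^N)) A (indicator U) x"
      using emeasure_grid_exit_le[of A U N x] by (simp add: emeasure_eq_measure G_def)
    finally show ?case
      by (simp add: add_right_mono)
  qed
qed

end

context isotropic_unimodal_levy_process
begin

lemma AE_exits_into_iff:
  assumes A: "open A" "convex A" and U: "open U" "negligible (frontier U)" and sep: "separated d A U"
    and x: "x \<in> A" and V: "U \<subseteq> V" "V \<subseteq> closure U"
  shows "AE \<omega> in M. exits_into (started_at x X) A V \<omega> \<longleftrightarrow> outer_exit A U (\<lambda>s. x + disp s \<omega>)"
  using AE_right_cont[of x] AE_not_ambiguous[OF A U sep x]
proof eventually_elim
  case (elim \<omega>)
  let ?y = "\<lambda>s. x + disp s \<omega>"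
  have iff: "exits_into (started_at x X) A V \<omega> \<longleftrightarrow> (\<exists>t. exits_at A (V - A) ?y t)"
    using exits_into_iff[of "started_at x X" \<omega> A V] elim A by (simp add: started_at_disp)
  show ?case
  proof
    assume "exits_into (started_at x X) A V \<omega>"
    then obtain t where "exits_at A (V - A) ?y t"
      using iff by blast
    then have "exits_at (closure A) (closure U) ?y t"
      by (rule exits_at_mono) (use V closure_subset in auto)
    then show "outer_exit A U ?y"
      by (rule exits_at_imp_outer_exit[OF elim(1)])
  next
    assume "outer_exit A U ?y"
    then have "inner_exit A U ?y"
      using elim(2) by (simp add: ambiguous_def)
    then obtain e t where e: "0 < e" "exits_at (shrink A e) (shrink U e) ?y t"
      using inner_exit_imp[OF elim(1) sep] by blast
    have "A \<inter> U = {}"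
      using sep unfolding separated_def by force
    then have "shrink A e \<subseteq> A" "shrink U e \<subseteq> V - A"
      using shrink_subset[OF e(1), of A] shrink_subset[OF e(1), of U] V by auto
    then have "exits_at A (V - A) ?y t"
      by (rule exits_at_mono[OF e(2)])
    then show "exits_into (started_at x X) A V \<omega>"
      using iff by blast
  qed
qed

lemma exit_prob_eq:
  assumes "open A" "convex A" and "open U" "negligible (frontier U)" and "separated d A U"
    and "x \<in> A" and "U \<subseteq> V" "V \<subseteq> closure U"
  shows "{\<omega>\<in>space M. exits_into (started_at x X) A V \<omega>} \<in> sets (completion M)"
    and "exit_prob M X x A V = measure M {\<omega>\<in>space M. outer_exit A U (\<lambda>s. x + disp s \<omega>)}"
proof -
  have 1: "{\<omega>\<in>space M. outer_exit A U (\<lambda>s. x + disp s \<omega>)} \<in> sets M"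
    by measurable
  have 2: "AE \<omega> in M. \<omega> \<in> {\<omega>\<in>space M. exits_into (started_at x X) A V \<omega>} \<longleftrightarrow>
      \<omega> \<in> {\<omega>\<in>space M. outer_exit A U (\<lambda>s. x + disp s \<omega>)}"
    using AE_exits_into_iff[OF assms] by eventually_elim simp
  show "{\<omega>\<in>space M. exits_into (started_at x X) A V \<omega>} \<in> sets (completion M)"
    by (rule completion_eqI_AE(1)[OF 1 _ 2]) auto
  show "exit_prob M X x A V = measure M {\<omega>\<in>space M. outer_exit A U (\<lambda>s. x + disp s \<omega>)}"
    unfolding exit_prob_def by (rule completion_eqI_AE(2)[OF 1 _ 2]) auto
qed

text \<open>Enlarging \<open>A\<close> and \<open>U\<close> slightly absorbs a shift of the starting point.\<close>

lemma grid_exit_le_exit_prob_nearby: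
  assumes A: "open A" "convex A" and U: "open U" "negligible (frontier U)" and sep: "separated d A U"
    and x: "x \<in> A" and \<delta>: "0 < \<delta>"
  shows "\<exists>N. \<forall>n\<ge>N. \<forall>v\<in>ball x (1 / Suc N).
    walk_potential (step (1 / 2^n)) A (indicator U) v \<le> ennreal (exit_prob M X x A U + \<delta>)"
proof -
  have [measurable]: "A \<in> sets borel" "U \<in> sets borel"
    using A U by auto
  define G where "G N n = {\<omega>\<in>space M. grid_exit n (thicken A (1 / Suc N)) (thicken U (1 / Suc N)) (\<lambda>s. x + disp s \<omega>)}" for N n
  define D where "D N = {\<omega>\<in>space M. \<exists>n\<ge>N. \<omega> \<in> G N n}" for N
  have [measurable]: "G N n \<in> sets M" "D N \<in> sets M" for N n
    unfolding G_def D_def by measurable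
  have G_mono: "G N n \<subseteq> G N' n" if "N' \<le> N" for N N' n
  proof -
    have "1 / real (Suc N) \<le> 1 / Suc N'"
      using that by (simp add: frac_le)
    then show ?thesis
      unfolding G_def using grid_exit_mono[OF _ thicken_mono thicken_mono] by blast
  qed
  have "decseq D"
    unfolding decseq_def
  proof (intro allI impI subsetI)
    fix a b \<omega> assume "a \<le> b" "\<omega> \<in> D b"
    then obtain n where "b \<le> n" "\<omega> \<in> G b n" "\<omega> \<in> space M"
      by (auto simp: D_def)
    then show "\<omega> \<in> D a"
      using G_mono[OF \<open>a \<le> b\<close>] \<open>a \<le> b\<close> unfolding D_def by (blast intro: order_trans)
  qed
  then have "(\<lambda>N. measure M (D N)) \<longlonglongrightarrow> measure M (\<Inter>N. D N)"
    by (intro finite_Lim_measure_decseq) auto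
  moreover have "(\<Inter>N. D N) = {\<omega>\<in>space M. outer_exit A U (\<lambda>s. x + disp s \<omega>)}"
    by (auto simp: D_def G_def outer_exit_def)
  ultimately have "(\<lambda>N. measure M (D N)) \<longlonglongrightarrow> exit_prob M X x A U"
    using exit_prob_eq(2)[OF A U sep x order_refl closure_subset] by simp
  then have "\<forall>\<^sub>F N in sequentially. measure M (D N) < exit_prob M X x A U + \<delta>"
    by (rule order_tendstoD) (use \<delta> in simp)
  then obtain N where N: "measure M (D N) < exit_prob M X x A U + \<delta>"
    using eventually_happens' sequentially_bot by blast
  have disj: "A \<inter> U = {}"
    using sep unfolding separated_def by force
  have "walk_potential (step (1 / 2^n)) A (indicator U) v \<le> ennreal (exit_prob M X x A U + \<delta>)"
    if "N \<le> n" "v \<in> ball x (1 / Suc N)" for n v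
  proof -
    have shift: "x + w \<in> thicken B (1 / Suc N)" if "v + w \<in> B" for w B
      using that \<open>v \<in> ball x (1 / Suc N)\<close>
      by (auto simp: thicken_def dist_norm algebra_simps norm_minus_commute intro!: bexI[of _ "v + w"])
    have "{\<omega>\<in>space M. grid_exit n A U (\<lambda>s. v + disp s \<omega>)} \<subseteq> D N"
      using \<open>N \<le> n\<close> shift unfolding D_def G_def grid_exit_def by blast
    then have "emeasure M {\<omega>\<in>space M. grid_exit n A U (\<lambda>s. v + disp s \<omega>)} \<le> emeasure M (D N)"
      by (intro emeasure_mono) auto
    also have "\<dots> \<le> ennreal (exit_prob M X x A U + \<delta>)"
      using N by (simp add: emeasure_eq_measure ennreal_leI)
    also have "emeasure M {\<omega>\<in>space M. grid_exit n A U (\<lambda>s. v + disp s \<omega>)}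
        = walk_potential (step (1 / 2^n)) A (indicator U) v"
      by (rule emeasure_grid_exit) (fact | rule disj)+
    finally show ?thesis .
  qed
  then show ?thesis
    by blast
qed

end

context unimodal_law
begin

lemma walk_step_pow_1_le_1: 
  assumes [measurable]: "A \<in> sets borel"
  shows "(walk_step p A ^^ k) (\<lambda>_. 1) x \<le> 1"
proof (induction k arbitrary: x)
  case (Suc k)
  have "(walk_step p A ^^ Suc k) (\<lambda>_. 1) x \<le> 1 * (\<integral>\<^sup>+z. 1 \<partial>p)"
    unfolding funpow.simps comp_apply walk_step_def[of _ _ "(walk_step p A ^^ k) _"]
    by (intro mult_mono nn_integral_mono Suc) (auto split: split_indicator)
  then show ?case
    using emeasure_space_1 by simp
qed simp

text \<open>A run of sufficiently many consecutive steps to the right leaves the ball, and such a run has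
  positive probability.\<close>

lemma walk_leaves_ball:
  assumes s: "0 < s" "0 < m s" and e: "0 < (e::real)"
  shows "\<exists>K. (walk_step p (ball 0 r) ^^ K) (\<lambda>_. 1) x \<le> ennreal e"
proof -
  let ?Q = "walk_step p (ball 0 r)"
  obtain b :: 'a where b: "b \<in> Basis"
    using nonempty_Basis by blast
  define W where "W = {z. norm z < s \<and> s/2 < z \<bullet> b}"
  have "open W"
    unfolding W_def by (intro open_Collect_conj open_Collect_less continuous_intros)
  then have [measurable]: "W \<in> sets borel"
    by simp
  have "(3/4 * s) *\<^sub>R b \<in> W"
    using b s by (simp add: W_def)
  then have "emeasure lborel W \<noteq> 0"
    using \<open>open W\<close> open_not_negligible[of W] by (auto simp: negligible_iff_null_sets null_sets_def)
  define \<delta> where "\<delta> = (\<integral>\<^sup>+z. indicator W z \<partial>p)"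
  have "ennreal (m s) * emeasure lborel W \<le> \<delta>"
    using mass_ge[of W s 0] s by (auto simp: \<delta>_def W_def)
  moreover have "0 < ennreal (m s) * emeasure lborel W"
    using s \<open>emeasure lborel W \<noteq> 0\<close> by (simp add: ennreal_zero_less_mult_iff zero_less_iff_neq_zero)
  ultimately have \<delta>0: "0 < \<delta>"
    by (rule less_le_trans[rotated])
  have \<delta>1: "\<delta> \<le> 1"
    unfolding \<delta>_def using emeasure_le_1[of W] by simp
  have run: "(?Q ^^ Suc i) (\<lambda>_. 1) x + \<delta> ^ i \<le> 1" if "r - real i * (s/2) < x \<bullet> b" for i x
    using that
  proof (induction i arbitrary: x)
    case 0
    then have "r < norm x"
      using Basis_le_norm[OF b, of x] by simp
    then show ?case
      by (simp add: walk_step_def)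
  next
    case (Suc i)
    have "(?Q ^^ Suc (Suc i)) (\<lambda>_. 1) x \<le> (\<integral>\<^sup>+z. (?Q ^^ Suc i) (\<lambda>_. 1) (x + z) \<partial>p)"
      by (simp add: walk_step_def[of _ _ "walk_step p _ _"] indicator_def)
    moreover have "\<delta> ^ Suc i = (\<integral>\<^sup>+z. \<delta> ^ i * indicator W z \<partial>p)"
      unfolding \<delta>_def by (subst nn_integral_cmult) (auto simp: mult.commute)
    ultimately have "(?Q ^^ Suc (Suc i)) (\<lambda>_. 1) x + \<delta> ^ Suc i
        \<le> (\<integral>\<^sup>+z. (?Q ^^ Suc i) (\<lambda>_. 1) (x + z) \<partial>p) + (\<integral>\<^sup>+z. \<delta> ^ i * indicator W z \<partial>p)"
      by (metis add_right_mono)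
    also have "\<dots> = (\<integral>\<^sup>+z. (?Q ^^ Suc i) (\<lambda>_. 1) (x + z) + \<delta> ^ i * indicator W z \<partial>p)"
      by (rule nn_integral_add[symmetric]) measurable
    also have "\<dots> \<le> (\<integral>\<^sup>+z. 1 \<partial>p)"
    proof (intro nn_integral_mono)
      fix z
      show "(?Q ^^ Suc i) (\<lambda>_. 1) (x + z) + \<delta> ^ i * indicator W z \<le> 1"
      proof (cases "z \<in> W")
        case True
        then have "r - real i * (s/2) < (x + z) \<bullet> b"
          using Suc.prems by (simp add: W_def inner_add_left field_simps)
        then show ?thesis
          using Suc.IH[of "x + z"] True by simp
      next
        case False
        then show ?thesis
          using walk_step_pow_1_le_1[of "ball 0 r" "Suc i" "x + z"] by simp
      qed
    qed
    finally show ?case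
      using emeasure_space_1 by simp
  qed
  obtain N where N: "2 * r < real N * (s/2)"
    using reals_Archimedean3[of "s/2"] s by (meson half_gt_zero)
  obtain d where d: "\<delta> = ennreal d" "0 < d" "d \<le> 1"
    using \<delta>0 \<delta>1 by (cases \<delta>) (auto simp: ennreal_le_1 top_unique)
  define \<eta> where "\<eta> = d ^ N"
  have \<eta>: "\<delta> ^ N = ennreal \<eta>" "0 < \<eta>" "\<eta> \<le> 1"
    using d by (simp_all add: \<eta>_def ennreal_power power_le_one)
  define c where "c = ennreal (1 - \<eta>)"
  have step: "(?Q ^^ Suc N) (\<lambda>_. 1) x \<le> c" for x
  proof (cases "x \<in> ball 0 r")
    case True
    then have "r - real N * (s/2) < x \<bullet> b"
      using N Basis_le_norm[OF b, of x] by auto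
    from run[OF this] have w: "(?Q ^^ Suc N) (\<lambda>_. 1) x + ennreal \<eta> \<le> ennreal 1"
      by (simp only: \<eta>(1) ennreal_1)
    show ?thesis
    proof (cases "(?Q ^^ Suc N) (\<lambda>_. 1) x")
      case (real v)
      then have "ennreal (v + \<eta>) \<le> ennreal 1"
        using w \<eta> by (simp only: ennreal_plus less_imp_le)
      then show ?thesis
        unfolding c_def real using \<eta> by (intro ennreal_leI) simp
    next
      case top
      then show ?thesis
        using w by (simp add: top_unique)
    qed
  next
    case False
    then show ?thesis
      by (simp add: walk_step_def[of _ _ "(walk_step p _ ^^ N) _"])
  qed
  have pow: "(?Q ^^ (j * Suc N)) (\<lambda>_. 1) x \<le> c ^ j" for j x
  proof (induction j arbitrary: x)
    case (Suc j)
    have "(?Q ^^ (Suc j * Suc N)) (\<lambda>_. 1) x = (?Q ^^ (j * Suc N)) ((?Q ^^ Suc N) (\<lambda>_. 1)) x"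
      by (metis add.commute comp_apply funpow_add mult_Suc)
    also have "\<dots> \<le> (?Q ^^ (j * Suc N)) (\<lambda>x. c * 1) x"
      by (intro walk_step_pow_mono) (use step in auto)
    also have "\<dots> = c * (?Q ^^ (j * Suc N)) (\<lambda>_. 1) x"
      by (rule walk_step_pow_cmult) auto
    also have "\<dots> \<le> c * c ^ j"
      by (intro mult_left_mono Suc) auto
    finally show ?case
      by simp
  qed simp
  obtain j where "(1 - \<eta>) ^ j < e"
    using real_arch_pow_inv[OF e, of "1 - \<eta>"] \<eta>(2) by auto
  then have "c ^ j \<le> ennreal e"
    using \<eta>(3) by (simp add: c_def ennreal_power ennreal_leI)
  then show ?thesis
    using pow order_trans by blast
qed

end

context isotropic_unimodal_levy_process
begin

lemma AE_leaves_ball: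
  assumes n: "unimodal_law (step (1 / 2^n)) m" and s: "0 < s" "0 < m s"
  shows "AE \<omega> in M. \<exists>t\<ge>0. disp t \<omega> \<notin> ball 0 r"
proof -
  interpret S: unimodal_law "step (1 / 2^n)" m
    by (rule n)
  have [measurable]: "ball (0::'b) r \<in> sets borel"
    by simp
  define E where "E = {\<omega>\<in>space M. \<forall>i. disp (real i / 2^n) \<omega> \<in> ball 0 r}"
  have [measurable]: "E \<in> sets M"
    unfolding E_def by measurable
  have le: "emeasure M E \<le> ennreal e" if e: "0 < e" for e
  proof -
    obtain K where K: "(walk_step (step (1 / 2^n)) (ball 0 r) ^^ K) (\<lambda>_. 1) 0 \<le> ennreal e"
      using S.walk_leaves_ball[OF s e] by blast
    have "emeasure M E \<le> emeasure M {\<omega>\<in>space M. (\<forall>i<K. 0 + disp (real i / 2^n) \<omega> \<in> ball 0 r) \<and> 0 + disp (real K / 2^n) \<omega> \<in> UNIV}"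
      by (intro emeasure_mono) (auto simp: E_def)
    also have "\<dots> = (walk_step (step (1 / 2^n)) (ball 0 r) ^^ K) (indicator UNIV) 0"
      by (rule emeasure_grid_exit_at) auto
    also have "(indicator UNIV :: 'b \<Rightarrow> ennreal) = (\<lambda>_. 1)"
      by auto
    finally show ?thesis
      using K by (rule order_trans)
  qed
  have "emeasure M E \<le> 0"
  proof (rule ennreal_le_epsilon)
    fix e :: real assume "0 < e"
    then show "emeasure M E \<le> 0 + ennreal e"
      using le by simp
  qed
  then have "E \<in> null_sets M"
    by (intro null_setsI) simp_all
  then have "AE \<omega> in M. \<omega> \<notin> E"
    by (rule AE_not_in)
  then show ?thesis
    using AE_space
  proof eventually_elim
    case (elim \<omega>)
    then obtain i where "disp (real i / 2^n) \<omega> \<notin> ball 0 r"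
      by (auto simp: E_def)
    then show ?case
      by (intro exI[of _ "real i / 2^n"]) auto
  qed
qed

lemma grid_exit_ball_le_exit_prob:
  assumes n: "unimodal_law (step (1 / 2^n)) m" and s: "0 < s" "0 < m s"
    and r: "0 < r" "r < \<rho>'" "\<rho> < \<rho>'" and \<delta>: "0 < \<delta>"
  shows "\<forall>\<^sub>F k in sequentially. walk_potential (step (1 / 2^k)) (ball 0 r) (indicator (ball 0 \<rho> - ball 0 r)) 0
    \<le> ennreal (exit_prob M X 0 (ball 0 r) (ball 0 \<rho>') + \<delta>)"
proof -
  let ?B = "ball (0::'b) r" and ?W = "ball (0::'b) \<rho>" and ?V = "ball (0::'b) \<rho>'"
  let ?far = "- cball (0::'b) \<rho>'"
  let ?Q = "{\<omega>\<in>space M. exits_into (started_at 0 X) ?B ?V \<omega>}"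
  have front: "negligible (frontier ?far)"
    by (simp add: negligible_convex_frontier frontier_complement del: frontier_cball)
  have sep: "separated (\<rho>' - r) ?B ?far"
    unfolding separated_def
  proof (intro conjI ballI)
    fix a u assume "a \<in> ?B" "u \<in> ?far"
    then show "\<rho>' - r \<le> dist a u"
      using dist_triangle[of 0 u a] by auto
  qed (use r in simp)
  have far_cl: "?far \<subseteq> - ?V" "- ?V \<subseteq> closure ?far"
    by (auto simp: closure_complement interior_cball)
  have rc: "AE \<omega> in M. right_cont (\<lambda>s. disp s \<omega>)"
    using AE_right_cont[of 0] by simp
  have iff: "exits_into (started_at 0 X) ?B Z \<omega> \<longleftrightarrow> (\<exists>t. exits_at ?B (Z - ?B) (\<lambda>s. disp s \<omega>) t)"
    if "right_cont (\<lambda>s. disp s \<omega>)" for \<omega> Z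
    using exits_into_iff[of "started_at 0 X" \<omega> ?B Z] that by (simp add: started_at_disp)
  have far: "{\<omega>\<in>space M. exits_into (started_at 0 X) ?B (- ?V) \<omega>} \<in> sets (completion M)"
    by (rule exit_prob_eq(1)[OF _ _ _ front sep _ far_cl]) (use r in auto)
  have "AE \<omega> in M. \<omega> \<in> space M - {\<omega>\<in>space M. exits_into (started_at 0 X) ?B (- ?V) \<omega>} \<longleftrightarrow> \<omega> \<in> ?Q"
    using rc AE_leaves_ball[OF n s, of r] AE_space
  proof eventually_elim
    case (elim \<omega>)
    then obtain t where t: "exits_at ?B (- ?B) (\<lambda>s. disp s \<omega>) t"
      using first_exit[OF elim(1), of ?B] by auto
    have uniq: "t' = t" if "exits_at ?B (Z - ?B) (\<lambda>s. disp s \<omega>) t'" for t' Z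
    proof -
      have "\<not> t' < t" "\<not> t < t'"
        using t that by (auto simp: exits_at_def)
      then show ?thesis
        by simp
    qed
    have "exits_into (started_at 0 X) ?B Z \<omega> \<longleftrightarrow> disp t \<omega> \<in> Z" for Z
    proof
      assume "exits_into (started_at 0 X) ?B Z \<omega>"
      then obtain t' where t': "exits_at ?B (Z - ?B) (\<lambda>s. disp s \<omega>) t'"
        using iff[OF elim(1)] by blast
      then show "disp t \<omega> \<in> Z"
        using uniq[OF t'] by (simp add: exits_at_def)
    next
      assume "disp t \<omega> \<in> Z"
      then have "exits_at ?B (Z - ?B) (\<lambda>s. disp s \<omega>) t"
        using t by (simp add: exits_at_def)
      then show "exits_into (started_at 0 X) ?B Z \<omega>"
        using iff[OF elim(1)] by blast
    qed
    then show ?case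
      using elim by simp
  qed
  then have "AE \<omega> in completion M. \<omega> \<in> space M - {\<omega>\<in>space M. exits_into (started_at 0 X) ?B (- ?V) \<omega>} \<longleftrightarrow> \<omega> \<in> ?Q"
    by (rule AE_completion)
  then have Q: "?Q \<in> sets (completion M)"
    by (rule completion.in_sets_AE) (use far in auto)
  define G where "G k = {\<omega>\<in>space M. grid_exit k ?B (?W - ?B) (\<lambda>s. 0 + disp s \<omega>)}" for k
  define D where "D N = {\<omega>\<in>space M. \<exists>k\<ge>N. \<omega> \<in> G k}" for N
  have [measurable]: "G k \<in> sets M" "D k \<in> sets M" for k
    unfolding G_def D_def by measurable
  have "decseq D"
    unfolding decseq_def D_def by (auto intro: order_trans)
  then have "(\<lambda>N. measure M (D N)) \<longlonglongrightarrow> measure M (\<Inter>N. D N)"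
    by (intro finite_Lim_measure_decseq) auto
  then have ev: "\<forall>\<^sub>F N in sequentially. measure M (D N) < measure M (\<Inter>N. D N) + \<delta>"
    by (rule order_tendstoD) (use \<delta> in simp)
  have "closure ?B \<union> closure ?W \<subseteq> ?V"
  proof -
    have "closure (ball (0::'b) a) \<subseteq> cball 0 a" for a
      by (rule closure_minimal) auto
    from this[of r] this[of \<rho>] show ?thesis
      using r by fastforce
  qed
  have "AE \<omega> in M. \<omega> \<in> (\<Inter>N. D N) \<longrightarrow> \<omega> \<in> ?Q"
    using rc AE_space
  proof eventually_elim
    case (elim \<omega>)
    show ?case
    proof
      assume "\<omega> \<in> (\<Inter>N. D N)"
      then have "\<exists>\<^sub>F k in sequentially. grid_exit k ?B (?W - ?B) (\<lambda>s. disp s \<omega>)"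
        unfolding frequently_sequentially by (auto simp: D_def G_def)
      then have "\<exists>t. exits_at ?B (?V - ?B) (\<lambda>s. disp s \<omega>) t"
        by (intro frequently_grid_exit_imp[OF elim(1) _ \<open>closure ?B \<union> closure ?W \<subseteq> ?V\<close>]) auto
      then show "\<omega> \<in> ?Q"
        using iff[OF elim(1)] elim by simp
    qed
  qed
  then have "AE \<omega> in completion M. \<omega> \<in> (\<Inter>N. D N) \<longrightarrow> \<omega> \<in> ?Q"
    by (rule AE_completion)
  then have "measure (completion M) (\<Inter>N. D N) \<le> measure (completion M) ?Q"
    using prob_space_completion Q by (intro finite_measure.finite_measure_mono_AE) (auto simp: prob_space_def)
  then have le: "measure M (\<Inter>N. D N) \<le> exit_prob M X 0 ?B ?V"
    by (simp add: exit_prob_def)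
  from ev show ?thesis
  proof eventually_elim
    case (elim k)
    have "G k \<subseteq> D k"
    proof
      fix \<omega> assume "\<omega> \<in> G k"
      moreover from this have "\<omega> \<in> space M"
        by (simp add: G_def)
      ultimately show "\<omega> \<in> D k"
        unfolding D_def by blast
    qed
    then have "measure M (G k) \<le> measure M (D k)"
      by (rule finite_measure_mono) simp
    then have "measure M (G k) \<le> exit_prob M X 0 ?B ?V + \<delta>"
      using elim le by linarith
    then have "emeasure M (G k) \<le> ennreal (exit_prob M X 0 ?B ?V + \<delta>)"
      by (simp add: emeasure_eq_measure ennreal_leI)
    moreover have "emeasure M (G k) = walk_potential (step (1 / 2^k)) ?B (indicator (?W - ?B)) 0"
      unfolding G_def by (rule emeasure_grid_exit) auto
    ultimately show ?case
      by simp
  qed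
qed

end

section \<open>Jumps and increments\<close>

lemma dist_diff_diff_le:
  fixes a b c d :: "'a::real_normed_vector"
  shows "dist (a - b) (c - d) \<le> dist a c + dist b d"
proof -
  have "(a - b) - (c - d) = (a - c) - (b - d)"
    by simp
  then show ?thesis
    unfolding dist_norm by (metis norm_triangle_ineq4)
qed

lemma jump_imp_grid_increment:
  fixes y :: "real \<Rightarrow> 'a::euclidean_space"
  assumes y: "right_cont y" and t: "0 < t" "t \<le> 1" and l: "(y \<longlongrightarrow> l) (at_left t)"
    and S: "open S" "y t - l \<in> S"
  shows "\<forall>\<^sub>F n in sequentially. \<exists>i<2^n. y (real (Suc i) / 2^n) - y (real i / 2^n) \<in> S"
proof -
  obtain e where e: "0 < e" "ball (y t - l) e \<subseteq> S"
    using S by (auto simp: open_contains_ball)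
  obtain d1 where d1: "0 < d1" "\<And>s. t \<le> s \<Longrightarrow> s < t + d1 \<Longrightarrow> dist (y s) (y t) < e/2"
    using right_contD[OF y, of t "e/2"] t e by auto
  have "\<forall>\<^sub>F s in at_left t. dist (y s) l < e/2"
    using l by (rule tendstoD) (use e in simp)
  then obtain b where b: "b < t" "\<And>s. b < s \<Longrightarrow> s < t \<Longrightarrow> dist (y s) l < e/2"
    by (auto simp: eventually_at_left_field)
  have "0 < min d1 (t - b)"
    using d1 b by simp
  from eventually_grid_fine[OF this] show ?thesis
  proof eventually_elim
    case (elim n)
    have "0 \<le> t"
      using t by simp
    then obtain k where k: "t \<le> real k / 2^n" "real k / 2^n < t + 1 / 2^n" "\<And>i. i < k \<Longrightarrow> real i / 2^n < t"
      by (rule first_grid_point[of t n]) blast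
    have "k \<noteq> 0"
      using k(1) t by (cases k) auto
    then obtain i where i: "k = Suc i"
      using not0_implies_Suc by blast
    have "real k < 2^n * t + 1"
      using k(2) by (simp add: field_simps)
    also have "\<dots> \<le> 2^n * 1 + 1"
      using t by (intro add_right_mono mult_left_mono) auto
    finally have "real k < real (2^n + 1)"
      by simp
    then have "k < 2^n + 1"
      by (simp only: of_nat_less_iff)
    then have "i < 2^n"
      using i by simp
    have "real i / 2^n = real k / 2^n - 1 / 2^n"
      by (simp add: i field_simps)
    then have "b < real i / 2^n" "real i / 2^n < t"
      using k elim i by auto
    then have "dist (y (real i / 2^n)) l < e/2"
      by (rule b(2))
    moreover have "dist (y (real k / 2^n)) (y t) < e/2"
      using k elim by (intro d1(2)) auto
    moreover have "dist (y (real k / 2^n) - y (real i / 2^n)) (y t - l)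
        \<le> dist (y (real k / 2^n)) (y t) + dist (y (real i / 2^n)) l"
      by (rule dist_diff_diff_le)
    ultimately have "y (real k / 2^n) - y (real i / 2^n) \<in> ball (y t - l) e"
      by (simp add: dist_commute)
    then show ?case
      using e \<open>i < 2^n\<close> i by blast
  qed
qed

lemma grid_increment_imp_jump:
  fixes y :: "real \<Rightarrow> 'a::euclidean_space"
  assumes y: "right_cont y" and left: "\<And>t. 0 < t \<Longrightarrow> \<exists>l. (y \<longlongrightarrow> l) (at_left t)"
    and S: "closed S" "0 \<notin> S"
    and freq: "\<exists>\<^sub>F n in sequentially. \<exists>i<2^n. y (real (Suc i) / 2^n) - y (real i / 2^n) \<in> S"
  shows "\<exists>t. 0 < t \<and> t \<le> 1 \<and> y t - Lim (at_left t) y \<in> S"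
proof (rule ccontr)
  assume no_jump: "\<not> ?thesis"
  have "0 \<in> - S" "open (- S)"
    using S by auto
  then obtain e where e: "0 < e" "ball 0 e \<subseteq> - S"
    by (meson open_contains_ball)
  have local: "\<exists>r>0. \<forall>a b. 0 \<le> a \<and> a < b \<and> t - r < a \<and> b < t + r \<longrightarrow> y b - y a \<notin> S"
    if t: "0 \<le> t" "t \<le> 1" for t
  proof (cases "t = 0")
    case True
    obtain r where r: "0 < r" "\<And>s. t \<le> s \<Longrightarrow> s < t + r \<Longrightarrow> dist (y s) (y t) < e/2"
      using right_contD[OF y, of t "e/2"] t e by auto
    have "y b - y a \<notin> S" if "0 \<le> a" "a < b" "b < t + r" for a b
    proof -
      have "dist (y a) (y t) < e/2" "dist (y b) (y t) < e/2"
        using r that True by auto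
      then have "dist (y b) (y a) < e"
        using dist_triangle2[of "y b" "y a" "y t"] by linarith
      then show ?thesis
        using e(2) by (auto simp: dist_norm)
    qed
    then show ?thesis
      using r(1) by blast
  next
    case False
    then have "0 < t"
      using t by simp
    then obtain l where l: "(y \<longlongrightarrow> l) (at_left t)"
      using left by blast
    then have "Lim (at_left t) y = l"
      by (intro tendsto_Lim) (auto simp: trivial_limit_at_left_real)
    then have "y t - l \<notin> S"
      using no_jump \<open>0 < t\<close> t by blast
    then obtain e' where e': "0 < e'" "ball (y t - l) e' \<subseteq> - S"
      using S(1) by (metis ComplI open_Compl open_contains_ball)
    define \<epsilon> where "\<epsilon> = min e e' / 2"
    have "0 < \<epsilon>"
      using e e' by (simp add: \<epsilon>_def)
    obtain d1 where d1: "0 < d1" "\<And>s. t \<le> s \<Longrightarrow> s < t + d1 \<Longrightarrow> dist (y s) (y t) < \<epsilon>"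
      using right_contD[OF y t(1) \<open>0 < \<epsilon>\<close>] by blast
    have "\<forall>\<^sub>F s in at_left t. dist (y s) l < \<epsilon>"
      using l \<open>0 < \<epsilon>\<close> by (rule tendstoD)
    then obtain b0 where b0: "b0 < t" "\<And>s. b0 < s \<Longrightarrow> s < t \<Longrightarrow> dist (y s) l < \<epsilon>"
      by (auto simp: eventually_at_left_field)
    define r where "r = min d1 (t - b0)"
    have "y b - y a \<notin> S" if ab: "a < b" "t - r < a" "b < t + r" for a b
    proof -
      consider "t \<le> a" | "b < t" | "a < t" "t \<le> b"
        by linarith
      then show ?thesis
      proof cases
        case 1
        then have "dist (y a) (y t) < \<epsilon>" "dist (y b) (y t) < \<epsilon>"
          using ab by (auto intro!: d1(2) simp: r_def)
        then have "dist (y b) (y a) < e"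
          using dist_triangle2[of "y b" "y a" "y t"] by (simp add: \<epsilon>_def)
        then show ?thesis
          using e(2) by (auto simp: dist_norm)
      next
        case 2
        then have "dist (y a) l < \<epsilon>" "dist (y b) l < \<epsilon>"
          using ab by (auto intro!: b0(2) simp: r_def)
        then have "dist (y b) (y a) < e"
          using dist_triangle2[of "y b" "y a" l] by (simp add: \<epsilon>_def)
        then show ?thesis
          using e(2) by (auto simp: dist_norm)
      next
        case 3
        then have "dist (y a) l < \<epsilon>" "dist (y b) (y t) < \<epsilon>"
          using ab by (auto intro!: b0(2) d1(2) simp: r_def)
        then have "dist (y b - y a) (y t - l) < e'"
          using dist_diff_diff_le[of "y b" "y a" "y t" l] by (simp add: \<epsilon>_def)
        then have "y b - y a \<in> ball (y t - l) e'"
          by (simp add: dist_commute)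
        then show ?thesis
          using e'(2) by blast
      qed
    qed
    moreover have "0 < r"
      using d1 b0 by (simp add: r_def)
    ultimately show ?thesis
      by blast
  qed
  have "\<forall>N. \<exists>n i. N \<le> n \<and> i < 2^n \<and> y (real (Suc i) / 2^n) - y (real i / 2^n) \<in> S"
    using freq unfolding frequently_sequentially by blast
  then obtain \<nu> \<iota> where \<nu>: "\<And>N. N \<le> \<nu> N" and \<iota>: "\<And>N. \<iota> N < 2^\<nu> N"
    and inc: "\<And>N. y (real (Suc (\<iota> N)) / 2^\<nu> N) - y (real (\<iota> N) / 2^\<nu> N) \<in> S"
    by metis
  define a where "a N = real (\<iota> N) / 2^\<nu> N" for N
  have a01: "a N \<in> {0..1}" for N
  proof -
    have "real (\<iota> N) \<le> 2^\<nu> N"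
      using \<iota>[of N] by (metis less_imp_le of_nat_le_iff of_nat_numeral of_nat_power)
    then show ?thesis
      by (simp add: a_def)
  qed
  have "seq_compact {0..1::real}"
    by (intro compact_imp_seq_compact compact_Icc)
  then obtain t \<rho> where t: "t \<in> {0..1}" and \<rho>: "strict_mono \<rho>" and lim: "(a \<circ> \<rho>) \<longlonglongrightarrow> t"
    using a01 unfolding seq_compact_def by meson
  obtain r where r: "0 < r" "\<And>a b. 0 \<le> a \<Longrightarrow> a < b \<Longrightarrow> t - r < a \<Longrightarrow> b < t + r \<Longrightarrow> y b - y a \<notin> S"
    using local[of t] t by auto
  have "\<forall>\<^sub>F N in sequentially. dist ((a \<circ> \<rho>) N) t < r/2"
    using lim by (rule tendstoD) (use r in simp)
  moreover have "\<forall>\<^sub>F N in sequentially. 1 / 2^N < r/2"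
    by (rule eventually_grid_fine) (use r in simp)
  ultimately have "\<forall>\<^sub>F N in sequentially. dist ((a \<circ> \<rho>) N) t < r/2 \<and> 1 / 2^N < r/2"
    by eventually_elim simp
  then obtain N where N: "dist ((a \<circ> \<rho>) N) t < r/2" "1 / 2^N < r/2"
    using eventually_happens' sequentially_bot by blast
  have "N \<le> \<nu> (\<rho> N)"
    using \<nu>[of "\<rho> N"] seq_suble[OF \<rho>, of N] by linarith
  then have "(1::real) / 2^\<nu> (\<rho> N) \<le> 1 / 2^N"
    by (intro divide_left_mono power_increasing) auto
  moreover have "real (Suc (\<iota> (\<rho> N))) / 2^\<nu> (\<rho> N) = a (\<rho> N) + 1 / 2^\<nu> (\<rho> N)"
    by (simp add: a_def field_simps)
  moreover have "\<bar>a (\<rho> N) - t\<bar> < r/2"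
    using N(1) by (simp add: dist_real_def)
  ultimately have "t - r < a (\<rho> N)" "real (Suc (\<iota> (\<rho> N))) / 2^\<nu> (\<rho> N) < t + r"
    using N(2) r(1) by linarith+
  then have "y (real (Suc (\<iota> (\<rho> N))) / 2^\<nu> (\<rho> N)) - y (a (\<rho> N)) \<notin> S"
    using a01[of "\<rho> N"] by (intro r(2)) (auto simp: a_def divide_strict_right_mono)
  then show False
    using inc[of "\<rho> N"] by (simp add: a_def)
qed

lemma (in prob_space) eventually_measure_ge:
  assumes [measurable]: "\<And>n. G n \<in> sets M" and Z: "Z \<in> sets (completion M)"
    and AE: "AE \<omega> in M. \<omega> \<in> Z \<longrightarrow> (\<forall>\<^sub>F n in sequentially. \<omega> \<in> G n)"
    and p: "p < measure (completion M) Z"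
  shows "\<forall>\<^sub>F n in sequentially. p < measure M (G n)"
proof -
  define L where "L N = {\<omega>\<in>space M. \<forall>n\<ge>N. \<omega> \<in> G n}" for N
  have [measurable]: "L N \<in> sets M" for N
    unfolding L_def by measurable
  have "AE \<omega> in M. \<omega> \<in> Z \<longrightarrow> \<omega> \<in> (\<Union>N. L N)"
    using AE AE_space by eventually_elim (auto simp: L_def eventually_sequentially)
  then have "AE \<omega> in completion M. \<omega> \<in> Z \<longrightarrow> \<omega> \<in> (\<Union>N. L N)"
    by (rule AE_completion)
  then have "measure (completion M) Z \<le> measure (completion M) (\<Union>N. L N)"
    using prob_space_completion by (intro finite_measure.finite_measure_mono_AE) (auto simp: prob_space_def)
  then have "p < measure M (\<Union>N. L N)"
    using p by simp
  moreover have "(\<lambda>N. measure M (L N)) \<longlonglongrightarrow> measure M (\<Union>N. L N)"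
    by (rule finite_Lim_measure_incseq) (auto simp: incseq_def L_def)
  ultimately have "\<forall>\<^sub>F N in sequentially. p < measure M (L N)"
    by (rule order_tendstoD[rotated])
  then show ?thesis
  proof eventually_elim
    case (elim N)
    have "L N \<subseteq> G N"
      by (auto simp: L_def)
    then have "measure M (L N) \<le> measure M (G N)"
      by (rule finite_measure_mono) simp
    then show ?case
      using elim by linarith
  qed
qed

lemma emeasure_distr_nonzero:
  assumes "emeasure (distr M N f) A \<noteq> 0"
  shows "emeasure (distr M N f) A = emeasure M (f -` A \<inter> space M)"
  using assms unfolding distr_def by (auto simp: emeasure_measure_of_conv split: if_splits)

definition levy_mass :: "(real \<Rightarrow> real) \<Rightarrow> 'a::euclidean_space set \<Rightarrow> ennreal"
  where "levy_mass j S = (\<integral>\<^sup>+ x \<in> S. ennreal (j (norm x)) \<partial>lborel)"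

context levy_process
begin

lemma measure_no_grid_increment:
  assumes [measurable]: "S \<in> sets borel"
  shows "measure M {\<omega>\<in>space M. \<forall>i<2^n. X (real (Suc i) / 2^n) \<omega> - X (real i / 2^n) \<omega> \<notin> S}
    = (1 - measure (step (1 / 2^n)) S) ^ (2^n)"
proof -
  define \<xi> where "\<xi> i \<omega> = X (real (Suc i) / 2^n) \<omega> - X (real i / 2^n) \<omega>" for i \<omega>
  interpret S: step_law "step (1 / 2^n)"
    by (rule step_law_step) simp
  have [measurable]: "\<xi> i \<in> borel_measurable M" for i
    unfolding \<xi>_def by (intro borel_measurable_diff random_variable_X) auto
  have q: "prob (\<xi> i -` (- S) \<inter> space M) = 1 - measure (step (1 / 2^n)) S" for i
  proof -
    have "distr M borel (\<xi> i) = step (1 / 2^n)"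
      using stationary_increments[of "real i / 2^n" "1 / 2^n"]
      unfolding \<xi>_def[abs_def] step_def disp_def[abs_def] by (simp add: add_divide_distrib add.commute)
    then have "prob (\<xi> i -` (- S) \<inter> space M) = measure (step (1 / 2^n)) (- S)"
      using measure_distr[of "\<xi> i" M borel "- S"] by simp
    then show ?thesis
      using S.prob_compl[of S] by (simp add: Compl_eq_Diff_UNIV)
  qed
  have "indep_vars (\<lambda>_. borel) \<xi> {..<2^n}"
    unfolding \<xi>_def by (rule independent_increments[of "\<lambda>i. real i / 2^n"]) (auto simp: divide_right_mono)
  then have "prob (\<Inter>i\<in>{..<2^n}. \<xi> i -` (- S) \<inter> space M) = (\<Prod>i\<in>{..<2^n}. prob (\<xi> i -` (- S) \<inter> space M))"
    by (rule indep_varsD) (auto simp: lessThan_empty_iff)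
  also have "\<dots> = (1 - measure (step (1 / 2^n)) S) ^ (2^n)"
    by (simp add: q)
  also have "(\<Inter>i\<in>{..<2^n}. \<xi> i -` (- S) \<inter> space M) = {\<omega>\<in>space M. \<forall>i<2^n. \<xi> i \<omega> \<notin> S}"
    by (auto simp: lessThan_def) (metis zero_less_numeral zero_less_power)
  finally show ?thesis
    by (simp add: \<xi>_def)
qed

lemma no_jump_event:
  assumes j: "jump_density M X j" and S: "S \<in> sets borel" "0 \<notin> S" and I: "0 < levy_mass j S" "levy_mass j S < \<infinity>"
  defines "Z \<equiv> {\<omega>\<in>space M. card (jump_times X S \<omega> \<inter> {0<..1}) = 0}"
  shows "Z \<in> sets (completion M)" "measure (completion M) Z = exp (- enn2real (levy_mass j S))"
    "AE \<omega> in M. \<omega> \<in> Z \<longleftrightarrow> jump_times X S \<omega> \<inter> {0<..1} = {}"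
proof -
  have P: "poisson_process (completion M) (jump_times X S) (enn2real (levy_mass j S))"
    using j S I unfolding jump_density_def levy_mass_def Let_def by blast
  let ?\<nu> = "enn2real (levy_mass j S)"
  let ?D = "distr (completion M) (count_space UNIV) (\<lambda>\<omega>. card (jump_times X S \<omega> \<inter> {0<..1}))"
  have D: "?D = measure_pmf (poisson_pmf (?\<nu> * (1 - 0)))"
    using P unfolding poisson_process_def by (metis order_refl zero_less_one)
  have "emeasure ?D {0} = ennreal (exp (- ?\<nu>))"
    unfolding D using I by (simp add: emeasure_pmf_single enn2real_positive_iff)
  moreover from this have "emeasure ?D {0} = emeasure (completion M) Z"
    by (subst emeasure_distr_nonzero) (auto simp: Z_def vimage_def Int_def conj_commute)
  ultimately have Z: "emeasure (completion M) Z = ennreal (exp (- ?\<nu>))"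
    by simp
  then show "Z \<in> sets (completion M)"
    using emeasure_notin_sets by fastforce
  show "measure (completion M) Z = exp (- ?\<nu>)"
    using Z by (simp add: measure_def)
  have "AE \<omega> in completion M. \<forall>t. finite (jump_times X S \<omega> \<inter> {0<..t})"
    using P unfolding poisson_process_def by blast
  then have "AE \<omega> in M. \<forall>t. finite (jump_times X S \<omega> \<inter> {0<..t})"
    by (simp only: AE_completion_iff)
  then show "AE \<omega> in M. \<omega> \<in> Z \<longleftrightarrow> jump_times X S \<omega> \<inter> {0<..1} = {}"
    using AE_space by eventually_elim (auto simp: Z_def card_eq_0_iff)
qed

lemma AE_cadlag_path:
  "AE \<omega> in M. right_cont (\<lambda>s. X s \<omega>) \<and> (\<forall>t>0. \<exists>l. ((\<lambda>s. X s \<omega>) \<longlongrightarrow> l) (at_left t))"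
  using cadlag by eventually_elim (auto simp: right_cont_def)

lemma eventually_intensity_le:
  assumes j: "jump_density M X j" and S: "closed S" "0 \<notin> S" and I: "0 < levy_mass j S" "levy_mass j S < \<infinity>"
    and \<nu>': "enn2real (levy_mass j S) < \<nu>'"
  shows "\<forall>\<^sub>F n in sequentially. 2^n * measure (step (1 / 2^n)) S \<le> \<nu>'"
proof -
  have [measurable]: "S \<in> sets borel"
    using S by simp
  note no_jump = no_jump_event[OF j \<open>S \<in> sets borel\<close> S(2) I]
  let ?G = "\<lambda>n. {\<omega>\<in>space M. \<forall>i<2^n. X (real (Suc i) / 2^n) \<omega> - X (real i / 2^n) \<omega> \<notin> S}"
  have "\<forall>\<^sub>F n in sequentially. exp (- \<nu>') < measure M (?G n)"
  proof (rule eventually_measure_ge[OF _ no_jump(1)])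
    show "?G n \<in> sets M" for n
    proof -
      have [measurable]: "X (real i / 2^n) \<in> borel_measurable M" for i
        by (rule random_variable_X) simp
      show ?thesis
        by measurable
    qed
    show "exp (- \<nu>') < measure (completion M) {\<omega>\<in>space M. card (jump_times X S \<omega> \<inter> {0<..1}) = 0}"
      unfolding no_jump(2) using \<nu>' by simp
    show "AE \<omega> in M. \<omega> \<in> {\<omega>\<in>space M. card (jump_times X S \<omega> \<inter> {0<..1}) = 0} \<longrightarrow>
        (\<forall>\<^sub>F n in sequentially. \<omega> \<in> ?G n)"
      using no_jump(3) AE_cadlag_path
    proof eventually_elim
      case (elim \<omega>)
      show ?case
      proof (intro impI, rule ccontr)
        assume Z: "\<omega> \<in> {\<omega>\<in>space M. card (jump_times X S \<omega> \<inter> {0<..1}) = 0}"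
          and "\<not> (\<forall>\<^sub>F n in sequentially. \<omega> \<in> ?G n)"
        then have "\<exists>\<^sub>F n in sequentially. \<exists>i<2^n. X (real (Suc i) / 2^n) \<omega> - X (real i / 2^n) \<omega> \<in> S"
          unfolding frequently_def by simp
        then obtain t where "0 < t" "t \<le> 1" "X t \<omega> - Lim (at_left t) (\<lambda>s. X s \<omega>) \<in> S"
          using grid_increment_imp_jump[of "\<lambda>s. X s \<omega>" S] elim(2) S by blast
        then have "t \<in> jump_times X S \<omega> \<inter> {0<..1}"
          by (simp add: jump_times_def)
        then show False
          using elim(1) Z by blast
      qed
    qed
  qed
  then show ?thesis
  proof eventually_elim
    case (elim n)
    let ?q = "measure (step (1 / 2^n)) S"
    interpret S: step_law "step (1 / 2^n)"
      by (rule step_law_step) simp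
    have "exp (- \<nu>') < (1 - ?q) ^ (2^n)"
      using elim unfolding measure_no_grid_increment[OF \<open>S \<in> sets borel\<close>] .
    also have "\<dots> \<le> exp (- ?q) ^ (2^n)"
      using exp_ge_add_one_self[of "- ?q"] S.prob_le_1 by (intro power_mono) auto
    also have "\<dots> = exp (- (2^n * ?q))"
      by (simp flip: exp_of_nat_mult)
    finally show ?case
      by simp
  qed
qed

lemma eventually_intensity_ge:
  assumes j: "jump_density M X j" and S: "open S" "0 \<notin> S" and I: "levy_mass j S < \<infinity>"
    and \<tau>: "0 \<le> \<tau>" "\<tau> < enn2real (levy_mass j S)"
  shows "\<forall>\<^sub>F n in sequentially. \<tau> \<le> 2^n * measure (step (1 / 2^n)) S"
proof -
  have [measurable]: "S \<in> sets borel"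
    using S by simp
  have I0: "0 < levy_mass j S"
    using \<tau> by (metis enn2real_0 not_gr_zero not_le)
  note no_jump = no_jump_event[OF j \<open>S \<in> sets borel\<close> S(2) I0 I]
  let ?G = "\<lambda>n. {\<omega>\<in>space M. \<forall>i<2^n. X (real (Suc i) / 2^n) \<omega> - X (real i / 2^n) \<omega> \<notin> S}"
  let ?Z = "{\<omega>\<in>space M. card (jump_times X S \<omega> \<inter> {0<..1}) = 0}"
  define \<nu>' where "\<nu>' = (\<tau> + enn2real (levy_mass j S)) / 2"
  have \<nu>': "\<tau> < \<nu>'" "\<nu>' < enn2real (levy_mass j S)" "0 < \<nu>'"
    using \<tau> by (auto simp: \<nu>'_def)
  have G: "?G n \<in> sets M" for n
  proof -
    have [measurable]: "X (real i / 2^n) \<in> borel_measurable M" for i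
      by (rule random_variable_X) simp
    show ?thesis
      by measurable
  qed
  have ev: "\<forall>\<^sub>F n in sequentially. 1 - exp (- \<nu>') < measure M (space M - ?G n)"
  proof (rule eventually_measure_ge)
    show "space M - ?G n \<in> sets M" for n
      using G by blast
    show "space M - ?Z \<in> sets (completion M)"
      using no_jump(1) by (metis sets.compl_sets space_completion)
    interpret C: prob_space "completion M"
      by (rule prob_space_completion)
    have "measure (completion M) (space M - ?Z) = 1 - exp (- enn2real (levy_mass j S))"
      using C.prob_compl[OF no_jump(1)] no_jump(2) by simp
    then show "1 - exp (- \<nu>') < measure (completion M) (space M - ?Z)"
      using \<nu>' by simp
    show "AE \<omega> in M. \<omega> \<in> space M - ?Z \<longrightarrow> (\<forall>\<^sub>F n in sequentially. \<omega> \<in> space M - ?G n)"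
      using no_jump(3) AE_cadlag_path
    proof eventually_elim
      case (elim \<omega>)
      show ?case
      proof
        assume Z: "\<omega> \<in> space M - ?Z"
        then obtain t where t: "t \<in> jump_times X S \<omega>" "t \<le> 1"
          using elim(1) by force
        then have "0 < t" "X t \<omega> - Lim (at_left t) (\<lambda>s. X s \<omega>) \<in> S"
          by (auto simp: jump_times_def)
        moreover obtain l where l: "((\<lambda>s. X s \<omega>) \<longlongrightarrow> l) (at_left t)"
          using elim(2) \<open>0 < t\<close> by blast
        moreover have "Lim (at_left t) (\<lambda>s. X s \<omega>) = l"
          using l by (intro tendsto_Lim) (auto simp: trivial_limit_at_left_real)
        ultimately have "\<forall>\<^sub>F n in sequentially. \<exists>i<2^n. X (real (Suc i) / 2^n) \<omega> - X (real i / 2^n) \<omega> \<in> S"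
          using elim(2) t(2) S(1) by (intro jump_imp_grid_increment[of "\<lambda>s. X s \<omega>" t l]) auto
        then show "\<forall>\<^sub>F n in sequentially. \<omega> \<in> space M - ?G n"
          by eventually_elim (use Z in blast)
      qed
    qed
  qed
  obtain n0 where n0: "\<nu>' / (1 - \<tau> / \<nu>') < 2 ^ n0"
    using real_arch_pow[of 2] by force
  from ev eventually_ge_at_top[of n0] show ?thesis
  proof eventually_elim
    case (elim n)
    let ?q = "measure (step (1 / 2^n)) S"
    interpret S: step_law "step (1 / 2^n)"
      by (rule step_law_step) simp
    have "(1 - ?q) ^ (2^n) < exp (- \<nu>')"
      using elim(1) prob_compl[OF G, of n] measure_no_grid_increment[OF \<open>S \<in> sets borel\<close>, of n] by simp
    define \<delta> where "\<delta> = 1 - \<tau> / \<nu>'"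
    have \<delta>: "0 < \<delta>" "\<delta> \<le> 1" "(1 - \<delta>) * \<nu>' = \<tau>"
      using \<nu>' \<tau> by (auto simp: \<delta>_def)
    show ?case
    proof (cases "\<delta> \<le> ?q")
      case True
      have "(2::real) ^ n0 \<le> 2 ^ n"
        using elim by (intro power_increasing) auto
      then have "\<nu>' / \<delta> < 2 ^ n"
        using n0 unfolding \<delta>_def by linarith
      then have "\<nu>' < 2^n * \<delta>"
        using \<delta> by (simp add: field_simps)
      also have "\<dots> \<le> 2^n * ?q"
        using True by simp
      finally show ?thesis
        using \<nu>' by simp
    next
      case False
      then have q: "?q < \<delta>" "0 < 1 - ?q"
        using \<delta> by auto
      have "(1 - ?q) ^ (2^n) = exp (2^n * ln (1 - ?q))"
        using q by (simp add: exp_of_nat_mult[of "2^n", simplified])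
      then have "2^n * ln (1 - ?q) < - \<nu>'"
        using \<open>(1 - ?q) ^ (2^n) < exp (- \<nu>')\<close> by simp
      moreover have "- ln (1 - ?q) \<le> ?q / (1 - ?q)"
        using ln_le_minus_one[of "1 / (1 - ?q)"] q by (simp add: ln_div field_simps)
      then have "2^n * (- ln (1 - ?q)) \<le> 2^n * (?q / (1 - ?q))"
        by (intro mult_left_mono) auto
      ultimately have "\<nu>' < 2^n * ?q / (1 - ?q)"
        by simp
      then have "\<nu>' * (1 - ?q) < 2^n * ?q"
        using q by (simp add: field_simps)
      moreover have "\<tau> \<le> \<nu>' * (1 - ?q)"
      proof -
        have "\<nu>' * (1 - \<delta>) \<le> \<nu>' * (1 - ?q)"
          using q \<nu>' by (intro mult_left_mono) auto
        then show ?thesis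
          using \<delta>(3) by (simp add: mult.commute)
      qed
      ultimately show ?thesis
        by simp
    qed
  qed
qed

end

lemma emeasure_annulus:
  fixes a b :: real
  assumes "0 \<le> a" "a < b"
  shows "0 < measure lborel (ball (0::'a::euclidean_space) b - cball 0 a)"
    and "emeasure lborel (ball (0::'a) b - cball 0 a) = ennreal (measure lborel (ball (0::'a) b - cball 0 a))"
proof -
  let ?S = "ball (0::'a) b - cball 0 a"
  have "bounded ?S"
    by (rule bounded_subset[OF bounded_ball[of 0 b]]) auto
  then have fin: "emeasure lborel ?S < \<infinity>"
    by (rule emeasure_bounded_finite)
  then show eq: "emeasure lborel ?S = ennreal (measure lborel ?S)"
    by (intro emeasure_eq_ennreal_measure) auto
  obtain u :: 'a where u: "u \<in> Basis"
    using nonempty_Basis by blast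
  have "((a + b) / 2) *\<^sub>R u \<in> ?S"
    using u assms by simp
  moreover have "open ?S"
    by (intro open_Diff) auto
  ultimately have "\<not> negligible ?S"
    using open_not_negligible by blast
  then have "emeasure lborel ?S \<noteq> 0"
    using \<open>open ?S\<close> by (auto simp: negligible_iff_null_sets null_sets_def)
  then show "0 < measure lborel ?S"
    using eq by (metis ennreal_0 measure_nonneg order_le_less)
qed

lemma levy_mass_le:
  assumes j: "antimono_on {0<..} j" and [measurable]: "S \<in> sets borel"
    and r: "0 < r" "\<And>x. x \<in> S \<Longrightarrow> r \<le> norm x"
  shows "levy_mass j S \<le> ennreal (j r) * emeasure lborel S"
proof -
  have "levy_mass j S \<le> (\<integral>\<^sup>+ x. ennreal (j r) * indicator S x \<partial>lborel)"
    unfolding levy_mass_def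
  proof (intro nn_integral_mono)
    fix x
    have "j (norm x) \<le> j r" if "x \<in> S"
      using r(1) r(2)[OF that] j unfolding monotone_on_def by (metis greaterThan_iff order_less_le_trans)
    then show "ennreal (j (norm x)) * indicator S x \<le> ennreal (j r) * indicator S x"
      by (auto simp: indicator_def intro!: ennreal_leI)
  qed
  then show ?thesis
    by (simp add: nn_integral_cmult_indicator)
qed

lemma levy_mass_ge:
  assumes j: "antimono_on {0<..} j" and [measurable]: "S \<in> sets borel"
    and r: "\<And>x. x \<in> S \<Longrightarrow> 0 < norm x \<and> norm x \<le> r"
  shows "ennreal (j r) * emeasure lborel S \<le> levy_mass j S"
proof -
  have "(\<integral>\<^sup>+ x. ennreal (j r) * indicator S x \<partial>lborel) \<le> levy_mass j S"
    unfolding levy_mass_def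
  proof (intro nn_integral_mono)
    fix x
    have "j r \<le> j (norm x)" if "x \<in> S"
      using r[OF that] j unfolding monotone_on_def by (metis greaterThan_iff order_less_le_trans)
    then show "ennreal (j r) * indicator S x \<le> ennreal (j (norm x)) * indicator S x"
      by (auto simp: indicator_def intro!: ennreal_leI)
  qed
  then show ?thesis
    by (simp add: nn_integral_cmult_indicator)
qed

lemma levy_mass_Un:
  fixes S T :: "'a::euclidean_space set"
  assumes j: "antimono_on {0<..} j" and [measurable]: "S \<in> sets borel" "T \<in> sets borel" and "S \<inter> T = {}"
  shows "levy_mass j (S \<union> T) = levy_mass j S + levy_mass j T"
proof -
  have [measurable]: "(\<lambda>x::'a. ennreal (j (norm x))) \<in> borel_measurable borel"
  proof -
    have "(\<lambda>x::'a. ennreal (j (norm x))) = (\<lambda>x. if x = 0 then ennreal (j 0) else ennreal (j (norm x)))"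
      by auto
    then show ?thesis
      using borel_measurable_antimono_norm[OF j] by simp
  qed
  have "levy_mass j (S \<union> T) = (\<integral>\<^sup>+ x. ennreal (j (norm x)) * indicator S x + ennreal (j (norm x)) * indicator T x \<partial>lborel)"
    unfolding levy_mass_def using \<open>S \<inter> T = {}\<close> by (intro nn_integral_cong) (auto simp: indicator_def)
  also have "\<dots> = levy_mass j S + levy_mass j T"
    unfolding levy_mass_def by (rule nn_integral_add) measurable
  finally show ?thesis .
qed

lemma levy_mass_closed_annulus:
  "levy_mass j (cball (0::'a::euclidean_space) b - ball 0 a) = levy_mass j (ball (0::'a) b - cball 0 a)"
proof -
  have "AE x::'a in lborel. norm x \<noteq> r" for r
  proof -
    have "frontier (cball (0::'a) r) \<in> null_sets lborel"
      using negligible_convex_frontier[OF convex_cball[of "0::'a" r]]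
      by (simp add: negligible_iff_null_sets null_sets_completion_iff del: frontier_cball)
    then have "AE x::'a in lborel. x \<notin> frontier (cball 0 r)"
      by (rule AE_not_in)
    then show ?thesis
      by eventually_elim auto
  qed
  from this[of a] this[of b] have "AE x in lborel. ennreal (j (norm x)) * indicator (cball 0 b - ball 0 a) x
      = ennreal (j (norm x)) * indicator (ball 0 b - cball 0 a) (x :: 'a)"
    by eventually_elim (auto simp: indicator_def)
  then show ?thesis
    unfolding levy_mass_def by (rule nn_integral_cong_AE)
qed

context levy_process
begin

lemma eventually_density_le:
  assumes j: "jump_density M X j" and c: "0 < c" "0 < j c" "c < r" "r < \<rho>" and \<delta>: "0 < \<delta>"
  shows "\<forall>\<^sub>F n in sequentially. \<forall>m. unimodal_law (step (1 / 2^n)) m \<longrightarrow> 2^n * m \<rho> \<le> j r + \<delta>"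
proof -
  have j_anti: "antimono_on {0<..} j" and j0: "\<And>r. 0 < r \<Longrightarrow> 0 \<le> j r"
    using j by (auto simp: jump_density_def)
  let ?S = "cball (0::'a) \<rho> - ball 0 r" and ?T = "cball (0::'a) c - ball 0 (c/2)" and ?T' = "ball (0::'a) c - cball 0 (c/2)"
  define v where "v = measure lborel (ball (0::'a) \<rho> - cball 0 r)"
  define w where "w = measure lborel (ball (0::'a) c - cball 0 (c/2))"
  have v: "0 < v" "emeasure lborel (ball (0::'a) \<rho> - cball 0 r) = ennreal v"
    unfolding v_def using c by (intro emeasure_annulus; simp)+
  have w: "0 < w" "emeasure lborel ?T' = ennreal w"
    unfolding w_def using c by (intro emeasure_annulus; simp)+
  have [measurable]: "?S \<in> sets borel" "?T \<in> sets borel" "?T' \<in> sets borel"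
    by auto
  have IS: "levy_mass j ?S \<le> ennreal (j r * v)"
  proof -
    have "levy_mass j ?S = levy_mass j (ball (0::'a) \<rho> - cball 0 r)"
      by (rule levy_mass_closed_annulus)
    also have "\<dots> \<le> ennreal (j r) * emeasure lborel (ball (0::'a) \<rho> - cball 0 r)"
      by (rule levy_mass_le[OF j_anti]) (use c in auto)
    finally show ?thesis
      using v j0[of r] c by (simp add: ennreal_mult)
  qed
  have "levy_mass j ?T' \<le> ennreal (j (c/2)) * emeasure lborel ?T'"
    by (rule levy_mass_le[OF j_anti]) (use c in auto)
  also have "\<dots> < \<infinity>"
    unfolding w by (simp add: ennreal_mult_less_top)
  finally have IT_fin: "levy_mass j ?T' < \<infinity>" .
  have "ennreal (j c) * emeasure lborel ?T' \<le> levy_mass j ?T'"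
    by (rule levy_mass_ge[OF j_anti]) (use c in auto)
  moreover have "0 < ennreal (j c) * emeasure lborel ?T'"
    unfolding w using w(1) c by (simp add: ennreal_zero_less_mult_iff)
  ultimately have IT_pos: "0 < levy_mass j ?T'"
    by (rule less_le_trans[rotated])
  define \<tau> where "\<tau> = enn2real (levy_mass j ?T')"
  have \<tau>: "0 < \<tau>" "levy_mass j ?T' = ennreal \<tau>"
    using IT_pos IT_fin by (auto simp: \<tau>_def enn2real_positive_iff)
  have IU: "levy_mass j (?S \<union> ?T) = levy_mass j ?S + ennreal \<tau>"
    using c \<tau>(2) by (subst levy_mass_Un[OF j_anti]) (auto simp: levy_mass_closed_annulus)
  obtain \<sigma> where \<sigma>: "0 \<le> \<sigma>" "levy_mass j ?S = ennreal \<sigma>" "\<sigma> \<le> j r * v"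
    using IS j0[of r] c v by (cases "levy_mass j ?S") (auto simp: top_unique)
  have IU': "levy_mass j (?S \<union> ?T) = ennreal (\<sigma> + \<tau>)"
    using IU \<sigma> \<tau> by (simp add: ennreal_plus)
  define \<eta> where "\<eta> = min (\<delta> * v / 2) \<tau>"
  have \<eta>: "0 < \<eta>" "\<eta> \<le> \<tau>" "2 * \<eta> \<le> \<delta> * v"
    using v \<delta> \<tau> by (auto simp: \<eta>_def)
  have "\<forall>\<^sub>F n in sequentially. 2^n * measure (step (1 / 2^n)) (?S \<union> ?T) \<le> \<sigma> + \<tau> + \<eta>"
    using c \<sigma> \<tau> \<eta> by (intro eventually_intensity_le[OF j]) (auto simp: IU' add_nonneg_pos)
  moreover have "\<forall>\<^sub>F n in sequentially. \<tau> - \<eta> \<le> 2^n * measure (step (1 / 2^n)) ?T'"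
    using c \<tau> \<eta> IT_fin by (intro eventually_intensity_ge[OF j]) (auto intro!: open_Diff)
  ultimately show ?thesis
  proof eventually_elim
    case (elim n)
    show ?case
    proof (intro allI impI)
      fix m assume "unimodal_law (step (1 / 2^n)) m"
      then interpret S: unimodal_law "step (1 / 2^n)" m .
      have "ennreal (m \<rho>) * emeasure lborel (ball (0::'a) \<rho> - cball 0 r)
          \<le> (\<integral>\<^sup>+w. indicator (ball 0 \<rho> - cball 0 r) (0 + w) \<partial>step (1 / 2^n))"
        by (rule S.mass_ge) (use c in auto)
      also have "\<dots> = emeasure (step (1 / 2^n)) (ball 0 \<rho> - cball 0 r)"
        by simp
      also have "\<dots> \<le> emeasure (step (1 / 2^n)) ?S"
        by (intro emeasure_mono) auto
      finally have "m \<rho> * v \<le> measure (step (1 / 2^n)) ?S"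
        using v S.m_nonneg[of \<rho>] c by (simp add: S.emeasure_eq_measure flip: ennreal_mult)
      then have 1: "2^n * (m \<rho> * v) \<le> 2^n * measure (step (1 / 2^n)) ?S"
        by (intro mult_left_mono) auto
      have 2: "measure (step (1 / 2^n)) (?S \<union> ?T) = measure (step (1 / 2^n)) ?S + measure (step (1 / 2^n)) ?T"
        by (rule S.finite_measure_Union) (use c in auto)
      have "measure (step (1 / 2^n)) ?T' \<le> measure (step (1 / 2^n)) ?T"
        by (rule S.finite_measure_mono) auto
      then have 3: "2^n * measure (step (1 / 2^n)) ?T' \<le> 2^n * measure (step (1 / 2^n)) ?T"
        by (intro mult_left_mono) auto
      have "2^n * (m \<rho> * v) \<le> \<sigma> + 2 * \<eta>"
        using 1 3 elim unfolding 2 distrib_left by linarith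
      also have "\<dots> \<le> (j r + \<delta>) * v"
        using \<sigma> \<eta> by (simp add: distrib_right)
      finally have "(2^n * m \<rho>) * v \<le> (j r + \<delta>) * v"
        by (simp add: mult.assoc)
      then show "2^n * m \<rho> \<le> j r + \<delta>"
        using v(1) by (rule mult_right_le_imp_le)
    qed
  qed
qed

lemma eventually_density_ge:
  assumes j: "jump_density M X j" and c: "0 < \<rho>" "\<rho> < c" "0 < j c" and \<delta>: "0 < \<delta>" "\<delta> < j c"
  shows "\<forall>\<^sub>F n in sequentially. \<forall>m. unimodal_law (step (1 / 2^n)) m \<longrightarrow> j c - \<delta> \<le> 2^n * m \<rho>"
proof -
  have j_anti: "antimono_on {0<..} j"
    using j by (auto simp: jump_density_def)
  let ?S = "ball (0::'a) c - cball 0 \<rho>"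
  define v where "v = measure lborel ?S"
  have v: "0 < v" "emeasure lborel ?S = ennreal v"
    unfolding v_def using c by (intro emeasure_annulus; simp)+
  have [measurable]: "?S \<in> sets borel"
    by auto
  have "levy_mass j ?S \<le> ennreal (j \<rho>) * emeasure lborel ?S"
    by (rule levy_mass_le[OF j_anti]) (use c in auto)
  also have "\<dots> < \<infinity>"
    unfolding v by (simp add: ennreal_mult_less_top)
  finally have fin: "levy_mass j ?S < \<infinity>" .
  have "ennreal (j c) * emeasure lborel ?S \<le> levy_mass j ?S"
    by (rule levy_mass_ge[OF j_anti]) (use c in auto)
  then have "ennreal (j c * v) \<le> levy_mass j ?S"
    using v c by (simp add: ennreal_mult)
  then have "j c * v \<le> enn2real (levy_mass j ?S)"
    using fin by (metis enn2real_ennreal enn2real_mono infinity_ennreal_def c(3) v(1) mult_nonneg_nonneg less_imp_le)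
  moreover have "(j c - \<delta>) * v < j c * v"
    using \<delta> v by simp
  ultimately have less: "(j c - \<delta>) * v < enn2real (levy_mass j ?S)"
    by linarith
  have "\<forall>\<^sub>F n in sequentially. (j c - \<delta>) * v \<le> 2^n * measure (step (1 / 2^n)) ?S"
    by (rule eventually_intensity_ge[OF j _ _ fin _ less]) (use c v \<delta> in \<open>auto intro!: open_Diff\<close>)
  then show ?thesis
  proof eventually_elim
    case (elim n)
    show ?case
    proof (intro allI impI)
      fix m assume "unimodal_law (step (1 / 2^n)) m"
      then interpret S: unimodal_law "step (1 / 2^n)" m .
      have "emeasure (step (1 / 2^n)) ?S = (\<integral>\<^sup>+w. indicator ?S (0 + w) \<partial>step (1 / 2^n))"
        by simp
      also have "\<dots> \<le> ennreal (m \<rho>) * emeasure lborel ?S"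
        by (rule S.mass_le) (use c in auto)
      finally have "measure (step (1 / 2^n)) ?S \<le> m \<rho> * v"
        using v S.m_nonneg[of \<rho>] c by (simp add: S.emeasure_eq_measure flip: ennreal_mult)
      then have "2^n * measure (step (1 / 2^n)) ?S \<le> 2^n * (m \<rho> * v)"
        by (intro mult_left_mono) auto
      from order_trans[OF elim this] have "(j c - \<delta>) * v \<le> (2^n * m \<rho>) * v"
        by (simp only: mult.assoc)
      then show "j c - \<delta> \<le> 2^n * m \<rho>"
        using v(1) by (rule mult_right_le_imp_le)
    qed
  qed
qed

end

section \<open>Cylinders\<close>

definition perp :: "'n::finite \<Rightarrow> real ^ 'n \<Rightarrow> real ^ 'n"
  where "perp k x = x - (x $ k) *\<^sub>R axis k 1"

lemma perp_diff: "perp k (x - y) = perp k x - perp k y"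
  by (simp add: perp_def algebra_simps)

lemma perp_add: "perp k (x + y) = perp k x + perp k y"
  by (simp add: perp_def algebra_simps)

lemma perp_scaleR: "perp k (c *\<^sub>R x) = c *\<^sub>R perp k x"
  by (simp add: perp_def algebra_simps)

lemma linear_perp: "linear (perp k)"
  by (intro linearI perp_add perp_scaleR)

lemma perp_axis [simp]: "perp k (axis k c) = 0"
  by (simp add: perp_def vec_eq_iff axis_def)

lemma perp_nth: "perp k x $ i = (if i = k then 0 else x $ i)"
  by (simp add: perp_def axis_def)

lemma norm_perp: "norm (perp k x) = L2_set (\<lambda>i. x $ i) (UNIV - {k})"
proof -
  have "(\<Sum>i\<in>UNIV. (perp k x $ i)\<^sup>2) = (\<Sum>i\<in>UNIV - {k}. (x $ i)\<^sup>2)"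
    by (subst sum.remove[of UNIV k]) (auto simp: perp_nth intro!: sum.cong)
  then show ?thesis
    by (simp add: norm_vec_def L2_set_def)
qed

lemma norm_eq_perp: "(norm x)\<^sup>2 = (x $ k)\<^sup>2 + (norm (perp k x))\<^sup>2"
proof -
  have "(\<Sum>i\<in>UNIV. (x $ i)\<^sup>2) = (x $ k)\<^sup>2 + (\<Sum>i\<in>UNIV - {k}. (x $ i)\<^sup>2)"
    by (subst sum.remove[of UNIV k]) auto
  then show ?thesis
    unfolding norm_perp by (simp add: norm_vec_def L2_set_def sum_nonneg)
qed

lemma norm_perp_le: "norm (perp k x) \<le> norm x"
proof (rule power2_le_imp_le)
  show "(norm (perp k x))\<^sup>2 \<le> (norm x)\<^sup>2"
    by (simp add: norm_eq_perp[of x k])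
qed simp

lemma in_cylinder: "x \<in> cylinder k I r \<longleftrightarrow> x $ k \<in> I \<and> norm (perp k x) < r"
  by (simp add: cylinder_def norm_perp)

lemma cylinder_eq: "cylinder k {a<..<b} r = {x. a < x $ k} \<inter> {x. x $ k < b} \<inter> perp k -` ball 0 r"
  by (auto simp: in_cylinder)

lemma open_cylinder [simp]: "open (cylinder k {a<..<b} r)"
proof -
  have "open (perp k -` ball 0 r)"
    by (intro open_vimage open_ball linear_continuous_on linear_conv_bounded_linear[THEN iffD1] linear_perp)
  then show ?thesis
    unfolding cylinder_eq by (intro open_Int open_Collect_less) (auto intro!: continuous_intros)
qed

lemma convex_cylinder:
  fixes k :: "'n::finite"
  shows "convex (cylinder k {a<..<b} r)"
proof -
  have "convex {x :: real ^ 'n. a < x $ k}" "convex {x :: real ^ 'n. x $ k < b}"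
    using convex_halfspace_gt[of a "axis k 1 :: real ^ 'n"] convex_halfspace_lt[of "axis k 1 :: real ^ 'n" b]
    by (simp_all add: inner_axis')
  then show ?thesis
    unfolding cylinder_eq by (intro convex_Int convex_linear_vimage linear_perp convex_ball)
qed

lemma cylinder_borel [measurable]: "cylinder k {a<..<b} r \<in> sets borel"
  by (simp add: borel_open)

lemma emeasure_lborel_affine:
  fixes S :: "'a::euclidean_space set"
  assumes [measurable]: "S \<in> sets borel" and c: "0 < c"
  shows "emeasure lborel S = ennreal (c ^ DIM('a)) * emeasure lborel {x. t + c *\<^sub>R x \<in> S}"
proof -
  have "emeasure lborel S = emeasure (density (distr lborel borel (\<lambda>x. t + c *\<^sub>R x)) (\<lambda>_. \<bar>c\<bar> ^ DIM('a))) S"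
    using c by (subst lborel_affine[of c t]) auto
  also have "\<dots> = ennreal (c ^ DIM('a)) * emeasure (distr lborel borel (\<lambda>x. t + c *\<^sub>R x)) S"
    using c by (simp add: emeasure_density nn_integral_cmult_indicator)
  also have "emeasure (distr lborel borel (\<lambda>x. t + c *\<^sub>R x)) S = emeasure lborel {x. t + c *\<^sub>R x \<in> S}"
    by (subst emeasure_distr) (auto simp: vimage_def)
  finally show ?thesis .
qed

lemma image_diff_ball:
  fixes z w :: "'a::real_normed_vector"
  shows "(\<lambda>y. y - z) ` ball w r = ball (w - z) r"
proof (intro equalityI subsetI)
  fix x assume "x \<in> ball (w - z) r"
  then have "x + z \<in> ball w r"
    by (simp add: dist_norm algebra_simps)
  then show "x \<in> (\<lambda>y. y - z) ` ball w r"
    by (rule rev_image_eqI) simp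
qed (auto simp: dist_norm algebra_simps)

context step_law
begin

lemma walk_potential_offset:
  assumes [measurable]: "\<phi> \<in> borel_measurable borel" "A \<in> sets borel"
  shows "walk_potential p A \<phi> x = \<phi> x + walk_potential p A (walk_step p A \<phi>) x"
proof -
  have "(walk_step p A ^^ Suc j) \<phi> x = (walk_step p A ^^ j) (walk_step p A \<phi>) x" for j
    by (simp only: funpow_Suc_right comp_apply)
  then show ?thesis
    unfolding walk_potential_def by (subst suminf_offset[of _ 1]) (simp_all del: funpow.simps(2))
qed

lemma occupation_ball_shift:
  "walk_potential p (ball z r) (indicator (ball z r)) z = walk_potential p (ball 0 r) (indicator (ball 0 r)) 0"
proof -
  have "(\<lambda>y. y - z) ` ball z r = ball 0 r"
    by (simp add: image_diff_ball)
  moreover have "(\<lambda>y. indicator (ball z r) (y + z) :: ennreal) = indicator (ball 0 r)"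
    by (auto simp: fun_eq_iff indicator_def dist_norm)
  ultimately show ?thesis
    using walk_potential_shift[of p "ball z r" "indicator (ball z r)" 0 z] by simp
qed

text \<open>These two bounds take the place of the Ikeda-Watanabe formula for the exit from a ball.\<close>

lemma exit_ball_le:
  assumes [measurable]: "V \<in> sets borel" and z: "z \<notin> V"
    and c: "\<And>x. x \<in> ball z r \<Longrightarrow> (\<integral>\<^sup>+w. indicator V (x + w) \<partial>p) \<le> c"
  shows "walk_potential p (ball z r) (indicator V) z
    \<le> c * walk_potential p (ball 0 r) (indicator (ball 0 r)) 0"
proof -
  have "walk_potential p (ball z r) (indicator V) z = walk_potential p (ball z r) (walk_step p (ball z r) (indicator V)) z"
    using z by (subst walk_potential_offset) auto
  also have "\<dots> \<le> walk_potential p (ball z r) (\<lambda>x. c * indicator (ball z r) x) z"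
    by (rule walk_potential_mono) (auto simp: walk_step_def c split: split_indicator)
  also have "\<dots> = c * walk_potential p (ball z r) (indicator (ball z r)) z"
    by (rule walk_potential_cmult) (auto intro!: borel_measurable_indicator)
  finally show ?thesis
    unfolding occupation_ball_shift[of z r] .
qed

lemma exit_ball_ge:
  assumes [measurable]: "V \<in> sets borel"
    and c: "\<And>x. x \<in> ball z r \<Longrightarrow> c \<le> (\<integral>\<^sup>+w. indicator V (x + w) \<partial>p)"
  shows "c * walk_potential p (ball 0 r) (indicator (ball 0 r)) 0
    \<le> walk_potential p (ball z r) (indicator V) z"
proof -
  have "c * walk_potential p (ball z r) (indicator (ball z r)) z
      = walk_potential p (ball z r) (\<lambda>x. c * indicator (ball z r) x) z"
    by (rule walk_potential_cmult[symmetric]) (auto intro!: borel_measurable_indicator)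
  also have "\<dots> \<le> walk_potential p (ball z r) (walk_step p (ball z r) (indicator V)) z"
    by (rule walk_potential_mono) (auto simp: walk_step_def c split: split_indicator)
  also have "\<dots> \<le> walk_potential p (ball z r) (indicator V) z"
    by (subst (2) walk_potential_offset) auto
  finally show ?thesis
    unfolding occupation_ball_shift[of z r] .
qed

end

lemma coord_refl_axis_nth:
  "coord_refl (axis i 1) h x $ l = (if l = i then 2 * h - x $ i else x $ l)"
  by (simp add: coord_refl_def inner_axis) (simp add: axis_def)

lemma coord_refl_transversal:
  assumes "i \<noteq> k" and s: "0 < s * (x $ i - h)" "0 \<le> s * h" and x: "x \<in> cylinder k I r"
  shows "coord_refl (axis i 1) h x \<in> cylinder k I r"
proof -
  let ?y = "coord_refl (axis i 1) h x"
  have "0 \<le> (s * (x $ i - h)) * (s * h)"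
    by (rule mult_nonneg_nonneg[OF less_imp_le[OF s(1)] s(2)])
  then have "0 \<le> s\<^sup>2 * ((x $ i - h) * h)"
    by (simp add: power2_eq_square mult_ac)
  moreover have "0 < s\<^sup>2"
    using s by auto
  ultimately have "0 \<le> (x $ i - h) * h"
    by (simp add: zero_le_mult_iff)
  then have *: "(2 * h - x $ i)\<^sup>2 \<le> (x $ i)\<^sup>2"
    by (simp add: power2_eq_square algebra_simps)
  have "norm (perp k ?y) \<le> norm (perp k x)"
    unfolding norm_perp L2_set_def using *
    by (intro real_sqrt_le_mono sum_mono) (auto simp: coord_refl_axis_nth)
  moreover have "?y $ k = x $ k"
    using assms(1) by (simp add: coord_refl_axis_nth)
  ultimately show ?thesis
    using x by (auto simp: in_cylinder)
qed

lemma coord_refl_longitudinal: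
  "coord_refl (axis k 1) h x \<in> cylinder k I r \<longleftrightarrow> 2 * h - x $ k \<in> I \<and> norm (perp k x) < r"
proof -
  have "perp k (coord_refl (axis k 1) h x) = perp k x"
    by (simp add: vec_eq_iff perp_nth coord_refl_axis_nth)
  then show ?thesis
    by (simp add: in_cylinder coord_refl_axis_nth)
qed

lemma exit_cylinder_le_axis:
  fixes p :: "(real ^ 'n) measure" and k :: 'n and a b r R :: real
  assumes p: "unimodal_law p m" and a: "0 \<le> a"
  defines "F \<equiv> walk_potential p (cylinder k {-R<..<R} r) (indicator (cylinder k {a<..<b} r))"
  shows "F x \<le> F (axis k (max 0 (x $ k)))"
proof -
  interpret unimodal_law p m
    by (rule p)
  define kill where "kill J x = (\<chi> i. if i \<in> J then 0 else x $ i)" for J and x :: "real ^ 'n"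
  have kill: "F x \<le> F (kill J x)" if "finite J" "k \<notin> J" for J
    using that
  proof (induction J rule: finite_induct)
    case empty
    have "kill {} x = x"
      by (simp add: kill_def)
    then show ?case
      by simp
  next
    case (insert i J)
    then have IH: "F x \<le> F (kill J x)" and ik: "i \<noteq> k"
      by auto
    show ?case
    proof (cases "x $ i = 0")
      case True
      then have "kill (insert i J) x = kill J x"
        by (auto simp: kill_def vec_eq_iff)
      then show ?thesis
        using IH by simp
    next
      case False
      define h where "h = x $ i / 2"
      have "kill (insert i J) x = coord_refl (axis i 1) h (kill J x)"
        using insert.hyps by (auto simp: kill_def vec_eq_iff coord_refl_axis_nth h_def)
      moreover have "F (kill J x) \<le> F (coord_refl (axis i 1) h (kill J x))"
        unfolding F_def
      proof (rule reflection_walk_potential_mono[where s="x $ i"])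
        show "0 < x $ i * (kill J x \<bullet> axis i 1 - h)"
          using False insert.hyps by (auto simp: kill_def h_def inner_axis zero_less_mult_iff)
        have "0 \<le> x $ i * h"
          by (simp add: h_def)
        then show "coord_refl (axis i 1) h v \<in> cylinder k I r"
          if "0 < x $ i * (v \<bullet> axis i 1 - h)" "v \<in> cylinder k I r" for v I
          using that ik by (intro coord_refl_transversal[where s="x $ i"]) (auto simp: inner_axis)
        then show "coord_refl (axis i 1) h v \<in> cylinder k {a<..<b} r"
          if "0 < x $ i * (v \<bullet> axis i 1 - h)" "v \<in> cylinder k {a<..<b} r" for v
          using that by blast
      qed (auto simp: axis_in_Basis_iff)
      ultimately show ?thesis
        using IH by (metis order_trans)
    qed
  qed
  have "kill (UNIV - {k}) x = axis k (x $ k)"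
    by (auto simp: kill_def vec_eq_iff axis_def)
  then have 1: "F x \<le> F (axis k (x $ k))"
    using kill[of "UNIV - {k}"] by simp
  show ?thesis
  proof (cases "0 \<le> x $ k")
    case True
    then show ?thesis
      using 1 by simp
  next
    case False
    define h where "h = x $ k / 2"
    have h: "h < 0"
      using False by (simp add: h_def)
    have "F (axis k (x $ k)) \<le> F (coord_refl (axis k 1) h (axis k (x $ k)))"
      unfolding F_def
    proof (rule reflection_walk_potential_mono[where s="-1"])
      show "coord_refl (axis k 1) h v \<in> cylinder k {-R<..<R} r"
        if "0 < - 1 * (v \<bullet> axis k 1 - h)" "v \<in> cylinder k {-R<..<R} r" for v
        using that h unfolding coord_refl_longitudinal by (auto simp: in_cylinder inner_axis)
      show "coord_refl (axis k 1) h v \<in> cylinder k {a<..<b} r"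
        if "0 < - 1 * (v \<bullet> axis k 1 - h)" "v \<in> cylinder k {a<..<b} r" for v
        using that h a by (auto simp: in_cylinder inner_axis)
      show "0 < - 1 * (axis k (x $ k) \<bullet> axis k 1 - h)"
        using h by (simp add: inner_axis_axis h_def)
    qed (auto simp: axis_in_Basis_iff)
    moreover have "coord_refl (axis k 1) h (axis k (x $ k)) = 0"
      by (simp add: vec_eq_iff coord_refl_axis_nth) (simp add: axis_def h_def)
    moreover have "axis k (max 0 (x $ k)) = (0 :: real ^ 'n)"
      using False by (simp add: axis_def vec_eq_iff)
    ultimately show ?thesis
      using 1 by (metis order_trans)
  qed
qed

lemma walk_exit_comparison:
  fixes p :: "(real ^ 'n) measure" and k :: 'n and \<alpha> r R :: real and S :: ennreal
  assumes p: "unimodal_law p m" and \<alpha>: "0 < \<alpha>" "\<alpha> \<le> 19/100" and R: "0 < R" and r: "0 \<le> r"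
    and ratio: "m ((2 - 3 * \<alpha>) * R) \<le> r * m (531/100 * \<alpha> * R)"
  defines "A \<equiv> cylinder k {-R<..<R} R" and "U \<equiv> cylinder k {(1 + \<alpha>) * R<..<(3 + \<alpha>) * R} R"
  defines "F \<equiv> walk_potential p A (indicator U)"
  assumes S: "\<And>t. 0 \<le> t \<Longrightarrow> t \<le> (1 - \<alpha>) * R \<Longrightarrow> F (axis k t) \<le> S"
  shows "F (- axis k ((1 - \<alpha>) * R)) \<le> ennreal (r / \<alpha> ^ CARD('n)) * F (axis k ((1 - \<alpha>) * R))
    + S * walk_potential p (ball 0 (\<alpha> * R)) (indicator (ball 0 (9 * R) - ball 0 (\<alpha> * R))) 0"
proof -
  interpret unimodal_law p m
    by (rule p)
  define x0 :: "real ^ 'n" where "x0 = axis k ((1 - \<alpha>) * R)"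
  have x0_nth: "x0 $ k = (1 - \<alpha>) * R" and x0_perp: "perp k x0 = 0"
    by (simp_all add: x0_def)
  have norm_x0: "norm x0 \<le> R"
  proof (rule power2_le_imp_le)
    have "((1 - \<alpha>) * R)\<^sup>2 \<le> (1 * R)\<^sup>2"
      using \<alpha> R by (intro power_mono mult_right_mono) auto
    then show "(norm x0)\<^sup>2 \<le> R\<^sup>2"
      by (simp add: norm_eq_perp[of x0 k] x0_nth x0_perp)
  qed (use R in simp)
  define \<rho>1 where "\<rho>1 = (2 - 3 * \<alpha>) * R"
  define \<rho>2 where "\<rho>2 = 531/100 * \<alpha> * R"
  have \<rho>: "0 < \<rho>1" "0 < \<rho>2"
    using \<alpha> R by (simp_all add: \<rho>1_def \<rho>2_def)
  let ?G = "walk_potential p (ball 0 (\<alpha> * R)) (indicator (ball 0 (\<alpha> * R))) 0"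
  let ?B = "ball (- x0) (\<alpha> * R)" and ?B' = "ball x0 (\<alpha> * R)"
  define V where "V = U \<union> (A \<inter> {y. (1 - \<alpha>) * R < y $ k})"
  define D where "D = cylinder k {(1 + \<alpha>) * R<..<(1 + \<alpha>) * R + (2 + \<alpha>) * \<alpha> * R} (\<alpha> * R)"
  define E where "E = cylinder k {0<..<(2 + \<alpha>) * R} R"
  have A'_eq: "A \<inter> {y. (1 - \<alpha>) * R < y $ k} = cylinder k {(1 - \<alpha>) * R<..<R} R"
  proof -
    have "0 < (1 - \<alpha>) * R"
      using \<alpha> R by simp
    then have "- R < y" if "(1 - \<alpha>) * R < y" for y
      using that R by linarith
    then show ?thesis
      by (auto simp: A_def in_cylinder)
  qed
  have [measurable]: "A \<in> sets borel" "U \<in> sets borel" "D \<in> sets borel" "E \<in> sets borel" "V \<in> sets borel"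
    unfolding V_def A'_eq by (auto simp: A_def U_def D_def E_def)
  have comp: "\<bar>y $ k - z $ k\<bar> \<le> norm (y - z)" for y z :: "real ^ 'n"
    using component_le_norm_cart[of "y - z" k] by simp
  have B: "- R < y $ k \<and> y $ k < - R + 2 * (\<alpha> * R) \<and> norm (perp k y) < \<alpha> * R" if "y \<in> ?B" for y
  proof -
    have y: "norm (y - (- x0)) < \<alpha> * R"
      using that by (simp add: dist_norm norm_minus_commute)
    have "\<bar>y $ k - (- x0) $ k\<bar> < \<alpha> * R"
      using comp[of y "- x0"] y by linarith
    moreover have "norm (perp k y) \<le> norm (y - (- x0))"
      using norm_perp_le[of k "y - (- x0)"] x0_perp by (simp add: perp_add)
    ultimately show ?thesis
      using y x0_nth by (auto simp: algebra_simps)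
  qed
  have B': "R - 2 * (\<alpha> * R) < y $ k \<and> y $ k < R \<and> norm (perp k y) < \<alpha> * R" if "y \<in> ?B'" for y
  proof -
    have y: "norm (y - x0) < \<alpha> * R"
      using that by (simp add: dist_norm norm_minus_commute)
    have "\<bar>y $ k - x0 $ k\<bar> < \<alpha> * R"
      using comp[of y x0] y by linarith
    moreover have "norm (perp k y) \<le> norm (y - x0)"
      using norm_perp_le[of k "y - x0"] x0_perp by (simp add: perp_diff)
    ultimately show ?thesis
      using y x0_nth by (auto simp: algebra_simps)
  qed
  have \<alpha>R: "0 < \<alpha> * R" "\<alpha> * R \<le> 19/100 * R"
    using \<alpha> R by auto
  have BA: "?B \<subseteq> A"
  proof
    fix y assume "y \<in> ?B"
    from B[OF this] have "- R < y $ k" "y $ k < R" "norm (perp k y) < R"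
      using \<alpha>R R by linarith+
    then show "y \<in> A"
      by (simp add: A_def in_cylinder)
  qed
  have B'A: "?B' \<subseteq> A"
  proof
    fix y assume "y \<in> ?B'"
    from B'[OF this] have "- R < y $ k" "y $ k < R" "norm (perp k y) < R"
      using \<alpha>R R by linarith+
    then show "y \<in> A"
      by (simp add: A_def in_cylinder)
  qed
  have AU: "A \<inter> U = {}"
    using \<alpha>R by (auto simp: A_def U_def in_cylinder algebra_simps)
  have F1: "F y \<le> 1" for y
    unfolding F_def using AU by (intro walk_potential_indicator_le_1) auto
  have F0: "F y = 0" if "y \<notin> A" "y \<notin> U" for y
    unfolding F_def using that by (subst walk_potential_unfold) (auto simp: walk_step_def)
  have FS: "F y \<le> S" if "y \<in> A" "y \<notin> V" for y
  proof -
    have "F y \<le> F (axis k (max 0 (y $ k)))"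
      unfolding F_def A_def U_def using \<alpha> R by (intro exit_cylinder_le_axis[OF p]) auto
    also have "\<dots> \<le> S"
      using that \<alpha> R by (intro S) (auto simp: V_def)
    finally show ?thesis .
  qed
  have "F (- x0) \<le> walk_potential p ?B (\<lambda>y. indicator (- ?B) y * F y) (- x0)"
    unfolding F_def using BA AU by (intro walk_potential_le_subset) auto
  also have "\<dots> \<le> walk_potential p ?B (\<lambda>y. indicator V y + S * indicator (A - ?B) y) (- x0)"
  proof (rule walk_potential_mono)
    fix y
    consider "y \<in> ?B" | "y \<in> V" | "y \<in> A - ?B" "y \<notin> V" | "y \<notin> A" "y \<notin> U"
      by (auto simp: V_def)
    then show "indicator (- ?B) y * F y \<le> indicator V y + S * indicator (A - ?B) y"
    proof cases
      case 2
      then show ?thesis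
        using F1[of y] by (auto simp: indicator_def intro: add_increasing2)
    next
      case 3
      then show ?thesis
        using FS[of y] by (auto simp: indicator_def)
    qed (auto simp: F0)
  qed simp
  also have "\<dots> = walk_potential p ?B (indicator V) (- x0) + S * walk_potential p ?B (indicator (A - ?B)) (- x0)"
  proof -
    have [measurable]: "A - ?B \<in> sets borel"
      by measurable
    show ?thesis
      by (subst walk_potential_add) (measurable, simp add: walk_potential_cmult)
  qed
  also have "walk_potential p ?B (indicator (A - ?B)) (- x0)
      \<le> walk_potential p (ball 0 (\<alpha> * R)) (indicator (ball 0 (9 * R) - ball 0 (\<alpha> * R))) 0"
  proof -
    have "walk_potential p ?B (indicator (A - ?B)) (0 + - x0)
        = walk_potential p ((\<lambda>y. y - - x0) ` ?B) (\<lambda>y. indicator (A - ?B) (y + - x0)) 0"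
      by (rule walk_potential_shift)
    also have "\<dots> \<le> walk_potential p (ball 0 (\<alpha> * R)) (indicator (ball 0 (9 * R) - ball 0 (\<alpha> * R))) 0"
    proof (rule walk_potential_mono)
      show "(\<lambda>y. y - - x0) ` ?B \<subseteq> ball 0 (\<alpha> * R)"
        unfolding image_diff_ball by simp
      fix y
      have "y \<in> ball 0 (9 * R) - ball 0 (\<alpha> * R)" if "y - x0 \<in> A - ?B"
      proof -
        have "norm (y - x0) \<le> \<bar>(y - x0) $ k\<bar> + norm (perp k (y - x0))"
        proof -
          have "y - x0 = ((y - x0) $ k) *\<^sub>R axis k 1 + perp k (y - x0)"
            by (simp add: perp_def)
          then show ?thesis
            using norm_triangle_ineq[of "((y - x0) $ k) *\<^sub>R axis k 1" "perp k (y - x0)"]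
            by (simp add: norm_axis_1)
        qed
        also have "\<dots> < R + R"
          using that by (intro add_strict_mono) (auto simp: A_def in_cylinder abs_less_iff)
        finally have "norm y < 9 * R"
          using norm_x0 norm_triangle_sub[of y x0] R by linarith
        moreover have "y \<notin> ball 0 (\<alpha> * R)"
          using that by (simp add: dist_norm)
        ultimately show ?thesis
          by simp
      qed
      then show "indicator (A - ?B) (y + - x0) \<le> (indicator (ball 0 (9 * R) - ball 0 (\<alpha> * R)) y :: ennreal)"
        by (auto simp: indicator_def)
    qed
    finally show ?thesis
      by simp
  qed
  also have "walk_potential p ?B (indicator V) (- x0) \<le> (ennreal (m \<rho>1) * emeasure lborel V) * ?G"
  proof (rule exit_ball_le)
    have "- x0 \<in> ?B"
      using \<alpha>R by simp
    have far: "\<rho>1 \<le> norm (v - x)" if "v \<in> V" "x \<in> ?B" for v x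
    proof -
      have "(1 - \<alpha>) * R < v $ k"
        using that(1) \<alpha>R R by (auto simp: V_def U_def in_cylinder algebra_simps)
      then show ?thesis
        using B[OF that(2)] comp[of v x] by (auto simp: \<rho>1_def algebra_simps)
    qed
    show "- x0 \<notin> V"
      using far[of "- x0" "- x0"] \<open>- x0 \<in> ?B\<close> \<rho> by auto
    show "(\<integral>\<^sup>+w. indicator V (x + w) \<partial>p) \<le> ennreal (m \<rho>1) * emeasure lborel V" if "x \<in> ?B" for x
      using far[OF _ that] \<rho> by (intro mass_le) auto
  qed simp
  also have "(ennreal (m \<rho>1) * emeasure lborel V) * ?G \<le> ennreal (r / \<alpha> ^ CARD('n)) * F x0"
  proof -
    have VE: "emeasure lborel V \<le> emeasure lborel E"
    proof -
      let ?U = "{x. R *\<^sub>R axis k 1 + x \<in> U}" and ?A = "{x. ((1 - \<alpha>) * R) *\<^sub>R axis k 1 + x \<in> A \<inter> {y. (1 - \<alpha>) * R < y $ k}}"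
      let ?U' = "cylinder k {\<alpha> * R<..<(2 + \<alpha>) * R} R" and ?A' = "cylinder k {0<..<\<alpha> * R} R"
      have U: "?U = ?U'"
        by (auto simp: U_def in_cylinder perp_add perp_scaleR algebra_simps)
      have A: "?A = ?A'"
        unfolding A'_eq by (simp add: set_eq_iff in_cylinder perp_add perp_scaleR) (auto simp: algebra_simps)
      have "emeasure lborel V \<le> emeasure lborel U + emeasure lborel (A \<inter> {y. (1 - \<alpha>) * R < y $ k})"
        unfolding V_def A'_eq by (intro emeasure_subadditive) auto
      also have "\<dots> = emeasure lborel ?U + emeasure lborel ?A"
        using emeasure_lborel_affine[of U 1 "R *\<^sub>R axis k 1"]
          emeasure_lborel_affine[of "A \<inter> {y. (1 - \<alpha>) * R < y $ k}" 1 "((1 - \<alpha>) * R) *\<^sub>R axis k 1"]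
        by (simp add: A'_eq)
      also have "\<dots> = emeasure lborel (?U' \<union> ?A')"
        unfolding U A by (rule plus_emeasure) (auto simp: in_cylinder)
      also have "\<dots> \<le> emeasure lborel E"
      proof (rule emeasure_mono)
        have "\<alpha> * R < (2 + \<alpha>) * R"
          using R by simp
        then show "?U' \<union> ?A' \<subseteq> E"
          using \<alpha>R(1) by (auto simp: E_def in_cylinder intro: less_trans)
      qed simp
      finally show ?thesis .
    qed
    have DE: "emeasure lborel D = ennreal (\<alpha> ^ CARD('n)) * emeasure lborel E"
    proof -
      have "{x. ((1 + \<alpha>) * R) *\<^sub>R axis k 1 + \<alpha> *\<^sub>R x \<in> D} = E"
        using \<alpha> by (auto simp: D_def E_def in_cylinder perp_add perp_scaleR mult_less_cancel_left_pos mult.left_commute[of _ \<alpha>] mult.assoc zero_less_mult_iff)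
      then show ?thesis
        using emeasure_lborel_affine[of D \<alpha> "((1 + \<alpha>) * R) *\<^sub>R axis k 1"] \<alpha> by simp
    qed
    have "(ennreal (m \<rho>2) * emeasure lborel D) * ?G \<le> walk_potential p ?B' (indicator D) x0"
    proof (rule exit_ball_ge)
      fix x assume x: "x \<in> ?B'"
      show "ennreal (m \<rho>2) * emeasure lborel D \<le> (\<integral>\<^sup>+w. indicator D (x + w) \<partial>p)"
      proof (rule mass_ge)
        fix u assume u: "u \<in> D"
        have u1: "0 \<le> (u - x0) $ k" "(u - x0) $ k \<le> (4 + \<alpha>) * (\<alpha> * R)"
          using u x0_nth \<alpha>R by (auto simp: D_def in_cylinder algebra_simps)
        have u2: "norm (perp k (u - x0)) \<le> \<alpha> * R"
          using u x0_perp by (auto simp: D_def in_cylinder perp_diff)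
        have "(norm (u - x0))\<^sup>2 \<le> ((4 + \<alpha>) * (\<alpha> * R))\<^sup>2 + (\<alpha> * R)\<^sup>2"
          unfolding norm_eq_perp[of "u - x0" k] using u1 u2 by (intro add_mono power_mono) auto
        also have "\<dots> = ((4 + \<alpha>)\<^sup>2 + 1) * (\<alpha> * R)\<^sup>2"
          by (simp add: power2_eq_square algebra_simps)
        also have "\<dots> \<le> (431/100)\<^sup>2 * (\<alpha> * R)\<^sup>2"
        proof (rule mult_right_mono)
          have "(4 + \<alpha>)\<^sup>2 \<le> (4 + 19/100)\<^sup>2"
            using \<alpha> by (intro power_mono) auto
          then show "(4 + \<alpha>)\<^sup>2 + 1 \<le> (431/100)\<^sup>2"
            by (simp add: power2_eq_square)
        qed simp
        finally have "(norm (u - x0))\<^sup>2 \<le> (431/100 * (\<alpha> * R))\<^sup>2"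
          by (simp only: power_mult_distrib)
        then have "norm (u - x0) \<le> 431/100 * (\<alpha> * R)"
          by (rule power2_le_imp_le) (use \<alpha>R in simp)
        moreover have "norm (x0 - x) \<le> \<alpha> * R"
          using x by (simp add: dist_norm)
        ultimately show "norm (u - x) \<le> \<rho>2"
          using norm_triangle_ineq[of "u - x0" "x0 - x"] by (simp add: \<rho>2_def)
      qed (use \<rho> in auto)
    qed simp
    also have "\<dots> \<le> F x0"
      unfolding F_def
    proof (rule walk_potential_mono[OF B'A])
      have "(2 + \<alpha>) * \<alpha> * R \<le> 2 * R"
      proof -
        have "(2 + \<alpha>) * \<alpha> \<le> (2 + 1) * (19/100)"
          using \<alpha> by (intro mult_mono) auto
        then show ?thesis
          using R by (intro mult_right_mono) auto
      qed
      moreover have "\<alpha> * R < R" "(3 + \<alpha>) * R = (1 + \<alpha>) * R + 2 * R"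
        using \<alpha>R R by (simp_all add: algebra_simps)
      ultimately have "u \<in> U" if "u \<in> D" for u
        using that unfolding D_def U_def in_cylinder greaterThanLessThan_iff by linarith
      then have "D \<subseteq> U"
        by blast
      then show "(indicator D y :: ennreal) \<le> indicator U y" for y
        by (auto simp: indicator_def)
    qed
    finally have lower: "(ennreal (m \<rho>2) * emeasure lborel D) * ?G \<le> F x0" .
    have "ennreal (m \<rho>1) * emeasure lborel V \<le> ennreal (r * m \<rho>2) * emeasure lborel E"
      using ratio VE by (intro mult_mono ennreal_leI) (auto simp: \<rho>1_def \<rho>2_def)
    also have "\<dots> = ennreal (r / \<alpha> ^ CARD('n)) * (ennreal (m \<rho>2) * emeasure lborel D)"
    proof -
      have "r * m \<rho>2 = (r / \<alpha> ^ CARD('n)) * (m \<rho>2 * \<alpha> ^ CARD('n))"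
        using \<alpha> by simp
      then have "ennreal (r * m \<rho>2) = ennreal (r / \<alpha> ^ CARD('n)) * (ennreal (m \<rho>2) * ennreal (\<alpha> ^ CARD('n)))"
        using r \<alpha> m_nonneg[OF \<rho>(2)] by (simp only: ennreal_mult zero_le_divide_iff zero_le_power less_imp_le mult_nonneg_nonneg simp_thms)
      then show ?thesis
        unfolding DE by (simp add: mult.assoc)
    qed
    finally have "(ennreal (m \<rho>1) * emeasure lborel V) * ?G
        \<le> ennreal (r / \<alpha> ^ CARD('n)) * ((ennreal (m \<rho>2) * emeasure lborel D) * ?G)"
      by (subst mult.assoc[symmetric]) (rule mult_right_mono, simp_all)
    also have "\<dots> \<le> ennreal (r / \<alpha> ^ CARD('n)) * F x0"
      by (intro mult_left_mono lower) simp
    finally show ?thesis .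
  qed
  finally show ?thesis
    by (simp add: x0_def add_mono mult_left_mono)
qed

theorem proposition1p2:
  fixes M :: "'w measure"
    and X :: "real \<Rightarrow> 'w \<Rightarrow> real ^ 'n"
    and j :: "real \<Rightarrow> real"
    and c \<alpha> R :: real
    and k :: 'n
  assumes "isotropic_unimodal_levy_process M X"
    and "jump_density M X j"
    and "0 < sqrt 29 * \<alpha>" and "sqrt 29 * \<alpha> \<le> c" and "c < 1"
    and "0 < R"
    and "0 < j (c * R)"
  shows "let e\<^sub>1 = axis k 1;
             \<A> = cylinder k {- R<..<R} R;
             \<U> = cylinder k {(1 + \<alpha>) * R<..<(3 + \<alpha>) * R} R;
             f = (\<lambda>x. exit_prob M X x \<A> \<U>);
             x\<^sub>0 = ((1 - \<alpha>) * R) *\<^sub>R e\<^sub>1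
         in f (- x\<^sub>0) \<le>
            (\<alpha> powi (- int CARD('n)) * (j R / j (c * R)) +
             2 * exit_prob M X 0 (ball 0 (\<alpha> * R)) (ball 0 (10 * R))) *
            (SUP x \<in> ball 0 ((1 - \<alpha> / 2) * R). f x)"
proof -
  interpret isotropic_unimodal_levy_process M X
    by (rule assms(1))
  note j = assms(2) and R = assms(6) and jc = assms(7)
  define A :: "(real ^ 'n) set" where "A = cylinder k {- R<..<R} R"
  define U :: "(real ^ 'n) set" where "U = cylinder k {(1 + \<alpha>) * R<..<(3 + \<alpha>) * R} R"
  define f where "f x = exit_prob M X x A U" for x
  define s where "s = (SUP x\<in>ball 0 ((1 - \<alpha> / 2) * R). f x)"
  define q where "q = exit_prob M X 0 (ball 0 (\<alpha> * R)) (ball 0 (10 * R))"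
  define x0 :: "real ^ 'n" where "x0 = axis k ((1 - \<alpha>) * R)"
  have \<alpha>0: "0 < \<alpha>"
    using assms(3) by (simp add: zero_less_mult_iff)
  have sqrt29: "538/100 \<le> sqrt 29"
    by (rule real_le_rsqrt) (simp add: power2_eq_square)
  have \<alpha>c: "538/100 * \<alpha> \<le> c"
    using mult_right_mono[OF sqrt29, of \<alpha>] \<alpha>0 assms(4) by linarith
  then have \<alpha>1: "\<alpha> \<le> 19/100"
    using assms(5) by linarith
  have c0: "0 < c"
    using \<alpha>c \<alpha>0 by linarith
  define \<rho>1 where "\<rho>1 = (2 - 3 * \<alpha>) * R"
  define \<rho>2 where "\<rho>2 = 531/100 * \<alpha> * R"
  have \<rho>: "0 < \<rho>2" "\<rho>2 < c * R" "R < \<rho>1" "0 < c * R" "c * R < R"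
    using R \<alpha>0 \<alpha>1 \<alpha>c c0 assms(5) by (auto simp: \<rho>1_def \<rho>2_def intro: mult_strict_right_mono)
  have jR: "0 \<le> j R"
    using j R by (auto simp: jump_density_def)
  have f01: "0 \<le> f x" "f x \<le> 1" for x
    using prob_space.prob_le_1[OF prob_space_completion] by (auto simp: f_def exit_prob_def)
  have bdd: "bdd_above (f ` ball 0 ((1 - \<alpha> / 2) * R))"
    using f01 by (auto intro!: bdd_aboveI[of _ 1])
  have f_le_s: "f x \<le> s" if "norm x < (1 - \<alpha> / 2) * R" for x
    unfolding s_def using that by (intro cSUP_upper bdd) simp
  have q0: "0 \<le> q"
    by (simp add: q_def exit_prob_def)
  have A: "open A" "convex A" and U: "open U" "negligible (frontier U)"
    by (auto simp: A_def U_def convex_cylinder intro!: negligible_convex_frontier)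
  have sep: "separated (\<alpha> * R) A U"
    unfolding separated_def
  proof (intro conjI ballI)
    show "0 < \<alpha> * R"
      using \<alpha>0 R by simp
    fix a u assume "a \<in> A" "u \<in> U"
    then have "a $ k < R" "R + \<alpha> * R < u $ k"
      by (auto simp: A_def U_def in_cylinder algebra_simps)
    moreover have "\<bar>u $ k - a $ k\<bar> \<le> dist a u"
      using component_le_norm_cart[of "u - a" k] by (simp add: dist_norm norm_minus_commute)
    ultimately show "\<alpha> * R \<le> dist a u"
      by linarith
  qed
  then have disj: "A \<inter> U = {}"
    unfolding separated_def by force
  define K where "K = axis k ` {0..(1 - \<alpha>) * R}"
  have scaleR_axis: "t *\<^sub>R (axis k 1 :: real ^ 'n) = axis k t" for t
    by (simp add: vec_eq_iff axis_def)
  have norm_axis': "norm (axis k t :: real ^ 'n) = \<bar>t\<bar>" for t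
    by (subst scaleR_axis[symmetric]) (simp add: norm_axis_1)
  have x0_eq: "x0 = ((1 - \<alpha>) * R) *\<^sub>R axis k 1"
    by (simp add: x0_def scaleR_axis)
  have step_bound: "f (- x0) \<le> (j R + \<delta>) / (j (c * R) - \<delta>) / \<alpha> ^ CARD('n) * (s + \<delta>) + (s + \<delta>) * (q + \<delta>) + \<delta>"
    if \<delta>: "0 < \<delta>" "\<delta> < j (c * R)" for \<delta>
  proof -
    define r where "r = (j R + \<delta>) / (j (c * R) - \<delta>)"
    have r: "0 \<le> r"
      using \<delta> jR by (simp add: r_def)
    have s0: "0 \<le> s"
      using f_le_s[of 0] f01(1)[of 0] \<alpha>1 R by (simp add: zero_less_mult_iff)
    let ?F = "\<lambda>n. walk_potential (step (1 / 2^n)) A (indicator U)"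
    have "\<forall>\<^sub>F n in sequentially. \<forall>v\<in>K. ?F n v \<le> ennreal (s + \<delta>)"
    proof -
      have "\<exists>N. \<forall>n\<ge>N. \<forall>v\<in>ball x (1 / Suc N). ?F n v \<le> ennreal (s + \<delta>)" if x: "x \<in> K" for x
      proof -
        obtain t where t: "x = axis k t" "0 \<le> t" "t \<le> (1 - \<alpha>) * R"
          using x by (auto simp: K_def)
        have "\<alpha> * R > 0"
          using \<alpha>0 R by simp
        then have t1: "t < (1 - \<alpha> / 2) * R" "t < R"
          using t by (auto simp: algebra_simps)
        have "x \<in> A"
          using t t1 R by (auto simp: A_def in_cylinder)
        then obtain N where "\<forall>n\<ge>N. \<forall>v\<in>ball x (1 / Suc N). ?F n v \<le> ennreal (exit_prob M X x A U + \<delta>)"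
          using grid_exit_le_exit_prob_nearby[OF A U sep _ \<delta>(1)] by blast
        moreover have "exit_prob M X x A U \<le> s"
          using f_le_s[of x] t t1 by (simp add: f_def norm_axis')
        then have "ennreal (exit_prob M X x A U + \<delta>) \<le> ennreal (s + \<delta>)"
          by (intro ennreal_leI) simp
        ultimately show ?thesis
          using order_trans by blast
      qed
      then obtain N where N: "\<And>x n v. x \<in> K \<Longrightarrow> N x \<le> n \<Longrightarrow> v \<in> ball x (1 / Suc (N x)) \<Longrightarrow> ?F n v \<le> ennreal (s + \<delta>)"
        by metis
      have "compact K"
        unfolding K_def
      proof (rule compact_continuous_image)
        have "continuous_on {0..(1 - \<alpha>) * R} (\<lambda>t. t *\<^sub>R (axis k 1 :: real ^ 'n))"
          by (intro continuous_intros)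
        then show "continuous_on {0..(1 - \<alpha>) * R} (axis k :: real \<Rightarrow> real ^ 'n)"
          by (simp add: scaleR_axis)
      qed simp
      then obtain C where C: "C \<subseteq> K" "finite C" "K \<subseteq> (\<Union>x\<in>C. ball x (1 / Suc (N x)))"
        by (rule compactE_image[of K K "\<lambda>x. ball x (1 / Suc (N x))"]) auto
      have "\<forall>\<^sub>F n in sequentially. \<forall>x\<in>C. N x \<le> n"
        using C(2) by (intro eventually_ball_finite ballI eventually_ge_at_top)
      then show ?thesis
      proof eventually_elim
        case (elim n)
        then show ?case
          using C N by blast
      qed
    qed
    moreover have "\<forall>\<^sub>F n in sequentially. ennreal (f (- x0)) \<le> ?F n (- x0) + ennreal \<delta>"
      unfolding f_def by (rule exit_prob_le_grid[OF A(1) U(1) disj \<delta>(1)])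
    moreover have le: "\<forall>\<^sub>F n in sequentially. \<forall>m. unimodal_law (step (1 / 2^n)) m \<longrightarrow> 2^n * m \<rho>1 \<le> j R + \<delta>"
      using eventually_density_le[OF j \<rho>(4) jc \<rho>(5) \<rho>(3) \<delta>(1)] .
    moreover have ge: "\<forall>\<^sub>F n in sequentially. \<forall>m. unimodal_law (step (1 / 2^n)) m \<longrightarrow> j (c * R) - \<delta> \<le> 2^n * m \<rho>2"
      using eventually_density_ge[OF j \<rho>(1,2) jc \<delta>] .
    moreover have "\<forall>\<^sub>F n in sequentially. walk_potential (step (1 / 2^n)) (ball 0 (\<alpha> * R)) (indicator (ball 0 (9 * R) - ball 0 (\<alpha> * R))) 0
        \<le> ennreal (q + \<delta>)"
    proof -
      obtain n where n: "\<forall>m. unimodal_law (step (1 / 2^n)) m \<longrightarrow> j (c * R) - \<delta> \<le> 2^n * m \<rho>2"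
        using eventually_happens'[OF sequentially_bot ge] by blast
      obtain m where m: "unimodal_law (step (1 / 2^n)) m"
        using step_unimodal[of "1 / 2^n"] by auto
      then have "0 < 2^n * m \<rho>2"
        using n \<delta> by fastforce
      then have "0 < m \<rho>2"
        by (simp add: zero_less_mult_iff)
      have "\<alpha> * R \<le> 19/100 * R"
        using \<alpha>1 R by (intro mult_right_mono) auto
      then show ?thesis
        unfolding q_def using \<alpha>0 R by (intro grid_exit_ball_le_exit_prob[OF m \<rho>(1) \<open>0 < m \<rho>2\<close> _ _ _ \<delta>(1)]) auto
    qed
    ultimately have "\<forall>\<^sub>F n in sequentially. f (- x0) \<le> r / \<alpha> ^ CARD('n) * (s + \<delta>) + (s + \<delta>) * (q + \<delta>) + \<delta>"
    proof eventually_elim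
      case (elim n)
      obtain m where m: "unimodal_law (step (1 / 2^n)) m"
        using step_unimodal[of "1 / 2^n"] by auto
      have "2^n * m \<rho>1 \<le> r * (j (c * R) - \<delta>)"
        using elim(3) m \<delta> by (simp add: r_def)
      also have "\<dots> \<le> r * (2^n * m \<rho>2)"
        using elim(4) m r by (intro mult_left_mono) auto
      finally have "2^n * m \<rho>1 \<le> 2^n * (r * m \<rho>2)"
        by (simp add: mult_ac)
      then have ratio: "m \<rho>1 \<le> r * m \<rho>2"
        by (rule mult_left_le_imp_le) simp
      have K: "?F n (axis k t) \<le> ennreal (s + \<delta>)" if "0 \<le> t" "t \<le> (1 - \<alpha>) * R" for t
        using elim(1) that by (auto simp: K_def)
      have "?F n (- x0) \<le> ennreal (r / \<alpha> ^ CARD('n)) * ?F n x0 + ennreal (s + \<delta>) *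
          walk_potential (step (1 / 2^n)) (ball 0 (\<alpha> * R)) (indicator (ball 0 (9 * R) - ball 0 (\<alpha> * R))) 0"
        unfolding A_def U_def x0_def
        by (rule walk_exit_comparison[OF m \<alpha>0 \<alpha>1 R r ratio[unfolded \<rho>1_def \<rho>2_def]])
           (rule K[unfolded A_def U_def])
      also have "\<dots> \<le> ennreal (r / \<alpha> ^ CARD('n)) * ennreal (s + \<delta>) + ennreal (s + \<delta>) * ennreal (q + \<delta>)"
        using K[of "(1 - \<alpha>) * R"] elim(5) \<alpha>1 R by (intro add_mono mult_left_mono) (auto simp: x0_def)
      also have "\<dots> = ennreal (r / \<alpha> ^ CARD('n) * (s + \<delta>) + (s + \<delta>) * (q + \<delta>))"
      proof -
        have nn: "0 \<le> r / \<alpha> ^ CARD('n)" "0 \<le> s + \<delta>" "0 \<le> q + \<delta>"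
          using r \<alpha>0 s0 q0 \<delta> by auto
        show ?thesis
          by (subst ennreal_plus) (simp_all only: ennreal_mult nn mult_nonneg_nonneg)
      qed
      finally have "?F n (- x0) + ennreal \<delta> \<le> ennreal (r / \<alpha> ^ CARD('n) * (s + \<delta>) + (s + \<delta>) * (q + \<delta>)) + ennreal \<delta>"
        by (rule add_right_mono)
      with elim(2) have "ennreal (f (- x0)) \<le> ennreal (r / \<alpha> ^ CARD('n) * (s + \<delta>) + (s + \<delta>) * (q + \<delta>)) + ennreal \<delta>"
        by (rule order_trans)
      also have "\<dots> = ennreal (r / \<alpha> ^ CARD('n) * (s + \<delta>) + (s + \<delta>) * (q + \<delta>) + \<delta>)"
        using r \<alpha>0 s0 q0 \<delta> by (intro ennreal_plus[symmetric]) auto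
      finally show ?case
        using r \<alpha>0 s0 q0 \<delta> by (subst (asm) ennreal_le_iff) auto
    qed
    then show ?thesis
      unfolding r_def using eventually_happens'[OF sequentially_bot] by blast
  qed
  have "((\<lambda>\<delta>. (j R + \<delta>) / (j (c * R) - \<delta>) / \<alpha> ^ CARD('n) * (s + \<delta>) + (s + \<delta>) * (q + \<delta>) + \<delta>)
      \<longlongrightarrow> (j R + 0) / (j (c * R) - 0) / \<alpha> ^ CARD('n) * (s + 0) + (s + 0) * (q + 0) + 0) (at_right 0)"
    using jc \<alpha>0 by (intro tendsto_intros) auto
  moreover have "\<forall>\<^sub>F \<delta> in at_right 0. f (- x0)
      \<le> (j R + \<delta>) / (j (c * R) - \<delta>) / \<alpha> ^ CARD('n) * (s + \<delta>) + (s + \<delta>) * (q + \<delta>) + \<delta>"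
    unfolding eventually_at_right_field using step_bound jc by blast
  ultimately have "f (- x0) \<le> (j R + 0) / (j (c * R) - 0) / \<alpha> ^ CARD('n) * (s + 0) + (s + 0) * (q + 0) + 0"
    by (rule tendsto_lowerbound) simp
  also have "\<dots> = (\<alpha> powi (- int CARD('n)) * (j R / j (c * R)) + q) * s"
    by (simp add: power_int_minus field_simps)
  also have "\<dots> \<le> (\<alpha> powi (- int CARD('n)) * (j R / j (c * R)) + 2 * q) * s"
  proof (rule mult_right_mono)
    show "0 \<le> s"
      using f_le_s[of 0] f01(1)[of 0] \<alpha>1 R by (simp add: zero_less_mult_iff)
  qed (use q0 in simp)
  finally show ?thesis
    unfolding Let_def x0_eq s_def q_def f_def A_def U_def .
qed

end
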